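(* Let $p:\mathbb{C}^n\to\mathbb{R}$ be a nonnegative weighted homogeneous balanced polynomial with respect to a tuple $m=(m_1,\dots,m_n)$ of positive integers, and let $\mathcal{E}_p=\{(z,w)\in\mathbb{C}\times\mathbb{C}^n : |z|^2+p(w)<1\}$. Then the map $T:\mathcal{Y}_p\to A^2(\mathcal{E}_p)$ given, for $a=(a_k)_{k=0}^\infty\in\mathcal{Y}_p$, by $$Ta(z,w)=\sum_{k=0}^{\infty}a_k(w)z^k,\quad \text{for all } (z,w)\in\mathcal{E}_p,$$ is an isometric isomorphism of Hilbert spaces.
   Context: $\mathbb{N}=\{0,1,2,\dots\}$; $dV$ denotes Lebesgue measure; $\mathcal{O}(\Omega)$ is the space of holomorphic functions on $\Omega$. For $\alpha\in\mathbb{N}^n$ the weight with respect to $m$ is $\mathrm{wt}_m(\alpha)=\sum_{i=1}^n\frac{\alpha_i}{2m_i}$. A real-valued polynomial $p:\mathbb{C}^n\to\mathbb{R}$ is weighted homogeneous balanced with respect to $m$ if it has the form $p(w)=\sum_{\mathrm{wt}_m(\alpha)=\mathrm{wt}_m(\beta)=1/2}C_{\alpha,\beta}w^\alpha\overline{w}^\beta$. For a domain $\Omega$ and a continuous function $\lambda>0$ on $\Omega$, $A^2(\Omega,\lambda)=\{f\in\mathcal{O}(\Omega):\int_\Omega|f|^2\lambda\,dV<\infty\}$ is the weighted Bergman space (with its natural norm), and $A^2(\Omega)=A^2(\Omega,1)$. Let $\mathbb{B}_p=\{w\in\mathbb{C}^n: p(w)<1\}$. For $k\in\mathbb{N}$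 let $\mathcal{W}_p(k)=A^2(\mathbb{B}_p,(1-p)^{k+1})$. $\mathcal{Y}_p$ is the Hilbert space of sequences $a=(a_k)_{k=0}^\infty$ with $a_k\in\mathcal{W}_p(k)$ for each $k\in\mathbb{N}$ and $$\|a\|_{\mathcal{Y}_p}^2:=\pi\sum_{k=0}^\infty\frac{1}{k+1}\int_{\mathbb{B}_p}|a_k(w)|^2(1-p(w))^{k+1}\,dV(w)<\infty.$$ The case $n=0$ is allowed: then $\mathbb{C}^0$ is a single point of unit mass, $p\equiv0$, and $\mathcal{W}_p(k)=\mathbb{C}$ for all $k$. *)

theory Defs
  imports "HOL-Complex_Analysis.Complex_Analysis" "HOL-Library.Function_Algebras"
begin

text \<open>
  Vectors in \<open>\<complex>\<^sup>n\<close> are functions on \<open>nat\<close> with the fixed value \<open>undefined\<close> at all indices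
  \<open>i \<ge> n\<close>. This lets \<open>n\<close> be an ordinary natural number and includes \<open>n = 0\<close>, where
  \<open>Cn 0\<close> is a single point and \<open>Cvol 0\<close> gives it mass one.
  The topology that \<open>Cn n\<close> inherits from the product topology on \<open>nat \<Rightarrow> complex\<close> is the
  Euclidean one. The product \<open>\<complex> \<times> \<complex>\<^sup>n\<close> is \<open>Cn (Suc n)\<close>: the pair \<open>(z, w)\<close> is \<open>case_nat z w\<close>,
  and the components of \<open>v\<close> are \<open>v 0\<close> and \<open>v \<circ> Suc\<close>.
\<close>

definition Cn :: "nat \<Rightarrow> (nat \<Rightarrow> complex) set" where
  "Cn n = {..<n} \<rightarrow>\<^sub>E UNIV"

definition Cvol :: "nat \<Rightarrow> (nat \<Rightarrow> complex) measure" where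
  "Cvol n = Pi\<^sub>M {..<n} (\<lambda>_. lborel)"

text \<open>By Osgood's lemma this is joint holomorphy.\<close>

definition holomorphic_Cn :: "nat \<Rightarrow> (nat \<Rightarrow> complex) set \<Rightarrow> ((nat \<Rightarrow> complex) \<Rightarrow> complex) \<Rightarrow> bool" where
  "holomorphic_Cn n \<Omega> f \<longleftrightarrow> continuous_on \<Omega> f \<and>
     (\<forall>w\<in>\<Omega>. \<forall>i<n. (\<lambda>\<zeta>. f (w(i := \<zeta>))) holomorphic_on {\<zeta>. w(i := \<zeta>) \<in> \<Omega>})"

text \<open>The inner product \<open>ip\<close> is linear in its first argument and only meaningful on \<open>H\<close>.
  Taking \<open>cmod\<close> instead of \<open>Re\<close> makes no difference on \<open>H\<close> and keeps the norm
  nonnegative on the whole type.\<close>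

definition hnorm :: "('v \<Rightarrow> 'v \<Rightarrow> complex) \<Rightarrow> 'v \<Rightarrow> real" where
  "hnorm ip x = sqrt (cmod (ip x x))"

definition hilbert_space ::
  "(complex \<Rightarrow> 'v \<Rightarrow> 'v) \<Rightarrow> 'v::ab_group_add set \<Rightarrow> ('v \<Rightarrow> 'v \<Rightarrow> complex) \<Rightarrow> bool" where
  "hilbert_space scl H ip \<longleftrightarrow>
     vector_space scl \<and> module.subspace scl H \<and>
     (\<forall>x\<in>H. \<forall>y\<in>H. \<forall>z\<in>H. ip (x + y) z = ip x z + ip y z) \<and>
     (\<forall>c. \<forall>x\<in>H. \<forall>y\<in>H. ip (scl c x) y = c * ip x y) \<and>
     (\<forall>x\<in>H. \<forall>y\<in>H. ip y x = cnj (ip x y)) \<and>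
     (\<forall>x\<in>H. 0 \<le> Re (ip x x)) \<and>
     (\<forall>x\<in>H. ip x x = 0 \<longrightarrow> x = 0) \<and>
     Metric_space.mcomplete H (\<lambda>x y. hnorm ip (x - y))"

definition isometric_isomorphism ::
  "(complex \<Rightarrow> 'v \<Rightarrow> 'v) \<Rightarrow> 'v::ab_group_add set \<Rightarrow> ('v \<Rightarrow> 'v \<Rightarrow> complex) \<Rightarrow>
   (complex \<Rightarrow> 'u \<Rightarrow> 'u) \<Rightarrow> 'u::ab_group_add set \<Rightarrow> ('u \<Rightarrow> 'u \<Rightarrow> complex) \<Rightarrow> ('v \<Rightarrow> 'u) \<Rightarrow> bool" where
  "isometric_isomorphism scl\<^sub>1 H\<^sub>1 ip\<^sub>1 scl\<^sub>2 H\<^sub>2 ip\<^sub>2 T \<longleftrightarrow>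
     hilbert_space scl\<^sub>1 H\<^sub>1 ip\<^sub>1 \<and> hilbert_space scl\<^sub>2 H\<^sub>2 ip\<^sub>2 \<and>
     bij_betw T H\<^sub>1 H\<^sub>2 \<and>
     (\<forall>x\<in>H\<^sub>1. \<forall>y\<in>H\<^sub>1. T (x + y) = T x + T y) \<and>
     (\<forall>c. \<forall>x\<in>H\<^sub>1. T (scl\<^sub>1 c x) = scl\<^sub>2 c (T x)) \<and>
     (\<forall>x\<in>H\<^sub>1. hnorm ip\<^sub>2 (T x) = hnorm ip\<^sub>1 x)"

text \<open>A function on \<open>\<Omega>\<close> is represented by its extension by \<open>0\<close>, so that equality of functions
  on \<open>\<Omega>\<close> is equality in HOL and the pointwise operations are those of the function type.\<close>

definition A2 :: "nat \<Rightarrow> (nat \<Rightarrow> complex) set \<Rightarrow> ((nat \<Rightarrow> complex) \<Rightarrow> real) \<Rightarrow>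
    ((nat \<Rightarrow> complex) \<Rightarrow> complex) set" where
  "A2 n \<Omega> \<mu> = {f. holomorphic_Cn n \<Omega> f \<and> (\<forall>w. w \<notin> \<Omega> \<longrightarrow> f w = 0) \<and>
      set_integrable (Cvol n) \<Omega> (\<lambda>w. (cmod (f w))\<^sup>2 * \<mu> w)}"

definition A2_inner :: "nat \<Rightarrow> (nat \<Rightarrow> complex) set \<Rightarrow> ((nat \<Rightarrow> complex) \<Rightarrow> real) \<Rightarrow>
    ((nat \<Rightarrow> complex) \<Rightarrow> complex) \<Rightarrow> ((nat \<Rightarrow> complex) \<Rightarrow> complex) \<Rightarrow> complex" where
  "A2_inner n \<Omega> \<mu> f g = (LINT w:\<Omega>|Cvol n. f w * cnj (g w) * of_real (\<mu> w))"

definition A2_scale :: "complex \<Rightarrow> ((nat \<Rightarrow> complex) \<Rightarrow> complex) \<Rightarrow> (nat \<Rightarrow> complex) \<Rightarrow> complex" where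
  "A2_scale c f = (\<lambda>w. c * f w)"

lemma A2_inner_self:
  "A2_inner n \<Omega> \<mu> f f = of_real (LINT w:\<Omega>|Cvol n. (cmod (f w))\<^sup>2 * \<mu> w)"
proof -
  have "A2_inner n \<Omega> \<mu> f f =
      (LINT w|Cvol n. of_real (indicator \<Omega> w *\<^sub>R ((cmod (f w))\<^sup>2 * \<mu> w)))"
    unfolding A2_inner_def set_lebesgue_integral_def
    by (intro Bochner_Integration.integral_cong refl)
       (simp add: complex_norm_square[symmetric] scaleR_conv_of_real)
  also have "\<dots> = of_real (LINT w:\<Omega>|Cvol n. (cmod (f w))\<^sup>2 * \<mu> w)"
    unfolding set_lebesgue_integral_def by (rule integral_complex_of_real)
  finally show ?thesis .
qed

lemma hnorm_A2:
  assumes "\<And>w. w \<in> \<Omega> \<Longrightarrow> 0 \<le> \<mu> w"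
  shows "(hnorm (A2_inner n \<Omega> \<mu>) f)\<^sup>2 = (LINT w:\<Omega>|Cvol n. (cmod (f w))\<^sup>2 * \<mu> w)"
proof -
  have "0 \<le> (LINT w:\<Omega>|Cvol n. (cmod (f w))\<^sup>2 * \<mu> w)"
    unfolding set_lebesgue_integral_def
    by (intro Bochner_Integration.integral_nonneg) (auto simp: indicator_def assms)
  then show ?thesis
    by (simp add: hnorm_def A2_inner_self)
qed

definition wt :: "nat \<Rightarrow> (nat \<Rightarrow> nat) \<Rightarrow> (nat \<Rightarrow> nat) \<Rightarrow> real" where
  "wt n m \<alpha> = (\<Sum>i<n. real (\<alpha> i) / (2 * real (m i)))"

text \<open>For positive \<open>m\<close> the index set below is finite, and for \<open>n = 0\<close> it is empty.\<close>

definition half_weight_indices :: "nat \<Rightarrow> (nat \<Rightarrow> nat) \<Rightarrow> (nat \<Rightarrow> nat) set" where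
  "half_weight_indices n m = {\<alpha> \<in> {..<n} \<rightarrow>\<^sub>E UNIV. wt n m \<alpha> = 1 / 2}"

definition weighted_homogeneous_balanced ::
  "nat \<Rightarrow> (nat \<Rightarrow> nat) \<Rightarrow> ((nat \<Rightarrow> complex) \<Rightarrow> real) \<Rightarrow> bool" where
  "weighted_homogeneous_balanced n m p \<longleftrightarrow>
     (\<exists>C :: (nat \<Rightarrow> nat) \<Rightarrow> (nat \<Rightarrow> nat) \<Rightarrow> complex. \<forall>w\<in>Cn n.
        of_real (p w) =
          (\<Sum>\<alpha>\<in>half_weight_indices n m. \<Sum>\<beta>\<in>half_weight_indices n m.
             C \<alpha> \<beta> * (\<Prod>i<n. w i ^ \<alpha> i) * (\<Prod>i<n. cnj (w i) ^ \<beta> i)))"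

definition ball_p :: "nat \<Rightarrow> ((nat \<Rightarrow> complex) \<Rightarrow> real) \<Rightarrow> (nat \<Rightarrow> complex) set" where
  "ball_p n p = {w \<in> Cn n. p w < 1}"

definition ellipsoid_p :: "nat \<Rightarrow> ((nat \<Rightarrow> complex) \<Rightarrow> real) \<Rightarrow> (nat \<Rightarrow> complex) set" where
  "ellipsoid_p n p = {case_nat z w |z w. w \<in> Cn n \<and> (cmod z)\<^sup>2 + p w < 1}"

definition W_space :: "nat \<Rightarrow> ((nat \<Rightarrow> complex) \<Rightarrow> real) \<Rightarrow> nat \<Rightarrow> ((nat \<Rightarrow> complex) \<Rightarrow> complex) set" where
  "W_space n p k = A2 n (ball_p n p) (\<lambda>w. (1 - p w) ^ (k + 1))"

definition Y_space :: "nat \<Rightarrow> ((nat \<Rightarrow> complex) \<Rightarrow> real) \<Rightarrow> (nat \<Rightarrow> (nat \<Rightarrow> complex) \<Rightarrow> complex) set" where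
  "Y_space n p = {a. (\<forall>k. a k \<in> W_space n p k) \<and>
     summable (\<lambda>k. 1 / real (k + 1) *
       (LINT w:ball_p n p|Cvol n. (cmod (a k w))\<^sup>2 * (1 - p w) ^ (k + 1)))}"

definition Y_inner :: "nat \<Rightarrow> ((nat \<Rightarrow> complex) \<Rightarrow> real) \<Rightarrow>
    (nat \<Rightarrow> (nat \<Rightarrow> complex) \<Rightarrow> complex) \<Rightarrow> (nat \<Rightarrow> (nat \<Rightarrow> complex) \<Rightarrow> complex) \<Rightarrow> complex" where
  "Y_inner n p a b = of_real pi * (\<Sum>k. of_real (1 / real (k + 1)) *
       A2_inner n (ball_p n p) (\<lambda>w. (1 - p w) ^ (k + 1)) (a k) (b k))"

definition Y_scale :: "complex \<Rightarrow> (nat \<Rightarrow> (nat \<Rightarrow> complex) \<Rightarrow> complex) \<Rightarrow>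
    nat \<Rightarrow> (nat \<Rightarrow> complex) \<Rightarrow> complex" where
  "Y_scale c a = (\<lambda>k w. c * a k w)"

definition T_map :: "nat \<Rightarrow> ((nat \<Rightarrow> complex) \<Rightarrow> real) \<Rightarrow>
    (nat \<Rightarrow> (nat \<Rightarrow> complex) \<Rightarrow> complex) \<Rightarrow> (nat \<Rightarrow> complex) \<Rightarrow> complex" where
  "T_map n p a v = (if v \<in> ellipsoid_p n p then (\<Sum>k. a k (v \<circ> Suc) * v 0 ^ k) else 0)"

lemma T_map_apply:
  assumes "w \<in> Cn n" "(cmod z)\<^sup>2 + p w < 1"
  shows "T_map n p a (case_nat z w) = (\<Sum>k. a k w * z ^ k)"
proof -
  have "case_nat z w \<in> ellipsoid_p n p"
    using assms by (auto simp: ellipsoid_p_def)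
  moreover have "case_nat z w \<circ> Suc = w"
    by auto
  ultimately show ?thesis
    by (simp add: T_map_def)
qed

lemma hnorm_Y:
  assumes "a \<in> Y_space n p"
  shows "(hnorm (Y_inner n p) a)\<^sup>2 = pi * (\<Sum>k. 1 / real (k + 1) *
       (LINT w:ball_p n p|Cvol n. (cmod (a k w))\<^sup>2 * (1 - p w) ^ (k + 1)))"
proof -
  let ?I = "\<lambda>k. LINT w:ball_p n p|Cvol n. (cmod (a k w))\<^sup>2 * (1 - p w) ^ (k + 1)"
  have nn: "0 \<le> ?I k" for k
    unfolding set_lebesgue_integral_def
    by (intro Bochner_Integration.integral_nonneg) (auto simp: indicator_def ball_p_def)
  have "Y_inner n p a a = of_real pi * (\<Sum>k. of_real (1 / real (k + 1) * ?I k))"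
    by (simp add: Y_inner_def A2_inner_self)
  also have "(\<Sum>k. complex_of_real (1 / real (k + 1) * ?I k)) = of_real (\<Sum>k. 1 / real (k + 1) * ?I k)"
    using assms by (intro suminf_of_real[symmetric]) (simp add: Y_space_def)
  finally have "Y_inner n p a a = of_real (pi * (\<Sum>k. 1 / real (k + 1) * ?I k))"
    by simp
  moreover have "0 \<le> (\<Sum>k. 1 / real (k + 1) * ?I k)"
    using assms nn by (intro suminf_nonneg) (auto simp: Y_space_def)
  ultimately show ?thesis
    by (simp add: hnorm_def norm_mult)
qed

end

theory Submission imports Defs begin

text \<open>
  The set \<open>ellipsoid_p n p\<close> is a Hartogs domain: over a point \<open>w\<close> of \<open>ball_p n p\<close> its fibre
  is the disc of radius \<open>sqrt (1 - p w)\<close> about \<open>0\<close>, and over every other point the fibre is empty.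
  A holomorphic function \<open>f\<close> on it is therefore, on each fibre, the sum of its Taylor series
  \<open>\<Sum>k. a k w * z ^ k\<close>. Distinct monomials are orthogonal on a disc of radius \<open>R\<close> about \<open>0\<close>, and
  \<open>(cmod z) ^ (2 * k)\<close> integrates to \<open>pi * R ^ (2 * k + 2) / (k + 1)\<close> over it; with \<open>R\<^sup>2 = 1 - p w\<close> this is exactly the
  weight in the norm of \<open>Y_space n p\<close>. Tonelli's theorem turns the fibrewise identity
  (\<open>Parseval_ball\<close>) into \<open>energy_power_series\<close>: the squared norm of \<open>f\<close> equals the squared norm of
  its coefficient sequence, as an identity in \<open>[0, \<infinity>]\<close>, so that it also decides membership.

  What remains is to match the two notions of holomorphy. If \<open>f\<close> is square integrable, its
  coefficients are holomorphic in \<open>w\<close> (\<open>taylor_coeff_holomorphic\<close>): inductively, \<open>a k\<close> is the locally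
  uniform limit, as \<open>s \<longrightarrow> 0\<close>, of the holomorphic functions
  \<open>(f (s, w) - (\<Sum>j<k. a j w * s ^ j)) / s ^ k\<close>. Conversely, for \<open>a\<close> in \<open>Y_space n p\<close> the series
  converges locally uniformly (\<open>Y_terms_locally_dominated\<close>). Both directions need bounds on values
  in terms of square integrals, which come from the mean value inequality
  \<open>polydisc_mean_value_inequality\<close>; in one variable that inequality is Parseval's identity with all
  but the first term dropped.

  The same inequality makes weighted Bergman spaces complete (\<open>hilbert_space_A2\<close>). Completeness of
  \<open>Y_space n p\<close> is then transported along the isometry (\<open>isometric_isomorphismI\<close>). The domains are
  relatively open because a weighted homogeneous balanced polynomial is continuous.
\<close>

section \<open>Parseval's identity on a disc\<close>

text \<open>
  This presents Lebesgue measure on the complex plane as a product measure, to which Tonelli's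
  theorem applies.
\<close>

lemma lborel_complex_eq_distr:
  "lborel = distr (lborel \<Otimes>\<^sub>M lborel) borel (\<lambda>(x, y). Complex x y)"
proof (rule lborel_eqI)
  have *: "(\<lambda>(x, y). Complex x y) \<in> borel_measurable (lborel \<Otimes>\<^sub>M lborel)"
    unfolding lborel_prod by (auto simp: split_beta' Complex_eq intro!: borel_measurable_continuous_onI continuous_intros)
  fix l u :: complex
  assume "\<And>b. b \<in> Basis \<Longrightarrow> l \<bullet> b \<le> u \<bullet> b"
  from this[of 1] this[of \<i>] have le: "Re l \<le> Re u" "Im l \<le> Im u"
    by (auto simp: Basis_complex_def)
  have "emeasure (distr (lborel \<Otimes>\<^sub>M lborel) borel (\<lambda>(x, y). Complex x y)) (box l u) =
      emeasure (lborel \<Otimes>\<^sub>M lborel) (box (Re l) (Re u) \<times> box (Im l) (Im u))"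
    using * by (subst emeasure_distr)
      (auto intro!: arg_cong2[where f=emeasure] simp: space_pair_measure in_box_complex_iff)
  also have "\<dots> = ennreal ((Re u - Re l) * (Im u - Im l))"
    using le by (subst lborel.emeasure_pair_measure_Times) (auto simp: ennreal_mult)
  finally show "emeasure (distr (lborel \<Otimes>\<^sub>M lborel) borel (\<lambda>(x, y). Complex x y)) (box l u) =
      ennreal (\<Prod>b\<in>Basis. (u - l) \<bullet> b)"
    by (simp add: Basis_complex_def)
qed simp

lemma nn_integral_complex_iterated:
  assumes [measurable]: "F \<in> borel_measurable borel"
  shows "(\<integral>\<^sup>+z. F z \<partial>lborel) = (\<integral>\<^sup>+y. \<integral>\<^sup>+x. F (Complex x y) \<partial>lborel \<partial>lborel)"
    and "(\<integral>\<^sup>+z. F z \<partial>lborel) = (\<integral>\<^sup>+x. \<integral>\<^sup>+y. F (Complex x y) \<partial>lborel \<partial>lborel)"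
proof -
  have *[measurable]: "(\<lambda>(x, y). Complex x y) \<in> borel_measurable (lborel \<Otimes>\<^sub>M lborel)"
    unfolding lborel_prod by (auto simp: split_beta' Complex_eq intro!: borel_measurable_continuous_onI continuous_intros)
  have eq: "(\<integral>\<^sup>+z. F z \<partial>lborel) = (\<integral>\<^sup>+z. F (case z of (x, y) \<Rightarrow> Complex x y) \<partial>(lborel \<Otimes>\<^sub>M lborel))"
    by (subst lborel_complex_eq_distr, subst nn_integral_distr) auto
  have F: "(\<lambda>z. F (case z of (x, y) \<Rightarrow> Complex x y)) \<in> borel_measurable (lborel \<Otimes>\<^sub>M lborel)"
    by measurable
  show "(\<integral>\<^sup>+z. F z \<partial>lborel) = (\<integral>\<^sup>+x. \<integral>\<^sup>+y. F (Complex x y) \<partial>lborel \<partial>lborel)"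
    unfolding eq lborel.nn_integral_fst[OF F, symmetric] by simp
  show "(\<integral>\<^sup>+z. F z \<partial>lborel) = (\<integral>\<^sup>+y. \<integral>\<^sup>+x. F (Complex x y) \<partial>lborel \<partial>lborel)"
    unfolding eq
    using lborel_pair.nn_integral_snd[of "\<lambda>(x,y). F (Complex x y)"] F by (simp add: split_beta')
qed

text \<open>
  With \<open>u = a + b * \<i>\<close>, a rotation is a composition of shears and scalings of
  single coordinates. Each is a one-dimensional affine substitution inside an iterated integral,
  and the Jacobian factors \<open>1 / \<bar>a\<bar>\<close> and \<open>\<bar>a\<bar>\<close>
  cancel because \<open>a\<^sup>2 + b\<^sup>2 = 1\<close>. The case \<open>a = 0\<close> would
  need the substitutions in another order; the rotations with \<open>a \<noteq> 0\<close>
  suffice for the orthogonality of monomials.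
\<close>

lemma nn_integral_rotation:
  assumes [measurable]: "F \<in> borel_measurable borel" and u: "cmod u = 1" "Re u \<noteq> 0"
  shows "(\<integral>\<^sup>+z. F (u * z) \<partial>lborel) = (\<integral>\<^sup>+z. F z \<partial>lborel)"
proof -
  define a b where "a = Re u" and "b = Im u"
  have ab: "a \<noteq> 0" "a\<^sup>2 + b\<^sup>2 = 1"
    using u cmod_power2[of u] by (auto simp: a_def b_def)
  have [measurable]: "(\<lambda>z. u * z) \<in> borel_measurable borel"
    by (intro borel_measurable_continuous_onI continuous_intros)
  have *[measurable]: "(\<lambda>(x, y). Complex x y) \<in> borel_measurable (borel \<Otimes>\<^sub>M borel)"
    unfolding borel_prod by (auto simp: split_beta' Complex_eq intro!: borel_measurable_continuous_onI continuous_intros)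
  have u_mult: "u * Complex x y = Complex (a * x - b * y) (b * x + a * y)" for x y
    by (auto simp: a_def b_def complex_eq_iff)
  have "(\<integral>\<^sup>+z. F (u * z) \<partial>lborel) =
      (\<integral>\<^sup>+y. \<integral>\<^sup>+x. F (Complex (a * x - b * y) (b * x + a * y)) \<partial>lborel \<partial>lborel)"
    by (subst nn_integral_complex_iterated(1)) (auto simp: u_mult)
  (* For fixed y, substitute x := (x + b * y) / a. *)
  also have "\<dots> = (\<integral>\<^sup>+y. ennreal \<bar>1 / a\<bar> * (\<integral>\<^sup>+x. F (Complex x (b / a * x + 1 / a * y)) \<partial>lborel) \<partial>lborel)"
  proof (intro nn_integral_cong)
    fix y
    have x1: "a * (b / a * y + 1 / a * x) - b * y = x" for x
      using ab by (simp add: field_simps)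
    have x2: "b * (b / a * y + 1 / a * x) + a * y = b / a * x + 1 / a * y" for x
    proof -
      have "b * (b / a * y + 1 / a * x) + a * y = b / a * x + (a\<^sup>2 + b\<^sup>2) / a * y"
        using ab(1) by (simp add: field_simps power2_eq_square)
      then show ?thesis using ab(2) by simp
    qed
    have "(\<integral>\<^sup>+x. F (Complex (a * x - b * y) (b * x + a * y)) \<partial>lborel) =
      ennreal \<bar>1 / a\<bar> * (\<integral>\<^sup>+x. F (Complex (a * (b / a * y + 1 / a * x) - b * y) (b * (b / a * y + 1 / a * x) + a * y)) \<partial>lborel)"
      by (rule nn_integral_real_affine) (use ab in auto)
    then show "(\<integral>\<^sup>+x. F (Complex (a * x - b * y) (b * x + a * y)) \<partial>lborel) =
      ennreal \<bar>1 / a\<bar> * (\<integral>\<^sup>+x. F (Complex x (b / a * x + 1 / a * y)) \<partial>lborel)"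
      by (simp only: x1 x2)
  qed
  also have "\<dots> = ennreal \<bar>1 / a\<bar> * (\<integral>\<^sup>+y. \<integral>\<^sup>+x. F (Complex x (b / a * x + 1 / a * y)) \<partial>lborel \<partial>lborel)"
    by (rule nn_integral_cmult) measurable
  also have "\<dots> = ennreal \<bar>1 / a\<bar> * (\<integral>\<^sup>+x. \<integral>\<^sup>+y. F (Complex x (b / a * x + 1 / a * y)) \<partial>lborel \<partial>lborel)"
    by (subst lborel_pair.Fubini'[of "\<lambda>x y. F (Complex x (b / a * x + 1 / a * y))"]) (auto, measurable)
  also have "\<dots> = (\<integral>\<^sup>+x. ennreal \<bar>1 / a\<bar> * (\<integral>\<^sup>+y. F (Complex x (b / a * x + 1 / a * y)) \<partial>lborel) \<partial>lborel)"
    by (rule nn_integral_cmult[symmetric]) measurable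
  (* For fixed x, the second coordinate is affine in y with slope 1 / a. *)
  also have "\<dots> = (\<integral>\<^sup>+x. \<integral>\<^sup>+y. F (Complex x y) \<partial>lborel \<partial>lborel)"
    by (intro nn_integral_cong nn_integral_real_affine[symmetric]) (use ab in auto)
  also have "\<dots> = (\<integral>\<^sup>+z. F z \<partial>lborel)"
    by (rule nn_integral_complex_iterated(2)[symmetric]) fact
  finally show ?thesis .
qed

lemma distr_rotation:
  assumes u: "cmod u = 1" "Re u \<noteq> 0"
  shows "distr lborel borel (\<lambda>z. u * z) = lborel"
proof (rule measure_eqI)
  have [measurable]: "(\<lambda>z. u * z) \<in> borel_measurable borel"
    by (intro borel_measurable_continuous_onI continuous_intros)
  fix A assume "A \<in> sets (distr lborel borel ((*) u))"
  then have [measurable]: "A \<in> sets borel" by simp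
  have "emeasure (distr lborel borel ((*) u)) A = (\<integral>\<^sup>+z. indicator A z \<partial>distr lborel borel ((*) u))"
    by simp
  also have "\<dots> = (\<integral>\<^sup>+z. indicator A (u * z) \<partial>lborel)"
    by (subst nn_integral_distr) auto
  also have "\<dots> = (\<integral>\<^sup>+z. indicator A z \<partial>lborel)"
    by (rule nn_integral_rotation) (use u in auto)
  finally show "emeasure (distr lborel borel ((*) u)) A = emeasure lborel A"
    by simp
qed simp

text \<open>
  Rotation by \<open>u\<close> multiplies the integral by \<open>u ^ j * cnj u ^ k\<close>,
  which can be made different from \<open>1\<close> when \<open>j \<noteq> k\<close>.
\<close>

lemma cball_monomials_orthogonal:
  assumes "j \<noteq> k"
  shows "(LINT z:cball 0 r|lborel. z ^ j * cnj z ^ k) = (0::complex)"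
proof -
  (* The angle (j - k) * \<theta> is nonzero and at most 1 in absolute value, so its sine does not vanish;
     and \<theta> itself lies in (0, 1], so that Re u = cos \<theta> is positive. *)
  define \<theta> where "\<theta> = 1 / (real j + real k)"
  define u where "u = cis \<theta>"
  have jk: "real j + real k \<ge> 1" using assms by linarith
  have "0 < \<theta>" "\<theta> \<le> 1" using jk by (auto simp: \<theta>_def)
  then have "cos \<theta> > 0"
    using pi_gt3 by (intro cos_gt_zero) auto
  then have u: "cmod u = 1" "Re u \<noteq> 0" by (auto simp: u_def)
  have [measurable]: "(\<lambda>z::complex. u * z) \<in> borel_measurable borel"
    "(\<lambda>z::complex. z ^ j * cnj z ^ k) \<in> borel_measurable borel"
    by (intro borel_measurable_continuous_onI continuous_intros)+
  have [measurable]: "cball (0::complex) r \<in> sets borel" by simp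
  let ?I = "LINT z:cball 0 r|lborel. z ^ j * cnj z ^ k"
  have "?I = (LINT z|distr lborel borel ((*) u). indicator (cball 0 r) z *\<^sub>R (z ^ j * cnj z ^ k))"
    unfolding distr_rotation[OF u] set_lebesgue_integral_def ..
  also have "\<dots> = (LINT z|lborel. indicator (cball 0 r) (u * z) *\<^sub>R ((u * z) ^ j * cnj (u * z) ^ k))"
    by (rule integral_distr) auto
  also have "\<dots> = (LINT z|lborel. (u ^ j * cnj u ^ k) * (indicator (cball 0 r) z *\<^sub>R (z ^ j * cnj z ^ k)))"
    by (intro Bochner_Integration.integral_cong refl)
       (auto simp: indicator_def norm_mult u power_mult_distrib)
  also have "\<dots> = (u ^ j * cnj u ^ k) * ?I"
    unfolding set_lebesgue_integral_def by (rule integral_mult_right_zero)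
  finally have "(1 - u ^ j * cnj u ^ k) * ?I = 0" by (simp add: algebra_simps)
  moreover have "u ^ j * cnj u ^ k \<noteq> 1"
  proof
    assume *: "u ^ j * cnj u ^ k = 1"
    have "u ^ j * cnj u ^ k = cis ((real j - real k) * \<theta>)"
      by (simp add: u_def Complex.DeMoivre cis_cnj cis_mult algebra_simps)
    with * have "sin ((real j - real k) * \<theta>) = 0" by (simp add: complex_eq_iff)
    then have s: "sin \<bar>(real j - real k) * \<theta>\<bar> = 0" by (simp add: abs_if)
    have "\<bar>(real j - real k) * \<theta>\<bar> > 0" using assms \<open>0 < \<theta>\<close> by simp
    moreover have "\<bar>(real j - real k) * \<theta>\<bar> \<le> 1"
      using jk by (auto simp: \<theta>_def abs_if field_simps)
    ultimately show False
      using s sin_gt_zero[of "\<bar>(real j - real k) * \<theta>\<bar>"] pi_gt3 by linarith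
  qed
  ultimately show ?thesis by simp
qed

text \<open>
  The disc \<open>(cmod z)\<^sup>2 \<le> t\<close> has area \<open>pi * t\<close>, which is
  linear in \<open>t\<close>. Hence \<open>(cmod z)\<^sup>2\<close> is uniformly distributed,
  and radial integrals become one-dimensional ones without polar coordinates.
\<close>

lemma distr_cmod_power2:
  assumes "0 \<le> r"
  shows "distr (density lborel (indicator (cball 0 r :: complex set))) borel (\<lambda>z. (cmod z)\<^sup>2) =
    density lborel (\<lambda>t. ennreal pi * indicator {0..r\<^sup>2} t)" (is "?M = ?N")
proof (rule measure_eqI_lessThan)
  have sq[simp]: "sqrt x \<le> r \<longleftrightarrow> x \<le> r\<^sup>2" for x
    using assms by (metis real_sqrt_abs real_sqrt_le_iff abs_of_nonneg)
  have [measurable]: "cball (0::complex) r \<in> sets borel" by simp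
  have M: "emeasure ?M {x<..} = ennreal (if x \<le> r\<^sup>2 then pi * (r\<^sup>2 - max 0 x) else 0)" for x
  proof -
    have "emeasure ?M {x<..} =
        (\<integral>\<^sup>+z. indicator (cball 0 r) z * indicator {z. x < (cmod z)\<^sup>2} z \<partial>lborel)"
      by (subst emeasure_distr) (auto simp: emeasure_density greaterThan_def vimage_def)
    also have "\<dots> = (\<integral>\<^sup>+z. indicator (cball 0 r \<inter> {z. x < (cmod z)\<^sup>2}) z \<partial>lborel)"
      by (intro nn_integral_cong) (auto split: split_indicator)
    also have "\<dots> = emeasure lborel (cball 0 r \<inter> {z. x < (cmod z)\<^sup>2})"
      by (rule nn_integral_indicator) measurable
    also have "\<dots> = ennreal (if x \<le> r\<^sup>2 then pi * (r\<^sup>2 - max 0 x) else 0)"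
    proof (cases "0 \<le> x \<and> x \<le> r\<^sup>2")
      case True
      have "cmod z \<le> sqrt x \<longleftrightarrow> (cmod z)\<^sup>2 \<le> x" for z
        using True by (metis norm_ge_zero real_sqrt_le_iff real_sqrt_abs abs_of_nonneg)
      moreover have sqrt_le: "sqrt x \<le> r" using True sq by blast
      ultimately have "cball (0::complex) r \<inter> {z. x < (cmod z)\<^sup>2} = cball 0 r - cball 0 (sqrt x)"
        by (simp add: set_eq_iff not_le)
      moreover have "emeasure lborel (cball (0::complex) r - cball 0 (sqrt x)) =
          emeasure lborel (cball (0::complex) r) - emeasure lborel (cball (0::complex) (sqrt x))"
      proof (rule emeasure_Diff)
        show "emeasure lborel (cball (0::complex) (sqrt x)) \<noteq> \<infinity>"
          using emeasure_lborel_cball_finite[of "0::complex" "sqrt x"] by (simp add: less_top)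
        show "cball (0::complex) (sqrt x) \<subseteq> cball 0 r"
          using sqrt_le by (rule subset_cball)
      qed simp_all
      moreover have "emeasure lborel (cball (0::complex) r) = ennreal (pi * r\<^sup>2)"
        "emeasure lborel (cball (0::complex) (sqrt x)) = ennreal (pi * x)"
        using assms True by (simp_all add: emeasure_cball unit_ball_vol_2 DIM_complex)
      ultimately have "emeasure lborel (cball (0::complex) r \<inter> {z. x < (cmod z)\<^sup>2}) = ennreal (pi * r\<^sup>2 - pi * x)"
        using True by (simp only: ennreal_minus mult_nonneg_nonneg pi_ge_zero)
      then show ?thesis
        using True by (simp add: right_diff_distrib max_def)
    next
      case False
      then consider "x < 0" | "x \<ge> 0" "r\<^sup>2 < x" by force
      then show ?thesis
      proof cases
        case 1
        then have "cball (0::complex) r \<inter> {z. x < (cmod z)\<^sup>2} = cball 0 r"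
          by (auto intro: less_le_trans)
        then show ?thesis using 1 assms 
          by (simp add: emeasure_cball unit_ball_vol_2 DIM_complex) (smt (verit) zero_le_power2)
      next
        case 2
        have "(cmod z)\<^sup>2 \<le> r\<^sup>2" if "cmod z \<le> r" for z using that by (intro power_mono) auto
        then have "cball (0::complex) r \<inter> {z. x < (cmod z)\<^sup>2} = {}"
          using 2 by force
        then show ?thesis using 2 by simp
      qed
    qed
    finally show ?thesis .
  qed
  have N: "emeasure ?N {x<..} = ennreal (if x \<le> r\<^sup>2 then pi * (r\<^sup>2 - max 0 x) else 0)" for x
  proof -
    have "emeasure ?N {x<..} = (\<integral>\<^sup>+t. ennreal pi * indicator ({0..r\<^sup>2} \<inter> {x<..}) t \<partial>lborel)"
      by (subst emeasure_density) (auto intro!: nn_integral_cong split: split_indicator)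
    also have "\<dots> = ennreal pi * emeasure lborel ({0..r\<^sup>2} \<inter> {x<..})"
      by (subst nn_integral_cmult) auto
    also have "{0..r\<^sup>2} \<inter> {x<..} = (if x < 0 then {0..r\<^sup>2} else {x<..r\<^sup>2})"
      by auto
    also have "ennreal pi * emeasure lborel (if x < 0 then {0..r\<^sup>2} else {x<..r\<^sup>2}) =
        ennreal (if x \<le> r\<^sup>2 then pi * (r\<^sup>2 - max 0 x) else 0)"
      by (auto simp: ennreal_mult max_def  dest: order.strict_trans2[OF _ zero_le_power2[of r]])
    finally show ?thesis .
  qed
  show "emeasure ?M {x<..} = emeasure ?N {x<..}" for x
    by (simp only: M N)
  show "emeasure ?M {x<..} < \<infinity>" for x
    by (simp only: M) auto
qed auto

lemma cball_moment:
  assumes "0 \<le> r"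
  shows "(\<integral>\<^sup>+z\<in>cball 0 r. ennreal (cmod z ^ (2 * k)) \<partial>lborel) = ennreal (pi * r ^ (2 * k + 2) / (k + 1))"
proof -
  have [measurable]: "cball (0::complex) r \<in> sets borel" by simp
  have "(\<integral>\<^sup>+z\<in>cball 0 r. ennreal (cmod z ^ (2 * k)) \<partial>lborel) =
      (\<integral>\<^sup>+z. ennreal (((cmod z)\<^sup>2) ^ k) \<partial>density lborel (indicator (cball 0 r :: complex set)))"
    by (subst nn_integral_density)
       (auto simp: power_mult mult.commute[of _ "indicator _ _"] simp flip: power_mult)
  also have "\<dots> = (\<integral>\<^sup>+t. ennreal (t ^ k) \<partial>density lborel (\<lambda>t. ennreal pi * indicator {0..r\<^sup>2} t))"
    unfolding distr_cmod_power2[OF assms, symmetric] by (subst nn_integral_distr) auto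
  also have "\<dots> = (\<integral>\<^sup>+t. ennreal pi * (ennreal (t ^ k) * indicator {0..r\<^sup>2} t) \<partial>lborel)"
    by (subst nn_integral_density) (auto simp: ac_simps)
  also have "\<dots> = ennreal pi * (\<integral>\<^sup>+t. ennreal (t ^ k) * indicator {0..r\<^sup>2} t \<partial>lborel)"
    by (rule nn_integral_cmult) auto
  also have "(\<integral>\<^sup>+t. ennreal (t ^ k) * indicator {0..r\<^sup>2} t \<partial>lborel) =
      ennreal ((r\<^sup>2) ^ (k + 1) / (k + 1) - 0 ^ (k + 1) / (k + 1))"
  proof (rule nn_integral_FTC_Icc)
    fix t :: real
    have "t ^ k + real k * t ^ (k - Suc 0) * t = t ^ k * (k + 1)"
      by (cases k) (auto simp: algebra_simps)
    then show "((\<lambda>t. t ^ (k + 1) / (k + 1)) has_real_derivative t ^ k) (at t)"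
      by (auto intro!: derivative_eq_intros simp: add.commute)
  qed auto
  also have "(r\<^sup>2) ^ (k + 1) / (k + 1) - 0 ^ (k + 1) / (k + 1) = r ^ (2 * k + 2) / (k + 1)"
    by (simp add: power_mult power2_eq_square)
  also have "ennreal pi * ennreal (r ^ (2 * k + 2) / (k + 1)) = ennreal (pi * r ^ (2 * k + 2) / (k + 1))"
    using assms by (simp add: ennreal_mult[symmetric])
  finally show ?thesis .
qed

lemma cball_monomials_set_integrable:
  "set_integrable lborel (cball 0 r) (\<lambda>z. z ^ j * cnj z ^ k :: complex)"
  unfolding set_integrable_def
  by (rule borel_integrable_compact) (auto intro!: continuous_intros)

lemma cball_moment_complex:
  assumes "0 \<le> r"
  shows "(LINT z:cball 0 r|lborel. z ^ k * cnj z ^ k) = complex_of_real (pi * r ^ (2 * k + 2) / (k + 1))"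
proof -
  have [measurable]: "cball (0::complex) r \<in> sets borel" by simp
  have "(LINT z:cball 0 r|lborel. z ^ k * cnj z ^ k) =
      (LINT z|lborel. complex_of_real (indicator (cball 0 r) z * cmod z ^ (2 * k)))"
    unfolding set_lebesgue_integral_def
    by (intro Bochner_Integration.integral_cong refl)
       (simp add: power_mult_distrib[symmetric] complex_norm_square[symmetric] power_mult scaleR_conv_of_real)
  also have "\<dots> = complex_of_real (LINT z|lborel. indicator (cball 0 r) z * cmod z ^ (2 * k))"
    by (rule integral_complex_of_real)
  also have "(LINT z|lborel. indicator (cball (0::complex) r) z * cmod z ^ (2 * k)) =
      enn2real (\<integral>\<^sup>+z. ennreal (indicator (cball (0::complex) r) z * cmod z ^ (2 * k)) \<partial>lborel)"
    by (rule integral_eq_nn_integral) auto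
  also have "(\<integral>\<^sup>+z. ennreal (indicator (cball (0::complex) r) z * cmod z ^ (2 * k)) \<partial>lborel) =
      (\<integral>\<^sup>+z\<in>cball 0 r. ennreal (cmod z ^ (2 * k)) \<partial>lborel)"
    by (intro nn_integral_cong) (auto split: split_indicator)
  also have "\<dots> = ennreal (pi * r ^ (2 * k + 2) / (k + 1))"
    by (rule cball_moment) fact
  finally show ?thesis using assms by (simp del: of_real_divide of_real_mult)
qed

text \<open>
  For partial sums the identity is a finite expansion, where only the diagonal terms survive.
\<close>

lemma Parseval_cball_polynomial:
  fixes c :: "nat \<Rightarrow> complex"
  assumes "0 \<le> r"
  shows "(LINT z:cball 0 r|lborel. (cmod (\<Sum>k<N. c k * z ^ k))\<^sup>2) =
    (\<Sum>k<N. pi * (cmod (c k))\<^sup>2 * r ^ (2 * k + 2) / (k + 1))"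
proof -
  have int: "set_integrable lborel (cball 0 r) (\<lambda>z. c j * cnj (c k) * (z ^ j * cnj z ^ k))" for j k
    by (intro set_integrable_mult_right cball_monomials_set_integrable)
  have "complex_of_real (LINT z:cball 0 r|lborel. (cmod (\<Sum>k<N. c k * z ^ k))\<^sup>2) =
      (LINT z:cball 0 r|lborel. complex_of_real ((cmod (\<Sum>k<N. c k * z ^ k))\<^sup>2))"
    unfolding set_lebesgue_integral_def integral_complex_of_real[symmetric]
    by (intro Bochner_Integration.integral_cong refl) (simp add: scaleR_conv_of_real)
  also have "\<dots> = (LINT z:cball 0 r|lborel. \<Sum>j<N. \<Sum>k<N. c j * cnj (c k) * (z ^ j * cnj z ^ k))"
    unfolding set_lebesgue_integral_def
    by (intro Bochner_Integration.integral_cong refl)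
       (simp add: complex_norm_square sum_product ac_simps del: of_real_power)
  also have "\<dots> = (\<Sum>j<N. \<Sum>k<N. LINT z:cball 0 r|lborel. c j * cnj (c k) * (z ^ j * cnj z ^ k))"
    using int unfolding set_lebesgue_integral_def set_integrable_def scaleR_sum_right
    by (subst Bochner_Integration.integral_sum;
        (intro sum.cong refl Bochner_Integration.integral_sum Bochner_Integration.integrable_sum)?) auto
  also have "\<dots> = (\<Sum>j<N. \<Sum>k<N. if k = j then
      complex_of_real (pi * (cmod (c k))\<^sup>2 * r ^ (2 * k + 2) / (k + 1)) else 0)"
  proof (intro sum.cong refl)
    fix j k
    show "(LINT z:cball 0 r|lborel. c j * cnj (c k) * (z ^ j * cnj z ^ k)) =
      (if k = j then complex_of_real (pi * (cmod (c k))\<^sup>2 * r ^ (2 * k + 2) / (k + 1)) else 0)"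
    proof (cases "j = k")
      case True
      then show ?thesis
        using cball_moment_complex[OF assms, of k] complex_norm_square[of "c k"] by (simp add: ac_simps)
    next
      case False
      then show ?thesis using cball_monomials_orthogonal[OF False, of r] by simp
    qed
  qed
  also have "\<dots> = complex_of_real (\<Sum>k<N. pi * (cmod (c k))\<^sup>2 * r ^ (2 * k + 2) / (k + 1))"
    by (simp add: sum.delta')
  finally show ?thesis by (simp only: of_real_eq_iff)
qed

text \<open>
  On a closed disc inside the disc of convergence the partial sums are bounded by the constant
  \<open>\<Sum>k. cmod (c k) * r ^ k\<close>, so dominated convergence passes from polynomials
  to the sum.
\<close>

lemma Parseval_cball:
  fixes c :: "nat \<Rightarrow> complex"
  assumes "0 \<le> r" and sm: "summable (\<lambda>k. cmod (c k) * r ^ k)"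
    and g: "\<And>z. cmod z \<le> r \<Longrightarrow> (\<lambda>k. c k * z ^ k) sums g z"
  shows "(\<integral>\<^sup>+z\<in>cball 0 r. ennreal ((cmod (g z))\<^sup>2) \<partial>lborel) =
    (\<Sum>k. ennreal (pi * (cmod (c k))\<^sup>2 * r ^ (2 * k + 2) / (k + 1)))"
proof -
  have [measurable]: "cball (0::complex) r \<in> sets borel" by simp
  define B where "B = (\<Sum>k. cmod (c k) * r ^ k)"
  have bound: "cmod (\<Sum>k<N. c k * z ^ k) \<le> B" if "cmod z \<le> r" for N z
  proof -
    have "cmod (\<Sum>k<N. c k * z ^ k) \<le> (\<Sum>k<N. cmod (c k) * r ^ k)"
      using that by (intro sum_norm_le) (auto simp: norm_mult norm_power intro!: mult_left_mono power_mono)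
    also have "\<dots> \<le> B"
      unfolding B_def using assms by (intro sum_le_suminf) auto
    finally show ?thesis .
  qed
  have B: "0 \<le> B" using bound[of 0 0] assms by simp
  let ?P = "\<lambda>N z. indicator (cball 0 r) z * (cmod (\<Sum>k<N. c k * z ^ k))\<^sup>2"
  let ?g = "\<lambda>z. indicator (cball 0 r) z * (cmod (g z))\<^sup>2"
  have lim: "(\<lambda>N. ?P N z) \<longlonglongrightarrow> ?g z" for z
    using g[of z] by (auto intro!: tendsto_intros simp: indicator_def sums_def)
  have P[measurable]: "?P N \<in> borel_measurable lborel" for N
    by (intro borel_measurable_times borel_measurable_indicator)
       (auto intro!: borel_measurable_continuous_onI continuous_intros)
  have g_meas: "?g \<in> borel_measurable lborel"
    by (rule borel_measurable_LIMSEQ_real[OF lim P])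
  have w: "integrable lborel (\<lambda>z. indicator (cball (0::complex) r) z * B\<^sup>2)"
    by (intro integrable_mult_left integrable_real_indicator) (auto simp: emeasure_cball assms)
  have le: "norm (?P N z) \<le> indicator (cball 0 r) z * B\<^sup>2" for N z
    using bound[of z N] by (auto simp: indicator_def intro!: power_mono)
  have "integrable lborel ?g" and "(\<lambda>N. LINT z|lborel. ?P N z) \<longlonglongrightarrow> (LINT z|lborel. ?g z)"
    by (rule integrable_dominated_convergence[OF g_meas P w]
        integral_dominated_convergence[OF g_meas P w]; rule AE_I2; rule lim le)+
  moreover have "(LINT z|lborel. ?P N z) = (\<Sum>k<N. pi * (cmod (c k))\<^sup>2 * r ^ (2 * k + 2) / (k + 1))" for N
    using Parseval_cball_polynomial[OF assms(1), of c N] by (simp add: set_lebesgue_integral_def)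
  ultimately have "(\<lambda>k. pi * (cmod (c k))\<^sup>2 * r ^ (2 * k + 2) / (k + 1)) sums (LINT z|lborel. ?g z)"
    and int: "integrable lborel ?g"
    by (auto simp: sums_def)
  then have "(\<Sum>k. ennreal (pi * (cmod (c k))\<^sup>2 * r ^ (2 * k + 2) / (k + 1))) = ennreal (LINT z|lborel. ?g z)"
    by (intro suminf_ennreal_eq) (auto simp: assms)
  also have "\<dots> = (\<integral>\<^sup>+z. ennreal (?g z) \<partial>lborel)"
    by (rule nn_integral_eq_integral[symmetric]) (use int in auto)
  also have "\<dots> = (\<integral>\<^sup>+z\<in>cball 0 r. ennreal ((cmod (g z))\<^sup>2) \<partial>lborel)"
    by (intro nn_integral_cong) (auto split: split_indicator)
  finally show ?thesis ..
qed

text \<open>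
  Exhausting the disc by closed discs and using monotone convergence on both sides gives the
  identity in \<open>[0, \<infinity>]\<close>, whether or not \<open>g\<close> is square integrable.
\<close>

lemma Parseval_ball:
  fixes c :: "nat \<Rightarrow> complex"
  assumes "0 < R" and g: "\<And>z. cmod z < R \<Longrightarrow> (\<lambda>k. c k * z ^ k) sums g z"
  shows "(\<integral>\<^sup>+z\<in>ball 0 R. ennreal ((cmod (g z))\<^sup>2) \<partial>lborel) =
    (\<Sum>k. ennreal (pi * (cmod (c k))\<^sup>2 * R ^ (2 * k + 2) / (k + 1)))"
proof -
  (* Any sequence increasing strictly to R would do; r 0 = 0. *)
  define r where "r N = R * (1 - inverse (real (Suc N)))" for N
  have r0: "0 \<le> r N" for N using assms by (auto simp: r_def field_simps)
  have rR: "r N < R" for N using assms by (auto simp: r_def field_simps)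
  have r_mono: "r N \<le> r M" if "N \<le> M" for N M
    using that assms unfolding r_def by (intro mult_left_mono diff_left_mono le_imp_inverse_le) auto
  have r_lim: "r \<longlonglongrightarrow> R"
    unfolding r_def by (rule tendsto_eq_intros LIMSEQ_inverse_real_of_nat refl)+ simp
  have g_meas: "(\<lambda>z. indicator (ball 0 R) z *\<^sub>R g z) \<in> borel_measurable lborel"
  proof (rule borel_measurable_LIMSEQ_metric)
    show "(\<lambda>N. indicator (ball 0 R) z *\<^sub>R (\<Sum>k<N. c k * z ^ k)) \<longlonglongrightarrow> indicator (ball 0 R) z *\<^sub>R g z" for z
      using g[of z] by (auto intro!: tendsto_intros simp: indicator_def sums_def)
    show "(\<lambda>z. indicator (ball 0 R) z *\<^sub>R (\<Sum>k<N. c k * z ^ k)) \<in> borel_measurable lborel" for N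
      by (intro borel_measurable_scaleR borel_measurable_indicator)
         (auto intro!: borel_measurable_continuous_onI continuous_intros)
  qed
  have cball: "(\<integral>\<^sup>+z\<in>cball 0 (r N). ennreal ((cmod (g z))\<^sup>2) \<partial>lborel) =
      (\<Sum>k. ennreal (pi * (cmod (c k))\<^sup>2 * r N ^ (2 * k + 2) / (k + 1)))" for N
  proof (rule Parseval_cball)
    obtain s where s: "r N < s" "s < R" using rR dense by blast
    have "summable (\<lambda>k. c k * complex_of_real s ^ k)"
      using g[of "complex_of_real s"] s r0[of N] by (auto simp: sums_iff)
    then have "summable (\<lambda>k. norm (c k * complex_of_real (r N) ^ k))"
      by (rule powser_insidea) (use s r0[of N] in auto)
    then show "summable (\<lambda>k. cmod (c k) * r N ^ k)"
      using r0[of N] by (simp add: norm_mult norm_power)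
  qed (use r0 rR g in \<open>auto intro: le_less_trans\<close>)
  have "(\<integral>\<^sup>+z\<in>ball 0 R. ennreal ((cmod (g z))\<^sup>2) \<partial>lborel) =
      (\<integral>\<^sup>+z. (SUP N. ennreal ((cmod (g z))\<^sup>2) * indicator (cball 0 (r N)) z) \<partial>lborel)"
  proof (intro nn_integral_cong)
    fix z :: complex
    show "ennreal ((cmod (g z))\<^sup>2) * indicator (ball 0 R) z =
        (SUP N. ennreal ((cmod (g z))\<^sup>2) * indicator (cball 0 (r N)) z)"
    proof (cases "cmod z < R")
      case True
      obtain N where "cmod z < r N"
        using order_tendstoD(1)[OF r_lim True] by (auto simp: eventually_sequentially)
      then show ?thesis using True
        by (intro antisym SUP_least SUP_upper2[of N]) (auto split: split_indicator)
    next
      case False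
      then have "z \<notin> cball 0 (r N)" for N using rR[of N] by auto
      then show ?thesis using False by (simp add: indicator_def)
    qed
  qed
  also have "\<dots> = (SUP N. \<integral>\<^sup>+z\<in>cball 0 (r N). ennreal ((cmod (g z))\<^sup>2) \<partial>lborel)"
  proof (rule nn_integral_monotone_convergence_SUP)
    show "incseq (\<lambda>N z. ennreal ((cmod (g z))\<^sup>2) * indicator (cball 0 (r N)) z)"
    proof (intro incseq_SucI le_funI mult_left_mono)
      fix N and z :: complex
      have "cball (0::complex) (r N) \<subseteq> cball 0 (r (Suc N))"
        using r_mono[of N "Suc N"] by auto
      then show "indicator (cball 0 (r N)) z \<le> (indicator (cball 0 (r (Suc N))) z :: ennreal)"
        by (auto split: split_indicator)
    qed simp
    fix N
    have [measurable]: "cball (0::complex) (r N) \<in> sets borel" by simp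
    have "(\<lambda>z. ennreal ((cmod (indicator (ball 0 R) z *\<^sub>R g z))\<^sup>2) * indicator (cball 0 (r N)) z) \<in> borel_measurable lborel"
      using g_meas by measurable
    also have "(\<lambda>z. ennreal ((cmod (indicator (ball 0 R) z *\<^sub>R g z))\<^sup>2) * indicator (cball 0 (r N)) z) =
        (\<lambda>z. ennreal ((cmod (g z))\<^sup>2) * indicator (cball 0 (r N)) z)"
      using rR[of N] by (auto split: split_indicator)
    finally show "(\<lambda>z. ennreal ((cmod (g z))\<^sup>2) * indicator (cball 0 (r N)) z) \<in> borel_measurable lborel" .
  qed
  also have "\<dots> = (SUP N. \<Sum>k. ennreal (pi * (cmod (c k))\<^sup>2 * r N ^ (2 * k + 2) / (k + 1)))"
    by (simp only: cball)
  also have "\<dots> = (\<Sum>k. SUP N. ennreal (pi * (cmod (c k))\<^sup>2 * r N ^ (2 * k + 2) / (k + 1)))"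
  proof (rule ennreal_suminf_SUP_eq[symmetric])
    show "incseq (\<lambda>N. ennreal (pi * (cmod (c k))\<^sup>2 * r N ^ (2 * k + 2) / (k + 1)))" for k
      using r_mono r0
      by (intro incseq_SucI ennreal_leI divide_right_mono mult_left_mono power_mono) auto
  qed
  also have "\<dots> = (\<Sum>k. ennreal (pi * (cmod (c k))\<^sup>2 * R ^ (2 * k + 2) / (k + 1)))"
  proof (intro suminf_cong LIMSEQ_unique[OF LIMSEQ_SUP])
    fix k
    show "incseq (\<lambda>N. ennreal (pi * (cmod (c k))\<^sup>2 * r N ^ (2 * k + 2) / (k + 1)))"
      using r_mono r0
      by (intro incseq_SucI ennreal_leI divide_right_mono mult_left_mono power_mono) auto
    show "(\<lambda>N. ennreal (pi * (cmod (c k))\<^sup>2 * r N ^ (2 * k + 2) / (k + 1))) \<longlonglongrightarrow>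
        ennreal (pi * (cmod (c k))\<^sup>2 * R ^ (2 * k + 2) / (k + 1))"
      by (intro tendsto_intros r_lim) auto
  qed
  finally show ?thesis .
qed

section \<open>Iterated integration over complex n-space\<close>

lemma space_Cvol [simp]: "space (Cvol n) = Cn n"
  by (simp add: Cvol_def Cn_def space_PiM)

lemma measurable_Cvol_component [measurable]:
  "i < n \<Longrightarrow> (\<lambda>w. w i) \<in> borel_measurable (Cvol n)"
  unfolding Cvol_def using measurable_component_singleton[of i "{..<n}" "\<lambda>_. lborel"] by simp

lemma sigma_finite_Cvol: "sigma_finite_measure (Cvol n)"
proof -
  interpret product_sigma_finite "\<lambda>_. lborel :: complex measure" by standard
  show ?thesis unfolding Cvol_def by (rule sigma_finite) simp
qed

lemma case_nat_in_Cn [simp]: "case_nat z w \<in> Cn (Suc n) \<longleftrightarrow> w \<in> Cn n"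
proof
  assume *: "case_nat z w \<in> Cn (Suc n)"
  have "w i = undefined" if "n \<le> i" for i
    using PiE_arb[OF *[unfolded Cn_def], of "Suc i"] that by simp
  then show "w \<in> Cn n" by (auto simp: Cn_def PiE_def extensional_def)
qed (auto simp: Cn_def PiE_def extensional_def split: nat.split)

lemma Cn_SucE:
  assumes "v \<in> Cn (Suc n)"
  obtains z w where "v = case_nat z w" "w \<in> Cn n"
proof
  show "v = case_nat (v 0) (v \<circ> Suc)" by (auto split: nat.split)
  then show "v \<circ> Suc \<in> Cn n" using assms case_nat_in_Cn by metis
qed

lemma measurable_case_nat_Cvol [measurable]:
  "(\<lambda>(z, w). case_nat z w) \<in> measurable (lborel \<Otimes>\<^sub>M Cvol n) (Cvol (Suc n))"
  unfolding Cvol_def[of "Suc n"]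
proof (rule measurable_PiM_single')
  fix i assume "i \<in> {..<Suc n}"
  then show "(\<lambda>x. (case x of (z, w) \<Rightarrow> case_nat z w) i) \<in> measurable (lborel \<Otimes>\<^sub>M Cvol n) lborel"
    by (cases i) (auto simp: split_beta')
next
  show "(\<lambda>(z, w). case_nat z w) \<in> space (lborel \<Otimes>\<^sub>M Cvol n) \<rightarrow> (\<Pi>\<^sub>E i\<in>{..<Suc n}. space lborel)"
    by (auto simp: space_pair_measure Cn_def[symmetric])
qed

text \<open>
  Both measures agree on boxes, and a product of sigma-finite measures is determined by its
  values there.
\<close>

lemma Cvol_Suc: "Cvol (Suc n) = distr (lborel \<Otimes>\<^sub>M Cvol n) (Cvol (Suc n)) (\<lambda>(z, w). case_nat z w)"
proof -
  interpret P: product_sigma_finite "\<lambda>_. lborel :: complex measure" by standard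
  interpret sigma_finite_measure "Cvol n" by (rule sigma_finite_Cvol)
  have "distr (lborel \<Otimes>\<^sub>M Cvol n) (Cvol (Suc n)) (\<lambda>(z, w). case_nat z w) = Pi\<^sub>M {..<Suc n} (\<lambda>_. lborel)"
  proof (rule P.PiM_eqI)
    fix A :: "nat \<Rightarrow> complex set" assume A: "\<And>i. i \<in> {..<Suc n} \<Longrightarrow> A i \<in> sets lborel"
    then have meas: "Pi\<^sub>E {..<Suc n} A \<in> sets (Cvol (Suc n))" "A 0 \<in> sets lborel"
        "(\<Pi>\<^sub>E i\<in>{..<n}. A (Suc i)) \<in> sets (Cvol n)"
      unfolding Cvol_def by (auto intro!: sets_PiM_I_finite)
    have "(\<lambda>(z, w). case_nat z w) -` Pi\<^sub>E {..<Suc n} A \<inter> space (lborel \<Otimes>\<^sub>M Cvol n) =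
        A 0 \<times> (\<Pi>\<^sub>E i\<in>{..<n}. A (Suc i))"
    proof (intro set_eqI iffI; clarsimp simp: space_pair_measure)
      fix z w assume "case_nat z w \<in> Pi\<^sub>E {..<Suc n} A" "w \<in> Cn n"
      then show "z \<in> A 0 \<and> w \<in> (\<Pi>\<^sub>E i\<in>{..<n}. A (Suc i))"
        using PiE_mem[of "case_nat z w" "{..<Suc n}" A 0] PiE_mem[of "case_nat z w" "{..<Suc n}" A "Suc i" for i]
        by (force simp: Cn_def PiE_iff)
    next
      fix z w assume z: "z \<in> A 0" and w: "w \<in> (\<Pi>\<^sub>E i\<in>{..<n}. A (Suc i))"
      then have wC: "w \<in> Cn n" by (auto simp: Cn_def PiE_iff)
      then have "case_nat z w \<in> Cn (Suc n)" by simp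
      with z w show "case_nat z w \<in> Pi\<^sub>E {..<Suc n} A \<and> w \<in> Cn n"
        unfolding Cn_def[of "Suc n"] by (auto simp: PiE_iff wC split: nat.split)
    qed
    then have "emeasure (distr (lborel \<Otimes>\<^sub>M Cvol n) (Cvol (Suc n)) (\<lambda>(z, w). case_nat z w)) (Pi\<^sub>E {..<Suc n} A) =
        emeasure (lborel \<Otimes>\<^sub>M Cvol n) (A 0 \<times> (\<Pi>\<^sub>E i\<in>{..<n}. A (Suc i)))"
      using meas by (subst emeasure_distr) auto
    also have "\<dots> = emeasure lborel (A 0) * emeasure (Cvol n) (\<Pi>\<^sub>E i\<in>{..<n}. A (Suc i))"
      using meas by (intro emeasure_pair_measure_Times) auto
    also have "emeasure (Cvol n) (\<Pi>\<^sub>E i\<in>{..<n}. A (Suc i)) = (\<Prod>i<n. emeasure lborel (A (Suc i)))"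
      unfolding Cvol_def using A by (intro P.emeasure_PiM) auto
    also have "emeasure lborel (A 0) * \<dots> = (\<Prod>i<Suc n. emeasure lborel (A i))"
      by (rule prod.lessThan_Suc_shift[symmetric])
    finally show "emeasure (distr (lborel \<Otimes>\<^sub>M Cvol n) (Cvol (Suc n)) (\<lambda>(z, w). case_nat z w)) (Pi\<^sub>E {..<Suc n} A) =
        (\<Prod>i<Suc n. emeasure lborel (A i))" .
  qed (auto simp: Cvol_def)
  then show ?thesis by (simp add: Cvol_def)
qed

text \<open>
  Both orders of integration are used: the first coordinate outermost for the induction on the
  dimension, innermost for the fibres of a Hartogs domain.
\<close>

lemma nn_integral_Cvol_Suc:
  assumes [measurable]: "F \<in> borel_measurable (Cvol (Suc n))"
  shows "(\<integral>\<^sup>+v. F v \<partial>Cvol (Suc n)) = (\<integral>\<^sup>+z. \<integral>\<^sup>+w. F (case_nat z w) \<partial>Cvol n \<partial>lborel)"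
    and "(\<integral>\<^sup>+v. F v \<partial>Cvol (Suc n)) = (\<integral>\<^sup>+w. \<integral>\<^sup>+z. F (case_nat z w) \<partial>lborel \<partial>Cvol n)"
proof -
  interpret S: sigma_finite_measure "Cvol n" by (rule sigma_finite_Cvol)
  interpret P: pair_sigma_finite lborel "Cvol n" ..
  have eq: "(\<integral>\<^sup>+v. F v \<partial>Cvol (Suc n)) = (\<integral>\<^sup>+x. F (case x of (z, w) \<Rightarrow> case_nat z w) \<partial>(lborel \<Otimes>\<^sub>M Cvol n))"
    by (subst Cvol_Suc, subst nn_integral_distr) auto
  have F: "(\<lambda>x. F (case x of (z, w) \<Rightarrow> case_nat z w)) \<in> borel_measurable (lborel \<Otimes>\<^sub>M Cvol n)"
    by measurable
  show "(\<integral>\<^sup>+v. F v \<partial>Cvol (Suc n)) = (\<integral>\<^sup>+z. \<integral>\<^sup>+w. F (case_nat z w) \<partial>Cvol n \<partial>lborel)"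
    unfolding eq S.nn_integral_fst[OF F, symmetric] by simp
  show "(\<integral>\<^sup>+v. F v \<partial>Cvol (Suc n)) = (\<integral>\<^sup>+w. \<integral>\<^sup>+z. F (case_nat z w) \<partial>lborel \<partial>Cvol n)"
    unfolding eq using P.nn_integral_snd[of "\<lambda>(z, w). F (case_nat z w)"] F by (simp add: split_beta')
qed

section \<open>Polydiscs and relatively open sets\<close>

lemma continuous_on_case_nat:
  fixes f :: "'a::topological_space \<Rightarrow> 'b::topological_space"
  assumes "continuous_on A f" "continuous_on A g"
  shows "continuous_on A (\<lambda>x. case_nat (f x) (g x) :: nat \<Rightarrow> 'b)"
proof (rule continuous_on_coordinatewise_then_product)
  fix i show "continuous_on A (\<lambda>x. case_nat (f x) (g x) i)"
    using assms by (cases i) (auto intro: continuous_on_product_then_coordinatewise)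
qed

lemma continuous_on_component: "continuous_on A (\<lambda>w. w i)"
  by (rule continuous_on_product_then_coordinatewise) (rule continuous_on_id)

abbreviation open_Cn :: "nat \<Rightarrow> (nat \<Rightarrow> complex) set \<Rightarrow> bool" where
  "open_Cn n \<equiv> openin (top_of_set (Cn n))"

lemma closed_Cn: "closed (Cn n)"
proof -
  have "Cn n = (\<Inter>i\<in>{n..}. {w. w i = undefined})"
    unfolding Cn_def PiE_def extensional_def by force
  also have "closed \<dots>"
    by (intro closed_INT ballI closed_Collect_eq continuous_on_component continuous_on_const)
  finally show ?thesis .
qed

lemma fun_upd_in_Cn: "w \<in> Cn n \<Longrightarrow> i < n \<Longrightarrow> w(i := \<zeta>) \<in> Cn n"
  by (simp add: Cn_def PiE_iff extensional_def)

lemma open_Cn_subset: "open_Cn n \<Omega> \<Longrightarrow> \<Omega> \<subseteq> Cn n"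
  by (rule openin_imp_subset)

text \<open>
  The measure lives on the product sigma-algebra over finitely many indices, while continuity
  refers to the product topology over all of \<open>nat\<close>. The inclusion of \<open>Cn
  n\<close> is measurable because the components beyond \<open>n\<close> are constant, and
  \<open>\<Omega>\<close> is Borel because \<open>Cn n\<close> is closed.
\<close>

lemma borel_measurable_Cvol_continuous:
  fixes f :: "(nat \<Rightarrow> complex) \<Rightarrow> 'b::real_normed_vector"
  assumes "continuous_on \<Omega> f" "open_Cn n \<Omega>"
  shows "(\<lambda>w. indicator \<Omega> w *\<^sub>R f w) \<in> borel_measurable (Cvol n)"
proof -
  have *: "(\<lambda>w. w) \<in> measurable (Cvol n) borel"
  proof (rule measurable_coordinatewise_then_product)
    fix i show "(\<lambda>w. w i) \<in> borel_measurable (Cvol n)"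
    proof (cases "i < n")
      case False
      then have "w i = undefined" if "w \<in> Cn n" for w
        using that by (auto simp: Cn_def PiE_iff extensional_def)
      then have "(\<lambda>w. w i) \<in> borel_measurable (Cvol n) \<longleftrightarrow>
          (\<lambda>_. undefined :: complex) \<in> borel_measurable (Cvol n)"
        by (intro measurable_cong) simp
      then show ?thesis by simp
    qed (rule measurable_Cvol_component)
  qed
  obtain U where "open U" "\<Omega> = Cn n \<inter> U"
    using assms(2) by (auto simp: openin_open)
  then have "\<Omega> \<in> sets borel"
    using borel_closed[OF closed_Cn] borel_open by blast
  from borel_measurable_continuous_on_indicator[OF this assms(1)] show ?thesis
    by (rule measurable_compose[OF *])
qed

definition polydisc :: "nat \<Rightarrow> (nat \<Rightarrow> complex) \<Rightarrow> real \<Rightarrow> (nat \<Rightarrow> complex) set" where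
  "polydisc n w r = {v \<in> Cn n. \<forall>i<n. dist (w i) (v i) < r}"

lemma polydisc_Suc:
  "case_nat z v \<in> polydisc (Suc n) (case_nat z0 w) r \<longleftrightarrow> z \<in> ball z0 r \<and> v \<in> polydisc n w r"
  by (auto simp: polydisc_def less_Suc_eq_0_disj)

lemma centre_in_polydisc: "w \<in> Cn n \<Longrightarrow> 0 < r \<Longrightarrow> w \<in> polydisc n w r"
  by (auto simp: polydisc_def)

lemma polydisc_mono: "r \<le> s \<Longrightarrow> polydisc n w r \<subseteq> polydisc n w s"
  by (auto simp: polydisc_def)

lemma polydisc_subset_polydisc:
  assumes "v \<in> polydisc n w r" "r + s \<le> t"
  shows "polydisc n v s \<subseteq> polydisc n w t"
proof
  fix x assume x: "x \<in> polydisc n v s"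
  have "dist (w i) (x i) < t" if "i < n" for i
    using assms x that dist_triangle[of "w i" "x i" "v i"] by (force simp: polydisc_def)
  then show "x \<in> polydisc n w t" using x by (simp add: polydisc_def)
qed

lemma open_Cn_polydisc: "open_Cn n (polydisc n w r)"
proof -
  have "open (\<Inter>i\<in>{..<n}. {v. dist (w i) (v i) < r})"
  proof (intro open_INT ballI finite_lessThan)
    fix i
    show "open {v :: nat \<Rightarrow> complex. dist (w i) (v i) < r}"
      by (rule open_Collect_less[OF continuous_on_dist[OF continuous_on_const continuous_on_component]
            continuous_on_const])
  qed
  moreover have "polydisc n w r = Cn n \<inter> (\<Inter>i\<in>{..<n}. {v. dist (w i) (v i) < r})"
    by (auto simp: polydisc_def)
  ultimately show ?thesis by (simp only: openin_open_Int)
qed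

text \<open>
  A basic open set of the product topology constrains finitely many components. Those with index
  below \<open>n\<close> yield the radius; the others hold automatically on \<open>Cn n\<close>.
\<close>

lemma open_Cn_contains_polydisc:
  assumes "open_Cn n \<Omega>" "w \<in> \<Omega>"
  obtains r where "0 < r" "polydisc n w r \<subseteq> \<Omega>"
proof -
  obtain U where U: "open U" "\<Omega> = Cn n \<inter> U"
    using assms(1) by (auto simp: openin_open)
  then have "openin (product_topology (\<lambda>i. euclidean) UNIV) U" "w \<in> U"
    using assms(2) by (auto simp: open_fun_def)
  from product_topology_open_contains_basis[OF this]
  obtain X where "w \<in> Pi\<^sub>E UNIV X \<and> (\<forall>i. openin euclidean (X i)) \<and>
      finite {i. X i \<noteq> topspace euclidean} \<and> Pi\<^sub>E UNIV X \<subseteq> U"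
    by (rule exE)
  then have X: "\<And>i. w i \<in> X i" "\<And>i. open (X i)" "Pi\<^sub>E UNIV X \<subseteq> U"
    by (simp_all add: PiE_iff)
  have "\<forall>i. \<exists>e>0. ball (w i) e \<subseteq> X i"
    using X(1,2) open_contains_ball by blast
  then obtain e where e: "\<And>i. 0 < e i" "\<And>i. ball (w i) (e i) \<subseteq> X i"
    unfolding choice_iff by blast
  define r where "r = Min (insert 1 (e ` {..<n}))"
  have r: "0 < r" "\<And>i. i < n \<Longrightarrow> r \<le> e i"
    using e(1) by (auto simp: r_def)
  have "v \<in> \<Omega>" if v: "v \<in> polydisc n w r" for v
  proof -
    have "v i \<in> X i" for i
    proof (cases "i < n")
      case True
      then have "v i \<in> ball (w i) (e i)"
        using v r(2)[OF True] by (auto simp: polydisc_def)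
      then show ?thesis using e(2) by blast
    next
      case False
      then have "v i = w i"
        using v assms(2) U(2) by (auto simp: polydisc_def Cn_def PiE_iff extensional_def)
      then show ?thesis using X(1) by simp
    qed
    then have "v \<in> U" using X(3) by (auto simp: PiE_iff)
    then show ?thesis using v U(2) by (auto simp: polydisc_def)
  qed
  with r(1) show thesis by (intro that[of r]) auto
qed

section \<open>Holomorphic functions of several variables\<close>

lemma holomorphic_Cn_subset:
  assumes "holomorphic_Cn n \<Omega> f" "\<Omega>' \<subseteq> \<Omega>"
  shows "holomorphic_Cn n \<Omega>' f"
  using assms unfolding holomorphic_Cn_def
  by (auto intro: continuous_on_subset holomorphic_on_subset)

lemma holomorphic_Cn_first_coordinate:
  assumes "holomorphic_Cn (Suc n) \<Omega> f"
  shows "(\<lambda>z. f (case_nat z w)) holomorphic_on {z. case_nat z w \<in> \<Omega>}"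
proof (cases "\<exists>z. case_nat z w \<in> \<Omega>")
  case True
  then obtain z where "case_nat z w \<in> \<Omega>" by blast
  moreover have "(case_nat z w)(0 := \<zeta>) = case_nat \<zeta> w" for \<zeta>
    by (auto simp: fun_eq_iff split: nat.split)
  moreover have "(\<lambda>\<zeta>. f ((case_nat z w)(0 := \<zeta>))) holomorphic_on {\<zeta>. (case_nat z w)(0 := \<zeta>) \<in> \<Omega>}"
    using assms calculation(1) unfolding holomorphic_Cn_def by blast
  ultimately show ?thesis by simp
qed (auto simp: holomorphic_on_def)

lemma holomorphic_Cn_fix_first:
  assumes "holomorphic_Cn (Suc n) \<Omega> f"
  shows "holomorphic_Cn n {w. case_nat z w \<in> \<Omega>} (\<lambda>w. f (case_nat z w))"
  unfolding holomorphic_Cn_def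
proof (intro conjI ballI allI impI)
  have "continuous_on \<Omega> f" using assms by (simp add: holomorphic_Cn_def)
  then show "continuous_on {w. case_nat z w \<in> \<Omega>} (\<lambda>w. f (case_nat z w))"
    by (rule continuous_on_compose2[OF _ continuous_on_case_nat[OF continuous_on_const continuous_on_id]]) blast
  fix w i assume w: "w \<in> {w. case_nat z w \<in> \<Omega>}" and i: "i < n"
  have "(case_nat z w)(Suc i := \<zeta>) = case_nat z (w(i := \<zeta>))" for \<zeta>
    by (auto simp: fun_eq_iff split: nat.split)
  moreover have "(\<lambda>\<zeta>. f ((case_nat z w)(Suc i := \<zeta>))) holomorphic_on {\<zeta>. (case_nat z w)(Suc i := \<zeta>) \<in> \<Omega>}"
    using assms w i unfolding holomorphic_Cn_def by blast
  ultimately show "(\<lambda>\<zeta>. f (case_nat z (w(i := \<zeta>)))) holomorphic_on {\<zeta>. w(i := \<zeta>) \<in> {w. case_nat z w \<in> \<Omega>}}"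
    by simp
qed

lemma fun_upd_in_polydisc:
  assumes "w \<in> Cn n" "i < n" "0 < r"
  shows "w(i := \<zeta>) \<in> polydisc n w r \<longleftrightarrow> \<zeta> \<in> ball (w i) r"
  using assms fun_upd_in_Cn[OF assms(1,2)] by (auto simp: polydisc_def)

lemma open_Cn_slice:
  assumes "open_Cn n \<Omega>" "w \<in> Cn n" "i < n"
  shows "open {\<zeta>. w(i := \<zeta>) \<in> \<Omega>}"
proof -
  obtain U where U: "open U" "\<Omega> = Cn n \<inter> U"
    using assms(1) by (auto simp: openin_open)
  have "continuous_on UNIV (\<lambda>\<zeta>. w(i := \<zeta>))"
  proof (rule continuous_on_coordinatewise_then_product)
    fix j show "continuous_on UNIV (\<lambda>\<zeta>. (w(i := \<zeta>)) j)"
      by (cases "j = i") (simp_all add: continuous_on_id continuous_on_const)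
  qed
  then have "open ((\<lambda>\<zeta>. w(i := \<zeta>)) -` U)"
    by (rule open_vimage[OF U(1)])
  moreover have "{\<zeta>. w(i := \<zeta>) \<in> \<Omega>} = (\<lambda>\<zeta>. w(i := \<zeta>)) -` U"
    using fun_upd_in_Cn[OF assms(2,3)] by (auto simp: U(2))
  ultimately show ?thesis by simp
qed

text \<open>
  Continuity and complex differentiability in each variable are both local properties.
\<close>

lemma holomorphic_Cn_local:
  assumes \<Omega>: "open_Cn n \<Omega>" and loc: "\<And>w. w \<in> \<Omega> \<Longrightarrow> \<exists>r>0. holomorphic_Cn n (polydisc n w r) f"
  shows "holomorphic_Cn n \<Omega> f"
  unfolding holomorphic_Cn_def
proof (intro conjI ballI allI impI)
  note \<Omega>_sub = open_Cn_subset[OF \<Omega>]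
  show "continuous_on \<Omega> f"
    unfolding continuous_on_eq_continuous_within
  proof
    fix w assume w: "w \<in> \<Omega>"
    obtain r where r: "r > 0" "holomorphic_Cn n (polydisc n w r) f" using loc[OF w] by blast
    obtain U where U: "open U" "polydisc n w r = Cn n \<inter> U"
      using open_Cn_polydisc[of n w r] by (auto simp: openin_open)
    have wP: "w \<in> polydisc n w r" using w r(1) \<Omega>_sub by (auto intro: centre_in_polydisc)
    have "continuous_on (polydisc n w r \<inter> \<Omega>) f"
      using r(2) unfolding holomorphic_Cn_def by (meson continuous_on_subset inf_le1)
    then have "continuous (at w within (polydisc n w r \<inter> \<Omega>)) f"
      using w wP by (simp add: continuous_on_eq_continuous_within)
    also have "at w within (polydisc n w r \<inter> \<Omega>) = at w within \<Omega>"
      by (rule at_within_nhd[OF _ U(1)]) (use wP U(2) \<Omega>_sub in auto)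
    finally show "continuous (at w within \<Omega>) f" .
  qed
  fix w i assume w: "w \<in> \<Omega>" and i: "i < n"
  show "(\<lambda>\<zeta>. f (w(i := \<zeta>))) holomorphic_on {\<zeta>. w(i := \<zeta>) \<in> \<Omega>}"
    unfolding holomorphic_on_def
  proof
    fix \<zeta>\<^sub>0 assume "\<zeta>\<^sub>0 \<in> {\<zeta>. w(i := \<zeta>) \<in> \<Omega>}"
    then have w': "w(i := \<zeta>\<^sub>0) \<in> \<Omega>" (is "?w \<in> _") by simp
    obtain r where r: "r > 0" "holomorphic_Cn n (polydisc n ?w r) f" using loc[OF w'] by blast
    have wP: "?w \<in> polydisc n ?w r" using w' r(1) \<Omega>_sub by (auto intro: centre_in_polydisc)
    have "(\<lambda>\<zeta>. f (?w(i := \<zeta>))) holomorphic_on {\<zeta>. ?w(i := \<zeta>) \<in> polydisc n ?w r}"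
      using r(2) wP i unfolding holomorphic_Cn_def by blast
    also have "{\<zeta>. ?w(i := \<zeta>) \<in> polydisc n ?w r} = ball \<zeta>\<^sub>0 r"
      using fun_upd_in_polydisc[of ?w n i r] w' \<Omega>_sub i r(1) by auto
    finally have "(\<lambda>\<zeta>. f (w(i := \<zeta>))) holomorphic_on ball \<zeta>\<^sub>0 r"
      by (simp only: fun_upd_upd)
    then have "(\<lambda>\<zeta>. f (w(i := \<zeta>))) field_differentiable (at \<zeta>\<^sub>0)"
      by (rule holomorphic_on_imp_differentiable_at) (use r(1) in auto)
    then show "(\<lambda>\<zeta>. f (w(i := \<zeta>))) field_differentiable (at \<zeta>\<^sub>0 within {\<zeta>. w(i := \<zeta>) \<in> \<Omega>})"
      by (rule field_differentiable_at_within)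
  qed
qed

text \<open>
  In each variable separately this is the Weierstrass theorem; joint continuity is preserved by
  uniform limits.
\<close>

lemma holomorphic_Cn_uniform_limit:
  assumes \<Omega>: "open_Cn n \<Omega>" and F: "\<And>k. holomorphic_Cn n \<Omega> (F k)"
    and lim: "uniform_limit \<Omega> F f sequentially"
  shows "holomorphic_Cn n \<Omega> f"
  unfolding holomorphic_Cn_def
proof (intro conjI ballI allI impI)
  show "continuous_on \<Omega> f"
  proof (rule uniform_limit_theorem[OF _ lim])
    show "\<forall>\<^sub>F k in sequentially. continuous_on \<Omega> (F k)"
      using F by (simp add: holomorphic_Cn_def)
  qed simp
  fix w i assume w: "w \<in> \<Omega>" and i: "i < n"
  let ?D = "{\<zeta>. w(i := \<zeta>) \<in> \<Omega>}"
  have "open ?D"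
    using w open_Cn_subset[OF \<Omega>] by (intro open_Cn_slice[OF \<Omega> _ i]) blast
  then show "(\<lambda>\<zeta>. f (w(i := \<zeta>))) holomorphic_on ?D"
  proof (rule holomorphic_uniform_sequence[where f="\<lambda>k \<zeta>. F k (w(i := \<zeta>))"])
    show "(\<lambda>\<zeta>. F k (w(i := \<zeta>))) holomorphic_on ?D" for k
      using F[of k] w i unfolding holomorphic_Cn_def by blast
    fix x assume "x \<in> ?D"
    then obtain d where d: "d > 0" "cball x d \<subseteq> ?D"
      using \<open>open ?D\<close> open_contains_cball by blast
    have "uniform_limit (cball x d) (\<lambda>k \<zeta>. F k (w(i := \<zeta>))) (\<lambda>\<zeta>. f (w(i := \<zeta>))) sequentially"
      by (rule uniform_limit_compose'[OF lim]) (use d in auto)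
    with d show "\<exists>d>0. cball x d \<subseteq> ?D \<and>
        uniform_limit (cball x d) (\<lambda>k \<zeta>. F k (w(i := \<zeta>))) (\<lambda>\<zeta>. f (w(i := \<zeta>))) sequentially"
      by blast
  qed
qed

lemma holomorphic_Cn_const: "holomorphic_Cn n \<Omega> (\<lambda>_. c)"
  by (simp add: holomorphic_Cn_def)

lemma holomorphic_Cn_add:
  "holomorphic_Cn n \<Omega> f \<Longrightarrow> holomorphic_Cn n \<Omega> g \<Longrightarrow> holomorphic_Cn n \<Omega> (\<lambda>w. f w + g w)"
  unfolding holomorphic_Cn_def by (auto intro: continuous_on_add holomorphic_on_add)

lemma holomorphic_Cn_mult:
  "holomorphic_Cn n \<Omega> f \<Longrightarrow> holomorphic_Cn n \<Omega> g \<Longrightarrow> holomorphic_Cn n \<Omega> (\<lambda>w. f w * g w)"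
  unfolding holomorphic_Cn_def by (auto intro: continuous_on_mult holomorphic_on_mult)

lemma holomorphic_Cn_diff:
  "holomorphic_Cn n \<Omega> f \<Longrightarrow> holomorphic_Cn n \<Omega> g \<Longrightarrow> holomorphic_Cn n \<Omega> (\<lambda>w. f w - g w)"
  unfolding holomorphic_Cn_def by (auto intro: continuous_on_diff holomorphic_on_diff)

lemma holomorphic_Cn_sum:
  "(\<And>k. k \<in> A \<Longrightarrow> holomorphic_Cn n \<Omega> (f k)) \<Longrightarrow> holomorphic_Cn n \<Omega> (\<lambda>w. \<Sum>k\<in>A. f k w)"
  unfolding holomorphic_Cn_def by (auto intro: continuous_on_sum holomorphic_on_sum)

lemma holomorphic_Cn_first_power: "holomorphic_Cn n \<Omega> (\<lambda>v. v 0 ^ k)"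
  unfolding holomorphic_Cn_def
proof (intro conjI ballI allI impI)
  show "continuous_on \<Omega> (\<lambda>v. v 0 ^ k)"
    by (rule continuous_on_power[OF continuous_on_component])
  fix w i
  show "(\<lambda>\<zeta>. (w(i := \<zeta>)) 0 ^ k) holomorphic_on {\<zeta>. w(i := \<zeta>) \<in> \<Omega>}" for w :: "nat \<Rightarrow> complex"
    by (cases "i = 0") (simp_all add: holomorphic_on_power holomorphic_on_id holomorphic_on_const)
qed

lemma holomorphic_Cn_shift:
  assumes f: "holomorphic_Cn n \<Omega> f" and sub: "\<And>v. v \<in> \<Omega>' \<Longrightarrow> v \<circ> Suc \<in> \<Omega>"
  shows "holomorphic_Cn (Suc n) \<Omega>' (\<lambda>v. f (v \<circ> Suc))"
  unfolding holomorphic_Cn_def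
proof (intro conjI ballI allI impI)
  have "continuous_on \<Omega>' (\<lambda>v. v \<circ> Suc)"
    by (rule continuous_on_coordinatewise_then_product) (simp add: continuous_on_component)
  moreover have "continuous_on \<Omega> f" using f by (simp add: holomorphic_Cn_def)
  ultimately show "continuous_on \<Omega>' (\<lambda>v. f (v \<circ> Suc))"
    by (intro continuous_on_compose2[of \<Omega> f \<Omega>' "\<lambda>v. v \<circ> Suc"] image_subsetI sub)
  fix v i assume v: "v \<in> \<Omega>'" and i: "i < Suc n"
  show "(\<lambda>\<zeta>. f (v(i := \<zeta>) \<circ> Suc)) holomorphic_on {\<zeta>. v(i := \<zeta>) \<in> \<Omega>'}"
  proof (cases i)
    case 0
    then have "v(i := \<zeta>) \<circ> Suc = v \<circ> Suc" for \<zeta> by auto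
    then show ?thesis by (simp add: holomorphic_on_const)
  next
    case (Suc j)
    then have *: "v(i := \<zeta>) \<circ> Suc = (v \<circ> Suc)(j := \<zeta>)" for \<zeta> by auto
    have "(\<lambda>\<zeta>. f ((v \<circ> Suc)(j := \<zeta>))) holomorphic_on {\<zeta>. (v \<circ> Suc)(j := \<zeta>) \<in> \<Omega>}"
      using f sub[OF v] i Suc unfolding holomorphic_Cn_def by blast
    moreover have "{\<zeta>. v(i := \<zeta>) \<in> \<Omega>'} \<subseteq> {\<zeta>. (v \<circ> Suc)(j := \<zeta>) \<in> \<Omega>}"
      using sub unfolding *[symmetric] by blast
    ultimately show ?thesis
      unfolding * by (rule holomorphic_on_subset)
  qed
qed

section \<open>The mean value inequality on polydiscs\<close>

text \<open>
  Only the restriction of \<open>f\<close> to \<open>S\<close> is assumed measurable, since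
  holomorphic functions are of interest only on their domains.
\<close>

lemma borel_measurable_indicator_norm_square:
  fixes f :: "'a \<Rightarrow> complex"
  assumes "(\<lambda>x. indicator S x *\<^sub>R f x) \<in> borel_measurable M"
  shows "(\<lambda>x. ennreal ((cmod (f x))\<^sup>2) * indicator S x) \<in> borel_measurable M"
proof -
  have "(\<lambda>x. ennreal ((cmod (indicator S x *\<^sub>R f x))\<^sup>2)) \<in> borel_measurable M"
    by (rule measurable_compose[OF assms, of "\<lambda>y. ennreal ((cmod y)\<^sup>2)"]) measurable
  also have "(\<lambda>x. ennreal ((cmod (indicator S x *\<^sub>R f x))\<^sup>2)) = (\<lambda>x. ennreal ((cmod (f x))\<^sup>2) * indicator S x)"
    by (auto split: split_indicator)
  finally show ?thesis .
qed

text \<open>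
  The constant term of the Taylor series about \<open>a\<close> contributes the left-hand side
  to the sum in Parseval's identity, and all other terms are nonnegative.
\<close>

lemma disc_mean_value_inequality:
  assumes "0 < r" "g holomorphic_on ball a r"
  shows "ennreal ((cmod (g a))\<^sup>2) * ennreal (pi * r\<^sup>2) \<le> (\<integral>\<^sup>+z\<in>ball a r. ennreal ((cmod (g z))\<^sup>2) \<partial>lborel)"
proof -
  define c where "c k = (deriv ^^ k) g a / fact k" for k
  have sums: "(\<lambda>k. c k * z ^ k) sums g (a + z)" if "cmod z < r" for z
    using holomorphic_power_series[OF assms(2), of "a + z"] that by (simp add: c_def dist_norm)
  let ?h = "\<lambda>z. ennreal ((cmod (g z))\<^sup>2) * indicator (ball a r) z"
  have meas: "?h \<in> borel_measurable borel"
    by (rule borel_measurable_indicator_norm_square[OF borel_measurable_continuous_on_indicator[OF _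
            holomorphic_on_imp_continuous_on[OF assms(2)]]]) simp
  have "ennreal ((cmod (g a))\<^sup>2) * ennreal (pi * r\<^sup>2) = ennreal (pi * (cmod (c 0))\<^sup>2 * r ^ (2 * 0 + 2) / real (0 + 1))"
    by (simp add: ennreal_mult[symmetric] c_def power2_eq_square ac_simps)
  also have "\<dots> = (\<Sum>k\<in>{0}. ennreal (pi * (cmod (c k))\<^sup>2 * r ^ (2 * k + 2) / real (k + 1)))"
    by simp
  also have "\<dots> \<le> (\<Sum>k. ennreal (pi * (cmod (c k))\<^sup>2 * r ^ (2 * k + 2) / real (k + 1)))"
    by (rule sum_le_suminf) auto
  also have "\<dots> = (\<integral>\<^sup>+z\<in>ball 0 r. ennreal ((cmod (g (a + z)))\<^sup>2) \<partial>lborel)"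
    by (rule Parseval_ball[OF assms(1) sums, symmetric])
  also have "\<dots> = (\<integral>\<^sup>+z. ?h (a + z) \<partial>lborel)"
    by (intro nn_integral_cong) (simp add: dist_norm indicator_def)
  also have "\<dots> = (\<integral>\<^sup>+z. ?h z \<partial>distr lborel borel ((+) a))"
    by (rule nn_integral_distr[where f="?h" and T="(+) a" and M=lborel and M'=borel, symmetric])
       (simp, simp only: measurable_distr_eq1 meas)
  also have "\<dots> = (\<integral>\<^sup>+z. ?h z \<partial>lborel)"
    by (simp only: lborel_distr_plus)
  finally show ?thesis .
qed

text \<open>
  Apply the inequality for a disc to the first coordinate and the induction hypothesis to the
  remaining ones.
\<close>

lemma polydisc_mean_value_inequality:
  assumes "w \<in> Cn n" "0 < r" "holomorphic_Cn n (polydisc n w r) f"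
  shows "ennreal ((cmod (f w))\<^sup>2) * ennreal (pi * r\<^sup>2) ^ n \<le>
    (\<integral>\<^sup>+v\<in>polydisc n w r. ennreal ((cmod (f v))\<^sup>2) \<partial>Cvol n)"
  using assms
proof (induction n arbitrary: w f)
  case 0
  interpret product_sigma_finite "\<lambda>_. lborel :: complex measure" by standard
  (* In dimension 0 there is one point, of mass one. *)
  have "w = (\<lambda>k. undefined)" "w \<in> polydisc 0 w r"
    using 0 by (auto simp: Cn_def polydisc_def)
  then show ?case
    by (simp add: Cvol_def nn_integral_empty)
next
  case (Suc n)
  obtain z0 w' where w: "w = case_nat z0 w'" "w' \<in> Cn n"
    using Cn_SucE[OF Suc.prems(1)] .
  let ?P = "polydisc (Suc n) w r" and ?P' = "polydisc n w' r"
  let ?F = "\<lambda>v. ennreal ((cmod (f v))\<^sup>2) * indicator ?P v"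
  have meas: "?F \<in> borel_measurable (Cvol (Suc n))"
    by (rule borel_measurable_indicator_norm_square[OF borel_measurable_Cvol_continuous[OF _ open_Cn_polydisc]])
       (use Suc.prems(3) in \<open>simp add: holomorphic_Cn_def\<close>)
  have z: "(\<lambda>z. f (case_nat z w')) holomorphic_on ball z0 r"
    using holomorphic_Cn_first_coordinate[OF Suc.prems(3), of w'] Suc.prems(2)
    by (simp add: w polydisc_Suc centre_in_polydisc ball_def)
  have "ennreal ((cmod (f w))\<^sup>2) * ennreal (pi * r\<^sup>2) ^ Suc n =
      (ennreal ((cmod (f (case_nat z0 w')))\<^sup>2) * ennreal (pi * r\<^sup>2)) * ennreal (pi * r\<^sup>2) ^ n"
    by (simp add: w ac_simps)
  also have "\<dots> \<le> (\<integral>\<^sup>+z\<in>ball z0 r. ennreal ((cmod (f (case_nat z w')))\<^sup>2) \<partial>lborel) * ennreal (pi * r\<^sup>2) ^ n"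
    by (intro mult_right_mono disc_mean_value_inequality z Suc.prems) simp
  also have "\<dots> = (\<integral>\<^sup>+z. ennreal ((cmod (f (case_nat z w')))\<^sup>2) * indicator (ball z0 r) z * ennreal (pi * r\<^sup>2) ^ n \<partial>lborel)"
  proof (rule nn_integral_multc[symmetric])
    have "(\<lambda>z. indicator (ball z0 r) z *\<^sub>R f (case_nat z w')) \<in> borel_measurable borel"
      by (rule borel_measurable_continuous_on_indicator[OF _ holomorphic_on_imp_continuous_on[OF z]]) simp
    from borel_measurable_indicator_norm_square[OF this]
    show "(\<lambda>z. ennreal ((cmod (f (case_nat z w')))\<^sup>2) * indicator (ball z0 r) z) \<in> borel_measurable lborel"
      by simp
  qed
  also have "\<dots> \<le> (\<integral>\<^sup>+z. \<integral>\<^sup>+v. ?F (case_nat z v) \<partial>Cvol n \<partial>lborel)"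
  proof (intro nn_integral_mono)
    fix z :: complex
    show "ennreal ((cmod (f (case_nat z w')))\<^sup>2) * indicator (ball z0 r) z * ennreal (pi * r\<^sup>2) ^ n \<le>
        (\<integral>\<^sup>+v. ?F (case_nat z v) \<partial>Cvol n)"
    proof (cases "z \<in> ball z0 r")
      case True
      have "holomorphic_Cn n ?P' (\<lambda>v. f (case_nat z v))"
        using holomorphic_Cn_fix_first[OF Suc.prems(3), of z] True by (simp add: w polydisc_Suc)
      from Suc.IH[OF w(2) Suc.prems(2) this]
      have "ennreal ((cmod (f (case_nat z w')))\<^sup>2) * ennreal (pi * r\<^sup>2) ^ n \<le>
          (\<integral>\<^sup>+v\<in>?P'. ennreal ((cmod (f (case_nat z v)))\<^sup>2) \<partial>Cvol n)" .
      also have "\<dots> = (\<integral>\<^sup>+v. ?F (case_nat z v) \<partial>Cvol n)"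
        using True by (intro nn_integral_cong) (auto simp: indicator_def w polydisc_Suc)
      finally show ?thesis using True by simp
    qed (simp add: indicator_def)
  qed
  also have "\<dots> = (\<integral>\<^sup>+v. ?F v \<partial>Cvol (Suc n))"
    by (rule nn_integral_Cvol_Suc(1)[symmetric]) (rule meas)
  finally show ?case .
qed

section \<open>Pre-Hilbert spaces and isometries\<close>

text \<open>
  The axioms of \<open>hilbert_space\<close> other than completeness.
\<close>

definition pre_hilbert_space ::
  "(complex \<Rightarrow> 'v \<Rightarrow> 'v) \<Rightarrow> 'v::ab_group_add set \<Rightarrow> ('v \<Rightarrow> 'v \<Rightarrow> complex) \<Rightarrow> bool" where
  "pre_hilbert_space scl H ip \<longleftrightarrow>
     vector_space scl \<and> module.subspace scl H \<and>
     (\<forall>x\<in>H. \<forall>y\<in>H. \<forall>z\<in>H. ip (x + y) z = ip x z + ip y z) \<and>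
     (\<forall>c. \<forall>x\<in>H. \<forall>y\<in>H. ip (scl c x) y = c * ip x y) \<and>
     (\<forall>x\<in>H. \<forall>y\<in>H. ip y x = cnj (ip x y)) \<and>
     (\<forall>x\<in>H. 0 \<le> Re (ip x x)) \<and>
     (\<forall>x\<in>H. ip x x = 0 \<longrightarrow> x = 0)"

lemma hilbert_space_iff:
  "hilbert_space scl H ip \<longleftrightarrow>
     pre_hilbert_space scl H ip \<and> Metric_space.mcomplete H (\<lambda>x y. hnorm ip (x - y))"
  by (simp add: hilbert_space_def pre_hilbert_space_def)

context
  fixes scl :: "complex \<Rightarrow> 'v \<Rightarrow> 'v::ab_group_add" and H ip
  assumes pre: "pre_hilbert_space scl H ip"
begin

interpretation V: vector_space scl
  using pre by (simp add: pre_hilbert_space_def)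

lemma pre_hilbert_subspace: "V.subspace H"
  using pre by (simp add: pre_hilbert_space_def)

lemma pre_hilbert_closed:
  "0 \<in> H" "x \<in> H \<Longrightarrow> y \<in> H \<Longrightarrow> x + y \<in> H" "x \<in> H \<Longrightarrow> scl c x \<in> H"
  "x \<in> H \<Longrightarrow> y \<in> H \<Longrightarrow> x - y \<in> H" "x \<in> H \<Longrightarrow> - x \<in> H"
  by (fact V.subspace_0[OF pre_hilbert_subspace] V.subspace_add[OF pre_hilbert_subspace]
      V.subspace_scale[OF pre_hilbert_subspace] V.subspace_diff[OF pre_hilbert_subspace]
      V.subspace_neg[OF pre_hilbert_subspace])+

lemma pre_hilbert_rules:
  "x \<in> H \<Longrightarrow> y \<in> H \<Longrightarrow> z \<in> H \<Longrightarrow> ip (x + y) z = ip x z + ip y z"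
  "x \<in> H \<Longrightarrow> y \<in> H \<Longrightarrow> ip (scl c x) y = c * ip x y"
  "x \<in> H \<Longrightarrow> 0 \<le> Re (ip x x)"
  "x \<in> H \<Longrightarrow> ip x x = 0 \<Longrightarrow> x = 0"
  and pre_hilbert_cnj: "x \<in> H \<Longrightarrow> y \<in> H \<Longrightarrow> ip y x = cnj (ip x y)"
proof -
  note conj = pre[unfolded pre_hilbert_space_def, THEN conjunct2, THEN conjunct2]
  show "x \<in> H \<Longrightarrow> y \<in> H \<Longrightarrow> z \<in> H \<Longrightarrow> ip (x + y) z = ip x z + ip y z"
    using conj[THEN conjunct1] by simp
  note conj = conj[THEN conjunct2]
  show "x \<in> H \<Longrightarrow> y \<in> H \<Longrightarrow> ip (scl c x) y = c * ip x y"
    using conj[THEN conjunct1] by simp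
  note conj = conj[THEN conjunct2]
  show "x \<in> H \<Longrightarrow> y \<in> H \<Longrightarrow> ip y x = cnj (ip x y)"
    using conj[THEN conjunct1] by blast
  note conj = conj[THEN conjunct2]
  show "x \<in> H \<Longrightarrow> 0 \<le> Re (ip x x)" "x \<in> H \<Longrightarrow> ip x x = 0 \<Longrightarrow> x = 0"
    using conj by simp_all
qed

lemma pre_hilbert_right:
  assumes "x \<in> H" "y \<in> H"
  shows "z \<in> H \<Longrightarrow> ip x (y + z) = ip x y + ip x z" "ip x (scl c y) = cnj c * ip x y"
proof -
  show "ip x (y + z) = ip x y + ip x z" if "z \<in> H"
    using that assms
    by (simp add: pre_hilbert_cnj[of _ x] pre_hilbert_closed(2) pre_hilbert_rules(1))
  show "ip x (scl c y) = cnj c * ip x y"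
    using assms by (simp add: pre_hilbert_cnj[of _ x] pre_hilbert_closed(3) pre_hilbert_rules(2))
qed

lemma pre_hilbert_self:
  assumes "x \<in> H"
  shows "ip x x = of_real ((hnorm ip x)\<^sup>2)"
proof -
  have "Im (ip x x) = Im (cnj (ip x x))"
    by (rule arg_cong[OF pre_hilbert_cnj[OF assms assms]])
  then have "Im (ip x x) = 0" by simp
  then show ?thesis
    using pre_hilbert_rules(3)[OF assms] by (simp add: hnorm_def complex_eq_iff cmod_eq_Re)
qed

lemma pre_hilbert_norm_add:
  assumes "x \<in> H" "y \<in> H"
  shows "(hnorm ip (x + y))\<^sup>2 = (hnorm ip x)\<^sup>2 + 2 * Re (ip x y) + (hnorm ip y)\<^sup>2"
proof -
  have "complex_of_real ((hnorm ip (x + y))\<^sup>2) = ip x x + ip x y + (cnj (ip x y) + ip y y)"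
    using assms pre_hilbert_closed(2)[OF assms] pre_hilbert_cnj[OF assms]
    by (simp add: pre_hilbert_self[symmetric] pre_hilbert_rules(1) pre_hilbert_right(1) del: of_real_power)
  then have "complex_of_real ((hnorm ip (x + y))\<^sup>2) =
      complex_of_real ((hnorm ip x)\<^sup>2 + 2 * Re (ip x y) + (hnorm ip y)\<^sup>2)"
    using assms by (simp add: pre_hilbert_self complex_eq_iff)
  then show ?thesis by (simp only: of_real_eq_iff)
qed

lemma hnorm_nonneg: "0 \<le> hnorm ip x"
  by (simp add: hnorm_def)

text \<open>
  The vector \<open>x + t * y\<close> with \<open>t = - ip x y / (hnorm ip y)\<^sup>2\<close> is
  the component of \<open>x\<close> orthogonal to \<open>y\<close>. Its squared norm is
  nonnegative and equals \<open>(hnorm ip x)\<^sup>2 - (cmod (ip x y))\<^sup>2 / (hnorm ip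
  y)\<^sup>2\<close>.
\<close>

lemma pre_hilbert_Cauchy_Schwarz:
  assumes "x \<in> H" "y \<in> H"
  shows "cmod (ip x y) \<le> hnorm ip x * hnorm ip y"
proof (cases "hnorm ip y = 0")
  case True
  then have "y = 0" using pre_hilbert_self pre_hilbert_rules(4) assms by simp
  then have "ip x y = 0"
    using pre_hilbert_right(2)[of x 0 0] assms pre_hilbert_closed(1) by simp
  then show ?thesis by (simp add: hnorm_nonneg)
next
  case False
  define t where "t = - ip x y / of_real ((hnorm ip y)\<^sup>2)"
  have y2: "ip (scl t y) (scl t y) = of_real ((cmod t)\<^sup>2 * (hnorm ip y)\<^sup>2)"
    using assms pre_hilbert_closed(3) pre_hilbert_self[of y]
    by (simp add: pre_hilbert_rules(2) pre_hilbert_right(2) complex_norm_square del: of_real_power)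
  then have n2: "(hnorm ip (scl t y))\<^sup>2 = (cmod t)\<^sup>2 * (hnorm ip y)\<^sup>2"
    using pre_hilbert_self[OF pre_hilbert_closed(3)[OF assms(2), of t]] by (simp only: of_real_eq_iff)
  have xy: "Re (ip x (scl t y)) = - (cmod (ip x y))\<^sup>2 / (hnorm ip y)\<^sup>2"
  proof -
    have "ip x (scl t y) = - of_real ((cmod (ip x y))\<^sup>2) / of_real ((hnorm ip y)\<^sup>2)"
      unfolding pre_hilbert_right(2)[OF assms]
      by (simp add: t_def complex_norm_square mult.commute del: of_real_power)
    also have "\<dots> = of_real (- (cmod (ip x y))\<^sup>2 / (hnorm ip y)\<^sup>2)" by simp
    finally show ?thesis by (simp only: Re_complex_of_real)
  qed
  have t2: "(cmod t)\<^sup>2 * (hnorm ip y)\<^sup>2 = (cmod (ip x y))\<^sup>2 / (hnorm ip y)\<^sup>2"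
  proof -
    have "cmod t = cmod (ip x y) / (hnorm ip y)\<^sup>2"
      by (simp add: t_def norm_divide norm_power hnorm_nonneg)
    then show ?thesis using False by (simp add: power_divide power2_eq_square)
  qed
  have "0 \<le> (hnorm ip (x + scl t y))\<^sup>2" by simp
  also have "\<dots> = (hnorm ip x)\<^sup>2 - (cmod (ip x y))\<^sup>2 / (hnorm ip y)\<^sup>2"
    using assms pre_hilbert_closed(3) by (subst pre_hilbert_norm_add) (simp_all add: n2 xy t2)
  finally have "(cmod (ip x y))\<^sup>2 \<le> (hnorm ip x * hnorm ip y)\<^sup>2"
    using False by (simp add: field_simps)
  then show ?thesis
    by (rule power2_le_imp_le) (simp add: hnorm_nonneg)
qed

lemma pre_hilbert_triangle:
  assumes "x \<in> H" "y \<in> H"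
  shows "hnorm ip (x + y) \<le> hnorm ip x + hnorm ip y"
proof (rule power2_le_imp_le)
  have "Re (ip x y) \<le> hnorm ip x * hnorm ip y"
    using pre_hilbert_Cauchy_Schwarz[OF assms] complex_Re_le_cmod order_trans by blast
  then show "(hnorm ip (x + y))\<^sup>2 \<le> (hnorm ip x + hnorm ip y)\<^sup>2"
    unfolding pre_hilbert_norm_add[OF assms] by (simp add: power2_sum)
qed (simp add: hnorm_nonneg)

text \<open>
  The locale \<open>Metric_space\<close> demands symmetry of the distance on the whole type,
  also outside of \<open>H\<close>, where the axioms of an inner product say nothing. This is
  what the hypothesis \<open>even\<close> provides.
\<close>

lemma pre_hilbert_Metric_space:
  assumes even: "\<And>x. ip (- x) (- x) = ip x x"
  shows "Metric_space H (\<lambda>x y. hnorm ip (x - y))"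
proof
  fix x y z
  show "0 \<le> hnorm ip (x - y)" by (rule hnorm_nonneg)
  show "hnorm ip (x - y) = hnorm ip (y - x)"
    using even[of "x - y"] by (simp add: hnorm_def)
  assume H: "x \<in> H" "y \<in> H"
  have "hnorm ip 0 = 0"
    using pre_hilbert_rules(2)[of 0 0 0] pre_hilbert_closed(1) by (simp add: hnorm_def)
  moreover have "x - y = 0" if "hnorm ip (x - y) = 0"
    using that pre_hilbert_closed(4)[OF H] pre_hilbert_self[of "x - y"] pre_hilbert_rules(4)[of "x - y"] by simp
  ultimately show "hnorm ip (x - y) = 0 \<longleftrightarrow> x = y" by auto
  assume "z \<in> H"
  then show "hnorm ip (x - z) \<le> hnorm ip (x - y) + hnorm ip (y - z)"
    using H pre_hilbert_triangle[of "x - y" "y - z"] by (simp add: pre_hilbert_closed)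
qed

end

text \<open>
  A linear isometry is injective, and it carries Cauchy sequences and limits back and forth. So
  completeness of the target gives completeness of the source, which for coefficient sequences
  spares a separate argument.
\<close>

lemma isometric_isomorphismI:
  assumes pre1: "pre_hilbert_space scl\<^sub>1 H\<^sub>1 ip\<^sub>1"
    and even1: "\<And>x. ip\<^sub>1 (- x) (- x) = ip\<^sub>1 x x"
    and hil2: "hilbert_space scl\<^sub>2 H\<^sub>2 ip\<^sub>2"
    and even2: "\<And>x. ip\<^sub>2 (- x) (- x) = ip\<^sub>2 x x"
    and surj: "T ` H\<^sub>1 = H\<^sub>2"
    and add: "\<And>x y. x \<in> H\<^sub>1 \<Longrightarrow> y \<in> H\<^sub>1 \<Longrightarrow> T (x + y) = T x + T y"
    and scale: "\<And>c x. x \<in> H\<^sub>1 \<Longrightarrow> T (scl\<^sub>1 c x) = scl\<^sub>2 c (T x)"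
    and norm: "\<And>x. x \<in> H\<^sub>1 \<Longrightarrow> hnorm ip\<^sub>2 (T x) = hnorm ip\<^sub>1 x"
  shows "isometric_isomorphism scl\<^sub>1 H\<^sub>1 ip\<^sub>1 scl\<^sub>2 H\<^sub>2 ip\<^sub>2 T"
proof -
  have pre2: "pre_hilbert_space scl\<^sub>2 H\<^sub>2 ip\<^sub>2"
    and complete2: "Metric_space.mcomplete H\<^sub>2 (\<lambda>x y. hnorm ip\<^sub>2 (x - y))"
    using hil2 by (simp_all add: hilbert_space_iff)
  interpret M1: Metric_space H\<^sub>1 "\<lambda>x y. hnorm ip\<^sub>1 (x - y)"
    by (rule pre_hilbert_Metric_space[OF pre1 even1])
  interpret M2: Metric_space H\<^sub>2 "\<lambda>x y. hnorm ip\<^sub>2 (x - y)"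
    by (rule pre_hilbert_Metric_space[OF pre2 even2])
  have diff: "T (x - y) = T x - T y" if "x \<in> H\<^sub>1" "y \<in> H\<^sub>1" for x y
    using add[of "x - y" y] that pre_hilbert_closed(4)[OF pre1] by (simp add: algebra_simps)
  have dist: "hnorm ip\<^sub>2 (T x - T y) = hnorm ip\<^sub>1 (x - y)" if "x \<in> H\<^sub>1" "y \<in> H\<^sub>1" for x y
    using norm[of "x - y"] that pre_hilbert_closed(4)[OF pre1] by (simp add: diff)
  have T: "T x \<in> H\<^sub>2" if "x \<in> H\<^sub>1" for x
    using surj that by blast
  have bij: "bij_betw T H\<^sub>1 H\<^sub>2"
    unfolding bij_betw_def
  proof (intro conjI surj inj_onI)
    fix x y assume xy: "x \<in> H\<^sub>1" "y \<in> H\<^sub>1" "T x = T y"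
    have "0 \<in> H\<^sub>2" by (rule pre_hilbert_closed(1)[OF pre2])
    then have "hnorm ip\<^sub>1 (x - y) = 0"
      using dist[OF xy(1,2)] M2.zero[of 0 0] xy(3) by simp
    then show "x = y" using xy by simp
  qed
  have "M1.mcomplete"
    unfolding M1.mcomplete_def
  proof (intro allI impI)
    fix s assume "M1.MCauchy s"
    then have s: "\<And>k. s k \<in> H\<^sub>1"
      and Cauchy: "\<forall>\<epsilon>>0. \<exists>N. \<forall>n n'. N \<le> n \<longrightarrow> N \<le> n' \<longrightarrow> hnorm ip\<^sub>1 (s n - s n') < \<epsilon>"
      by (auto simp: M1.MCauchy_def)
    have "M2.MCauchy (T \<circ> s)"
      using s Cauchy T by (auto simp: M2.MCauchy_def dist)
    then obtain y where y: "limitin M2.mtopology (T \<circ> s) y sequentially"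
      using complete2 unfolding M2.mcomplete_def by blast
    then have "y \<in> H\<^sub>2" by (simp add: M2.limitin_metric)
    then obtain x where x: "x \<in> H\<^sub>1" "y = T x"
      using surj by blast
    then have "limitin M1.mtopology s x sequentially"
      using y s T by (simp add: M1.limitin_metric M2.limitin_metric dist)
    then show "\<exists>x. limitin M1.mtopology s x sequentially" by blast
  qed
  then show ?thesis
    using pre1 hil2 bij add scale norm by (simp add: isometric_isomorphism_def hilbert_space_iff)
qed

section \<open>Weighted Bergman spaces as pre-Hilbert spaces\<close>

locale weighted_domain =
  fixes n :: nat and \<Omega> :: "(nat \<Rightarrow> complex) set" and \<mu> :: "(nat \<Rightarrow> complex) \<Rightarrow> real"
  assumes open_domain: "open_Cn n \<Omega>"
    and continuous_weight: "continuous_on \<Omega> \<mu>"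
    and weight_pos: "\<And>w. w \<in> \<Omega> \<Longrightarrow> 0 < \<mu> w"
begin

lemma weight_nonneg: "w \<in> \<Omega> \<Longrightarrow> 0 \<le> \<mu> w"
  using weight_pos by (rule less_imp_le)

text \<open>
  The squared norm, but with values in \<open>[0, \<infinity>]\<close>: finiteness is then part
  of what identities between energies express.
\<close>

definition energy :: "((nat \<Rightarrow> complex) \<Rightarrow> complex) \<Rightarrow> ennreal" where
  "energy f = (\<integral>\<^sup>+w. ennreal ((cmod (f w))\<^sup>2 * \<mu> w) * indicator \<Omega> w \<partial>Cvol n)"

lemma measurable_on_domain:
  fixes h :: "(nat \<Rightarrow> complex) \<Rightarrow> 'b::real_normed_vector"
  shows "continuous_on \<Omega> h \<Longrightarrow> (\<lambda>w. indicator \<Omega> w *\<^sub>R h w) \<in> borel_measurable (Cvol n)"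
  by (rule borel_measurable_Cvol_continuous[OF _ open_domain])

lemma energy_integrand_measurable:
  assumes "continuous_on \<Omega> f"
  shows "(\<lambda>w. ennreal ((cmod (f w))\<^sup>2 * \<mu> w) * indicator \<Omega> w) \<in> borel_measurable (Cvol n)"
proof -
  have "(\<lambda>w. indicator \<Omega> w *\<^sub>R ((cmod (f w))\<^sup>2 * \<mu> w)) \<in> borel_measurable (Cvol n)"
    by (intro measurable_on_domain continuous_on_mult continuous_on_power continuous_on_norm
        assms continuous_weight)
  then have "(\<lambda>w. ennreal (indicator \<Omega> w *\<^sub>R ((cmod (f w))\<^sup>2 * \<mu> w))) \<in> borel_measurable (Cvol n)"
    by (rule measurable_compose[OF _ measurable_ennreal])
  also have "(\<lambda>w. ennreal (indicator \<Omega> w *\<^sub>R ((cmod (f w))\<^sup>2 * \<mu> w))) =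
      (\<lambda>w. ennreal ((cmod (f w))\<^sup>2 * \<mu> w) * indicator \<Omega> w)"
    by (auto split: split_indicator)
  finally show ?thesis .
qed

lemma energy_eq_integrand:
  "energy f = (\<integral>\<^sup>+w. ennreal (indicator \<Omega> w *\<^sub>R ((cmod (f w))\<^sup>2 * \<mu> w)) \<partial>Cvol n)"
  unfolding energy_def by (intro nn_integral_cong) (auto split: split_indicator)

lemma A2_iff:
  "f \<in> A2 n \<Omega> \<mu> \<longleftrightarrow> holomorphic_Cn n \<Omega> f \<and> (\<forall>w. w \<notin> \<Omega> \<longrightarrow> f w = 0) \<and> energy f < \<infinity>"
proof -
  have "set_integrable (Cvol n) \<Omega> (\<lambda>w. (cmod (f w))\<^sup>2 * \<mu> w) \<longleftrightarrow> energy f < \<infinity>"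
    if "holomorphic_Cn n \<Omega> f"
  proof -
    have "continuous_on \<Omega> f" using that by (simp add: holomorphic_Cn_def)
    then have "(\<lambda>w. indicator \<Omega> w *\<^sub>R ((cmod (f w))\<^sup>2 * \<mu> w)) \<in> borel_measurable (Cvol n)"
      by (intro measurable_on_domain continuous_on_mult continuous_on_power continuous_on_norm
          continuous_weight)
    moreover have "norm (indicator \<Omega> w *\<^sub>R ((cmod (f w))\<^sup>2 * \<mu> w)) = indicator \<Omega> w *\<^sub>R ((cmod (f w))\<^sup>2 * \<mu> w)" for w
      using weight_pos[of w] by (auto split: split_indicator simp: abs_mult)
    ultimately show ?thesis
      unfolding set_integrable_def integrable_iff_bounded energy_eq_integrand by simp
  qed
  then show ?thesis by (auto simp: A2_def)
qed

lemma A2_I: "holomorphic_Cn n \<Omega> f \<Longrightarrow> (\<And>w. w \<notin> \<Omega> \<Longrightarrow> f w = 0) \<Longrightarrow> energy f < \<infinity> \<Longrightarrow> f \<in> A2 n \<Omega> \<mu>"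
  by (simp add: A2_iff)

lemma A2_D:
  assumes "f \<in> A2 n \<Omega> \<mu>"
  shows "holomorphic_Cn n \<Omega> f" "w \<notin> \<Omega> \<Longrightarrow> f w = 0" "energy f < \<infinity>" "continuous_on \<Omega> f"
  using assms by (auto simp: A2_iff holomorphic_Cn_def)

lemma energy_eq_LINT:
  assumes "f \<in> A2 n \<Omega> \<mu>"
  shows "energy f = ennreal (LINT w:\<Omega>|Cvol n. (cmod (f w))\<^sup>2 * \<mu> w)"
  unfolding energy_eq_integrand set_lebesgue_integral_def
proof (rule nn_integral_eq_integral)
  show "integrable (Cvol n) (\<lambda>w. indicator \<Omega> w *\<^sub>R ((cmod (f w))\<^sup>2 * \<mu> w))"
    using assms by (simp add: A2_def set_integrable_def)
  show "AE w in Cvol n. 0 \<le> indicator \<Omega> w *\<^sub>R ((cmod (f w))\<^sup>2 * \<mu> w)"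
    by (intro AE_I2) (auto split: split_indicator intro!: mult_nonneg_nonneg weight_nonneg)
qed

lemma energy_eq_hnorm:
  assumes "f \<in> A2 n \<Omega> \<mu>"
  shows "energy f = ennreal ((hnorm (A2_inner n \<Omega> \<mu>) f)\<^sup>2)"
  using energy_eq_LINT[OF assms] hnorm_A2[of \<Omega> \<mu> n f] weight_pos by (simp add: less_imp_le)

lemma energy_add_le:
  assumes "continuous_on \<Omega> f" "continuous_on \<Omega> g"
  shows "energy (f + g) \<le> 2 * energy f + 2 * energy g"
proof -
  have "energy (f + g) \<le> (\<integral>\<^sup>+w. 2 * (ennreal ((cmod (f w))\<^sup>2 * \<mu> w) * indicator \<Omega> w) +
      2 * (ennreal ((cmod (g w))\<^sup>2 * \<mu> w) * indicator \<Omega> w) \<partial>Cvol n)"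
    unfolding energy_def
  proof (intro nn_integral_mono)
    fix w
    show "ennreal ((cmod ((f + g) w))\<^sup>2 * \<mu> w) * indicator \<Omega> w \<le>
      2 * (ennreal ((cmod (f w))\<^sup>2 * \<mu> w) * indicator \<Omega> w) + 2 * (ennreal ((cmod (g w))\<^sup>2 * \<mu> w) * indicator \<Omega> w)"
    proof (cases "w \<in> \<Omega>")
      case True
      have "(cmod (f w + g w))\<^sup>2 \<le> (cmod (f w) + cmod (g w))\<^sup>2"
        by (intro power_mono norm_triangle_ineq) simp
      also have "\<dots> \<le> 2 * (cmod (f w))\<^sup>2 + 2 * (cmod (g w))\<^sup>2"
        using zero_le_power2[of "cmod (f w) - cmod (g w)"] by (simp add: power2_sum power2_diff)
      finally have "(cmod (f w + g w))\<^sup>2 * \<mu> w \<le> (2 * (cmod (f w))\<^sup>2 + 2 * (cmod (g w))\<^sup>2) * \<mu> w"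
        using weight_pos[OF True] by (intro mult_right_mono) auto
      then have "ennreal ((cmod (f w + g w))\<^sup>2 * \<mu> w) \<le>
          ennreal (2 * ((cmod (f w))\<^sup>2 * \<mu> w) + 2 * ((cmod (g w))\<^sup>2 * \<mu> w))"
        by (intro ennreal_leI) (simp add: distrib_right)
      also have "\<dots> = 2 * ennreal ((cmod (f w))\<^sup>2 * \<mu> w) + 2 * ennreal ((cmod (g w))\<^sup>2 * \<mu> w)"
        using weight_pos[OF True] by (simp add: ennreal_plus ennreal_mult del: ennreal_plus[symmetric])
      finally show ?thesis using True by simp
    qed simp
  qed
  also have "\<dots> = 2 * energy f + 2 * energy g"
    unfolding energy_def using energy_integrand_measurable[OF assms(1)] energy_integrand_measurable[OF assms(2)]
    by (simp add: nn_integral_add nn_integral_cmult)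
  finally show ?thesis .
qed

lemma energy_scale:
  assumes "continuous_on \<Omega> f"
  shows "energy (A2_scale c f) = ennreal ((cmod c)\<^sup>2) * energy f"
  unfolding energy_def nn_integral_cmult[OF energy_integrand_measurable[OF assms], symmetric]
  by (intro nn_integral_cong)
     (auto simp: A2_scale_def norm_mult power_mult_distrib ennreal_mult[symmetric] mult.assoc
       weight_pos less_imp_le split: split_indicator)

lemma A2_zero: "0 \<in> A2 n \<Omega> \<mu>"
  by (rule A2_I) (simp_all add: energy_def zero_fun_def holomorphic_Cn_const)

lemma A2_add:
  assumes "f \<in> A2 n \<Omega> \<mu>" "g \<in> A2 n \<Omega> \<mu>"
  shows "f + g \<in> A2 n \<Omega> \<mu>"
proof (rule A2_I)
  show "holomorphic_Cn n \<Omega> (f + g)"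
    unfolding plus_fun_def by (intro holomorphic_Cn_add A2_D(1) assms)
  show "energy (f + g) < \<infinity>"
    using energy_add_le[OF A2_D(4)[OF assms(1)] A2_D(4)[OF assms(2)]] A2_D(3)[OF assms(1)] A2_D(3)[OF assms(2)]
    by (auto simp: ennreal_mult_less_top intro: le_less_trans)
qed (simp add: A2_D(2)[OF assms(1)] A2_D(2)[OF assms(2)])

lemma A2_scale_closed:
  assumes "f \<in> A2 n \<Omega> \<mu>"
  shows "A2_scale c f \<in> A2 n \<Omega> \<mu>"
proof (rule A2_I)
  show "holomorphic_Cn n \<Omega> (A2_scale c f)"
    unfolding A2_scale_def by (intro holomorphic_Cn_mult holomorphic_Cn_const A2_D(1) assms)
  show "energy (A2_scale c f) < \<infinity>"
    using A2_D(3)[OF assms] by (simp add: energy_scale[OF A2_D(4)[OF assms]] ennreal_mult_less_top)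
qed (simp add: A2_scale_def A2_D(2)[OF assms])

text \<open>
  From \<open>cmod (f w) * cmod (g w) \<le> (cmod (f w))\<^sup>2 + (cmod (g w))\<^sup>2\<close>.
  The second part is cruder than the Cauchy-Schwarz inequality, but it is additive and thus sums
  well over \<open>k\<close> for coefficient sequences.
\<close>

lemma A2_inner_integrable:
  assumes "f \<in> A2 n \<Omega> \<mu>" "g \<in> A2 n \<Omega> \<mu>"
  shows "integrable (Cvol n) (\<lambda>w. indicator \<Omega> w *\<^sub>R (f w * cnj (g w) * of_real (\<mu> w)))"
    and "cmod (A2_inner n \<Omega> \<mu> f g) \<le>
      (LINT w:\<Omega>|Cvol n. (cmod (f w))\<^sup>2 * \<mu> w) + (LINT w:\<Omega>|Cvol n. (cmod (g w))\<^sup>2 * \<mu> w)"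
proof -
  let ?u = "\<lambda>f w. indicator \<Omega> w *\<^sub>R ((cmod (f w))\<^sup>2 * \<mu> w)"
  let ?v = "\<lambda>w. indicator \<Omega> w *\<^sub>R (f w * cnj (g w) * of_real (\<mu> w))"
  have int: "integrable (Cvol n) (?u f)" "integrable (Cvol n) (?u g)"
    using assms by (simp_all add: A2_def set_integrable_def)
  have meas: "?v \<in> borel_measurable (Cvol n)"
    by (intro measurable_on_domain continuous_on_mult continuous_on_cnj continuous_on_of_real
        continuous_weight A2_D(4) assms)
  have le: "norm (?v w) \<le> ?u f w + ?u g w" for w
  proof (cases "w \<in> \<Omega>")
    case True
    have "cmod (f w) * cmod (g w) \<le> (cmod (f w))\<^sup>2 + (cmod (g w))\<^sup>2"
    proof -
      have "0 \<le> cmod (f w) * cmod (g w)" by simp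
      then show ?thesis using sum_squares_bound[of "cmod (f w)" "cmod (g w)"] by linarith
    qed
    then have "cmod (f w) * cmod (g w) * \<mu> w \<le> ((cmod (f w))\<^sup>2 + (cmod (g w))\<^sup>2) * \<mu> w"
      using weight_pos[OF True] by (intro mult_right_mono) auto
    then show ?thesis using True weight_pos[OF True] by (simp add: norm_mult distrib_right)
  qed simp
  show int_v: "integrable (Cvol n) ?v"
    by (rule Bochner_Integration.integrable_bound[OF Bochner_Integration.integrable_add[OF int] meas])
       (intro AE_I2 order_trans[OF le], simp)
  have "cmod (A2_inner n \<Omega> \<mu> f g) \<le> (LINT w|Cvol n. norm (?v w))"
    unfolding A2_inner_def set_lebesgue_integral_def by (rule integral_norm_bound)
  also have "\<dots> \<le> (LINT w|Cvol n. ?u f w + ?u g w)"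
    by (intro integral_mono integrable_norm int_v Bochner_Integration.integrable_add int le)
  also have "\<dots> = (LINT w:\<Omega>|Cvol n. (cmod (f w))\<^sup>2 * \<mu> w) + (LINT w:\<Omega>|Cvol n. (cmod (g w))\<^sup>2 * \<mu> w)"
    unfolding set_lebesgue_integral_def by (rule Bochner_Integration.integral_add[OF int])
  finally show "cmod (A2_inner n \<Omega> \<mu> f g) \<le>
      (LINT w:\<Omega>|Cvol n. (cmod (f w))\<^sup>2 * \<mu> w) + (LINT w:\<Omega>|Cvol n. (cmod (g w))\<^sup>2 * \<mu> w)" .
qed

lemma A2_inner_add:
  assumes "f \<in> A2 n \<Omega> \<mu>" "g \<in> A2 n \<Omega> \<mu>" "h \<in> A2 n \<Omega> \<mu>"
  shows "A2_inner n \<Omega> \<mu> (f + g) h = A2_inner n \<Omega> \<mu> f h + A2_inner n \<Omega> \<mu> g h"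
  unfolding A2_inner_def set_lebesgue_integral_def
  by (subst Bochner_Integration.integral_add[OF A2_inner_integrable(1)[OF assms(1,3)] A2_inner_integrable(1)[OF assms(2,3)], symmetric])
     (intro Bochner_Integration.integral_cong refl, simp add: distrib_right scaleR_add_right)

lemma A2_inner_scale: "A2_inner n \<Omega> \<mu> (A2_scale c f) g = c * A2_inner n \<Omega> \<mu> f g"
  unfolding A2_inner_def set_lebesgue_integral_def integral_mult_right_zero[symmetric]
  by (intro Bochner_Integration.integral_cong refl) (simp add: A2_scale_def mult_ac)

lemma A2_inner_cnj: "A2_inner n \<Omega> \<mu> g f = cnj (A2_inner n \<Omega> \<mu> f g)"
  unfolding A2_inner_def set_lebesgue_integral_def Bochner_Integration.integral_cnj[symmetric]
  by (intro Bochner_Integration.integral_cong refl) (simp add: mult_ac)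

lemma A2_inner_uminus: "A2_inner n \<Omega> \<mu> (- f) (- f) = A2_inner n \<Omega> \<mu> f f"
  by (simp add: A2_inner_def)

lemma A2_inner_nonneg: "0 \<le> Re (A2_inner n \<Omega> \<mu> f f)"
  unfolding A2_inner_self set_lebesgue_integral_def Re_complex_of_real
  by (intro Bochner_Integration.integral_nonneg)
    (auto split: split_indicator intro!: mult_nonneg_nonneg weight_nonneg)

text \<open>
  This is the mean value inequality, with the weight replaced by a lower bound for it.
\<close>

lemma polydisc_energy_bound:
  assumes "holomorphic_Cn n \<Omega> f" "w \<in> Cn n" "0 < r" "polydisc n w r \<subseteq> \<Omega>"
    and c: "0 \<le> c" "\<And>v. v \<in> polydisc n w r \<Longrightarrow> c \<le> \<mu> v"
  shows "ennreal ((cmod (f w))\<^sup>2 * ((pi * r\<^sup>2) ^ n * c)) \<le> energy f"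
proof -
  let ?P = "polydisc n w r"
  have hol: "holomorphic_Cn n ?P f" by (rule holomorphic_Cn_subset[OF assms(1,4)])
  have "(\<lambda>v. ennreal ((cmod (f v))\<^sup>2) * indicator ?P v) \<in> borel_measurable (Cvol n)"
    by (rule borel_measurable_indicator_norm_square[OF borel_measurable_Cvol_continuous[OF _ open_Cn_polydisc]])
       (use hol in \<open>simp add: holomorphic_Cn_def\<close>)
  note meas = this
  have "ennreal ((cmod (f w))\<^sup>2 * ((pi * r\<^sup>2) ^ n * c)) = ennreal ((cmod (f w))\<^sup>2) * ennreal (pi * r\<^sup>2) ^ n * ennreal c"
  proof -
    have "ennreal (pi * r\<^sup>2) ^ n = ennreal ((pi * r\<^sup>2) ^ n)" by (rule ennreal_power) simp
    then show ?thesis using c(1) by (simp add: ennreal_mult[symmetric] mult.assoc)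
  qed
  also have "\<dots> \<le> (\<integral>\<^sup>+v\<in>?P. ennreal ((cmod (f v))\<^sup>2) \<partial>Cvol n) * ennreal c"
    by (intro mult_right_mono polydisc_mean_value_inequality assms(2,3) hol) simp
  also have "\<dots> = (\<integral>\<^sup>+v. ennreal ((cmod (f v))\<^sup>2) * indicator ?P v * ennreal c \<partial>Cvol n)"
    by (rule nn_integral_multc[OF meas, symmetric])
  also have "\<dots> \<le> energy f"
    unfolding energy_def
  proof (intro nn_integral_mono)
    fix v
    show "ennreal ((cmod (f v))\<^sup>2) * indicator ?P v * ennreal c \<le> ennreal ((cmod (f v))\<^sup>2 * \<mu> v) * indicator \<Omega> v"
    proof (cases "v \<in> ?P")
      case True
      then have "v \<in> \<Omega>" using assms(4) by blast
      then show ?thesis using True c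
        by (simp add: ennreal_mult[symmetric] mult_left_mono ennreal_leI)
    qed simp
  qed
  finally show ?thesis .
qed

text \<open>
  Evaluation at points near \<open>w\<^sub>0\<close> is uniformly bounded by the norm: near
  \<open>w\<^sub>0\<close> the continuous weight exceeds \<open>\<mu> w\<^sub>0 / 2\<close>, and
  polydiscs of a fixed radius fit into that neighbourhood.
\<close>

lemma local_energy_bound:
  assumes "w\<^sub>0 \<in> \<Omega>"
  obtains r C where "0 < r" "0 < C" "polydisc n w\<^sub>0 r \<subseteq> \<Omega>"
    "\<And>f w. holomorphic_Cn n \<Omega> f \<Longrightarrow> w \<in> polydisc n w\<^sub>0 r \<Longrightarrow> ennreal ((cmod (f w))\<^sup>2) \<le> ennreal C * energy f"
proof -
  define c where "c = \<mu> w\<^sub>0 / 2"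
  have c: "0 < c" "c < \<mu> w\<^sub>0" using weight_pos[OF assms] by (simp_all add: c_def)
  have "openin (top_of_set \<Omega>) (\<Omega> \<inter> \<mu> -` {c<..})"
    by (rule continuous_openin_preimage_gen[OF continuous_weight open_greaterThan])
  then have "open_Cn n (\<Omega> \<inter> \<mu> -` {c<..})"
    using open_domain openin_trans by blast
  moreover have "w\<^sub>0 \<in> \<Omega> \<inter> \<mu> -` {c<..}" using assms c by simp
  ultimately obtain s where s: "0 < s" "polydisc n w\<^sub>0 s \<subseteq> \<Omega> \<inter> \<mu> -` {c<..}"
    by (rule open_Cn_contains_polydisc)
  define r where "r = s / 2"
  define K where "K = (pi * r\<^sup>2) ^ n * c"
  have r: "0 < r" "r + r \<le> s" using s(1) by (simp_all add: r_def)
  have K: "0 < K" using r(1) c(1) by (simp add: K_def)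
  show thesis
  proof (rule that[of r "inverse K"])
    show "0 < r" "0 < inverse K" using r K by simp_all
    show "polydisc n w\<^sub>0 r \<subseteq> \<Omega>"
      using s(2) polydisc_mono[of r s n w\<^sub>0] r by auto
    fix f w assume f: "holomorphic_Cn n \<Omega> f" and w: "w \<in> polydisc n w\<^sub>0 r"
    have sub: "polydisc n w r \<subseteq> polydisc n w\<^sub>0 s"
      by (rule polydisc_subset_polydisc[OF w r(2)])
    have "ennreal ((cmod (f w))\<^sup>2 * K) \<le> energy f"
      unfolding K_def
    proof (rule polydisc_energy_bound[OF f _ r(1)])
      show "w \<in> Cn n" using w by (simp add: polydisc_def)
      show "polydisc n w r \<subseteq> \<Omega>" using sub s(2) by blast
      show "0 \<le> c" using c by simp
      show "c \<le> \<mu> v" if "v \<in> polydisc n w r" for v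
        using that sub s(2) by (auto intro: less_imp_le)
    qed
    then have "ennreal (inverse K) * ennreal ((cmod (f w))\<^sup>2 * K) \<le> ennreal (inverse K) * energy f"
      by (rule mult_left_mono) simp
    also have "ennreal (inverse K) * ennreal ((cmod (f w))\<^sup>2 * K) = ennreal ((cmod (f w))\<^sup>2)"
      using K by (simp add: ennreal_mult[symmetric] field_simps)
    finally show "ennreal ((cmod (f w))\<^sup>2) \<le> ennreal (inverse K) * energy f" .
  qed
qed

lemma energy_zero_imp_zero:
  assumes "f \<in> A2 n \<Omega> \<mu>" "energy f = 0"
  shows "f = 0"
proof
  fix w
  show "f w = 0 w"
  proof (cases "w \<in> \<Omega>")
    case True
    then obtain r C where r: "0 < r"
      "\<And>f v. holomorphic_Cn n \<Omega> f \<Longrightarrow> v \<in> polydisc n w r \<Longrightarrow> ennreal ((cmod (f v))\<^sup>2) \<le> ennreal C * energy f"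
      by (rule local_energy_bound) blast
    have "w \<in> polydisc n w r"
      using True open_Cn_subset[OF open_domain] r(1) by (auto intro: centre_in_polydisc)
    from r(2)[OF A2_D(1)[OF assms(1)] this] show ?thesis
      by (simp add: assms(2))
  qed (simp add: A2_D(2)[OF assms(1)])
qed

lemma pre_hilbert_A2: "pre_hilbert_space A2_scale (A2 n \<Omega> \<mu>) (A2_inner n \<Omega> \<mu>)"
proof -
  interpret V: vector_space A2_scale
    by standard (auto simp: A2_scale_def fun_eq_iff algebra_simps)
  have "V.subspace (A2 n \<Omega> \<mu>)"
    using A2_zero A2_add A2_scale_closed by (intro V.subspaceI) auto
  moreover have "f = 0" if "f \<in> A2 n \<Omega> \<mu>" "A2_inner n \<Omega> \<mu> f f = 0" for f
    using that energy_eq_hnorm[OF that(1)] by (intro energy_zero_imp_zero) (simp_all add: hnorm_def)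
  ultimately show ?thesis
    unfolding pre_hilbert_space_def
    by (intro conjI ballI allI impI V.vector_space_axioms A2_inner_add A2_inner_scale A2_inner_nonneg) 
       (auto intro: A2_inner_cnj)
qed

end

section \<open>Completeness of weighted Bergman spaces\<close>

context weighted_domain
begin

text \<open>
  This is Fatou's lemma.
\<close>

lemma energy_limit_le:
  assumes f: "\<And>k. continuous_on \<Omega> (f k)" and lim: "\<And>w. w \<in> \<Omega> \<Longrightarrow> (\<lambda>k. f k w) \<longlonglongrightarrow> g w"
    and le: "\<And>k. N \<le> k \<Longrightarrow> energy (f k) \<le> B"
  shows "energy g \<le> B"
proof -
  have "energy g = (\<integral>\<^sup>+w. liminf (\<lambda>k. ennreal ((cmod (f k w))\<^sup>2 * \<mu> w) * indicator \<Omega> w) \<partial>Cvol n)"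
    unfolding energy_def
  proof (intro nn_integral_cong)
    fix w
    have "(\<lambda>k. ennreal ((cmod (f k w))\<^sup>2 * \<mu> w) * indicator \<Omega> w) \<longlonglongrightarrow> ennreal ((cmod (g w))\<^sup>2 * \<mu> w) * indicator \<Omega> w"
    proof (cases "w \<in> \<Omega>")
      case True
      then show ?thesis
        by (simp add: tendsto_ennrealI tendsto_mult_right tendsto_power tendsto_norm lim)
    qed simp
    then show "ennreal ((cmod (g w))\<^sup>2 * \<mu> w) * indicator \<Omega> w =
        liminf (\<lambda>k. ennreal ((cmod (f k w))\<^sup>2 * \<mu> w) * indicator \<Omega> w)"
      by (rule lim_imp_Liminf[OF sequentially_bot, symmetric])
  qed
  also have "\<dots> \<le> liminf (\<lambda>k. energy (f k))"
    unfolding energy_def by (rule nn_integral_liminf[OF energy_integrand_measurable[OF f]])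
  also have "\<dots> \<le> liminf (\<lambda>k. B)"
    by (rule Liminf_mono) (use le in \<open>auto simp: eventually_sequentially\<close>)
  finally show ?thesis by (simp add: Liminf_const)
qed

text \<open>
  Because evaluation is locally uniformly bounded, a sequence that is Cauchy in norm is locally
  uniformly Cauchy.
\<close>

lemma Cauchy_imp_locally_uniform_limit:
  assumes f: "\<And>k. f k \<in> A2 n \<Omega> \<mu>"
    and Cauchy: "\<And>e. 0 < e \<Longrightarrow> \<exists>N. \<forall>j\<ge>N. \<forall>k\<ge>N. energy (f j - f k) \<le> ennreal e"
    and w: "w \<in> \<Omega>"
  obtains r where "0 < r" "polydisc n w r \<subseteq> \<Omega>"
    "uniform_limit (polydisc n w r) f (\<lambda>v. lim (\<lambda>k. f k v)) sequentially"
proof -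
  obtain r C where r: "0 < r" "0 < C" "polydisc n w r \<subseteq> \<Omega>"
    and bound: "\<And>f v. holomorphic_Cn n \<Omega> f \<Longrightarrow> v \<in> polydisc n w r \<Longrightarrow> ennreal ((cmod (f v))\<^sup>2) \<le> ennreal C * energy f"
    by (rule local_energy_bound[OF w]) blast
  have "uniformly_Cauchy_on (polydisc n w r) f"
    unfolding uniformly_Cauchy_on_def
  proof (intro allI impI)
    fix e :: real assume e: "0 < e"
    (* Halving e turns the non-strict energy bound into a strict bound on distances. *)
    define \<epsilon> where "\<epsilon> = (e / 2)\<^sup>2 / C"
    have "0 < \<epsilon>" using e r(2) by (simp add: \<epsilon>_def)
    then obtain N where N: "\<And>j k. N \<le> j \<Longrightarrow> N \<le> k \<Longrightarrow> energy (f j - f k) \<le> ennreal \<epsilon>"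
      using Cauchy by blast
    have "dist (f j v) (f k v) < e" if v: "v \<in> polydisc n w r" and jk: "N \<le> j" "N \<le> k" for v j k
    proof -
      have "holomorphic_Cn n \<Omega> (f j - f k)"
        unfolding fun_diff_def by (intro holomorphic_Cn_diff A2_D(1) f)
      then have "ennreal ((cmod ((f j - f k) v))\<^sup>2) \<le> ennreal C * energy (f j - f k)"
        using v by (rule bound)
      also have "\<dots> \<le> ennreal C * ennreal \<epsilon>"
        by (intro mult_left_mono N jk) simp
      also have "\<dots> = ennreal ((e / 2)\<^sup>2)"
        using r(2) \<open>0 < \<epsilon>\<close> by (simp add: ennreal_mult[symmetric] \<epsilon>_def)
      finally have "(cmod ((f j - f k) v))\<^sup>2 \<le> (e / 2)\<^sup>2"
        by (subst (asm) ennreal_le_iff) simp_all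
      then have "cmod ((f j - f k) v) \<le> e / 2"
        by (rule power2_le_imp_le) (use e in simp)
      then show ?thesis using e by (simp add: dist_norm)
    qed
    then show "\<exists>M. \<forall>v\<in>polydisc n w r. \<forall>j\<ge>M. \<forall>k\<ge>M. dist (f j v) (f k v) < e" by blast
  qed
  then have "uniformly_convergent_on (polydisc n w r) f"
    by (rule Cauchy_uniformly_convergent)
  then have "uniform_limit (polydisc n w r) f (\<lambda>v. lim (\<lambda>k. f k v)) sequentially"
    by (simp only: uniformly_convergent_uniform_limit_iff)
  with r show thesis using that by blast
qed

text \<open>
  The locally uniform limit of a Cauchy sequence is holomorphic, and by Fatou's lemma it is also
  the limit in norm.
\<close>

lemma hilbert_space_A2: "hilbert_space A2_scale (A2 n \<Omega> \<mu>) (A2_inner n \<Omega> \<mu>)"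
proof -
  let ?d = "\<lambda>f g. hnorm (A2_inner n \<Omega> \<mu>) (f - g)"
  interpret Metric_space "A2 n \<Omega> \<mu>" ?d
    by (rule pre_hilbert_Metric_space) (rule pre_hilbert_A2 A2_inner_uminus)+
  have A2_diff: "f - g \<in> A2 n \<Omega> \<mu>" if "f \<in> A2 n \<Omega> \<mu>" "g \<in> A2 n \<Omega> \<mu>" for f g
    using that by (rule pre_hilbert_closed(4)[OF pre_hilbert_A2])
  have energy_d: "energy (f - g) = ennreal ((?d f g)\<^sup>2)" if "f \<in> A2 n \<Omega> \<mu>" "g \<in> A2 n \<Omega> \<mu>" for f g
    using energy_eq_hnorm[OF A2_diff[OF that]] .
  have "mcomplete"
    unfolding mcomplete_def
  proof (intro allI impI)
    fix f assume "MCauchy f"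
    then have f: "\<And>k. f k \<in> A2 n \<Omega> \<mu>"
      and Cauchy: "\<And>e. 0 < e \<Longrightarrow> \<exists>N. \<forall>j k. N \<le> j \<longrightarrow> N \<le> k \<longrightarrow> ?d (f j) (f k) < e"
      by (auto simp: MCauchy_def)
    have energy_Cauchy: "\<exists>N. \<forall>j\<ge>N. \<forall>k\<ge>N. energy (f j - f k) \<le> ennreal e" if "0 < e" for e
    proof -
      have sqrt_pos: "0 < sqrt e" using that by simp
      obtain N where N: "\<And>j k. N \<le> j \<Longrightarrow> N \<le> k \<Longrightarrow> ?d (f j) (f k) < sqrt e"
        using Cauchy[OF sqrt_pos] by blast
      have "energy (f j - f k) \<le> ennreal e" if "N \<le> j" "N \<le> k" for j k
      proof -
        have "(?d (f j) (f k))\<^sup>2 \<le> (sqrt e)\<^sup>2"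
          by (rule power_mono[OF less_imp_le[OF N[OF that]] nonneg])
        then show ?thesis using \<open>0 < e\<close> by (simp add: energy_d[OF f f] ennreal_leI)
      qed
      then show ?thesis by blast
    qed
    define g where "g w = lim (\<lambda>k. f k w)" for w
    have g_out: "g w = 0" if "w \<notin> \<Omega>" for w
      using A2_D(2)[OF f that] by (simp add: g_def)
    have unif: "\<exists>r>0. polydisc n w r \<subseteq> \<Omega> \<and> uniform_limit (polydisc n w r) f g sequentially"
      if "w \<in> \<Omega>" for w
      using Cauchy_imp_locally_uniform_limit[OF f energy_Cauchy that] unfolding g_def by blast
    have hol: "holomorphic_Cn n \<Omega> g"
    proof (rule holomorphic_Cn_local[OF open_domain])
      fix w assume "w \<in> \<Omega>"
      then obtain r where r: "0 < r" "polydisc n w r \<subseteq> \<Omega>" "uniform_limit (polydisc n w r) f g sequentially"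
        using unif by blast
      have "holomorphic_Cn n (polydisc n w r) g"
        by (rule holomorphic_Cn_uniform_limit[OF open_Cn_polydisc holomorphic_Cn_subset[OF A2_D(1)[OF f] r(2)] r(3)])
      with r(1) show "\<exists>r>0. holomorphic_Cn n (polydisc n w r) g" by blast
    qed
    have ptw: "(\<lambda>k. f k w) \<longlonglongrightarrow> g w" if w: "w \<in> \<Omega>" for w
    proof -
      obtain r where r: "0 < r" "uniform_limit (polydisc n w r) f g sequentially"
        using unif[OF w] by blast
      have "w \<in> polydisc n w r"
        using w open_Cn_subset[OF open_domain] r(1) by (auto intro: centre_in_polydisc)
      then show ?thesis by (rule tendsto_uniform_limitI[OF r(2)])
    qed
    have tail: "energy (f j - g) \<le> ennreal e" if N: "\<And>j k. N \<le> j \<Longrightarrow> N \<le> k \<Longrightarrow> energy (f j - f k) \<le> ennreal e"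
      and "N \<le> j" for N j e
    proof (rule energy_limit_le[of "\<lambda>k. f j - f k" _ N])
      show "continuous_on \<Omega> (f j - f k)" for k by (rule A2_D(4)[OF A2_diff[OF f f]])
      show "(\<lambda>k. (f j - f k) w) \<longlonglongrightarrow> (f j - g) w" if "w \<in> \<Omega>" for w
        using ptw[OF that] by (simp add: tendsto_diff)
    qed (use that in simp)
    have fg: "f j - g \<in> A2 n \<Omega> \<mu>" if N: "\<And>j k. N \<le> j \<Longrightarrow> N \<le> k \<Longrightarrow> energy (f j - f k) \<le> ennreal e"
      and "N \<le> j" for N j e
    proof (rule A2_I)
      show "holomorphic_Cn n \<Omega> (f j - g)"
        unfolding fun_diff_def by (intro holomorphic_Cn_diff A2_D(1)[OF f] hol)
      show "energy (f j - g) < \<infinity>"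
        using tail[OF N that(2)] by (auto intro: le_less_trans)
    qed (simp add: A2_D(2)[OF f] g_out)
    have g: "g \<in> A2 n \<Omega> \<mu>"
    proof -
      obtain N where N: "\<And>j k. N \<le> j \<Longrightarrow> N \<le> k \<Longrightarrow> energy (f j - f k) \<le> ennreal 1"
        using energy_Cauchy[of 1] by auto
      have "f N - (f N - g) \<in> A2 n \<Omega> \<mu>"
        by (rule A2_diff[OF f fg[OF N order_refl]])
      then show ?thesis by simp
    qed
    have "limitin mtopology f g sequentially"
      unfolding limitin_metric
    proof (intro conjI allI impI g)
      fix e :: real assume e: "0 < e"
      then have "0 < (e / 2)\<^sup>2" by simp
      then obtain N where N: "\<And>j k. N \<le> j \<Longrightarrow> N \<le> k \<Longrightarrow> energy (f j - f k) \<le> ennreal ((e / 2)\<^sup>2)"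
        using energy_Cauchy by blast
      have "?d (f j) g < e" if "N \<le> j" for j
      proof -
        have "ennreal ((?d (f j) g)\<^sup>2) \<le> ennreal ((e / 2)\<^sup>2)"
          using tail[OF N that] by (simp only: energy_d[OF f g])
        then have "(?d (f j) g)\<^sup>2 \<le> (e / 2)\<^sup>2"
          by (subst (asm) ennreal_le_iff) simp_all
        then have "?d (f j) g \<le> e / 2"
          by (rule power2_le_imp_le) (use e in simp)
        then show ?thesis using e by simp
      qed
      then show "\<forall>\<^sub>F j in sequentially. f j \<in> A2 n \<Omega> \<mu> \<and> ?d (f j) g < e"
        using f by (auto simp: eventually_sequentially)
    qed
    then show "\<exists>g. limitin mtopology f g sequentially" by blast
  qed
  then show ?thesis using pre_hilbert_A2 by (simp add: hilbert_space_iff)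
qed

end

section \<open>Hartogs domains over sublevel sets\<close>

locale hartogs_domain =
  fixes n :: nat and p :: "(nat \<Rightarrow> complex) \<Rightarrow> real"
  assumes continuous_p: "continuous_on (Cn n) p"
begin

abbreviation "B \<equiv> ball_p n p"
abbreviation "E \<equiv> ellipsoid_p n p"

lemma open_sublevel: "open_Cn n {w \<in> Cn n. p w < c}"
proof -
  have "open_Cn n (Cn n \<inter> p -` {..<c})"
    by (rule continuous_openin_preimage_gen[OF continuous_p open_lessThan])
  also have "Cn n \<inter> p -` {..<c} = {w \<in> Cn n. p w < c}" by auto
  finally show ?thesis .
qed

lemma open_B: "open_Cn n B"
  unfolding ball_p_def by (rule open_sublevel)

lemma case_nat_in_E: "case_nat z w \<in> E \<longleftrightarrow> w \<in> Cn n \<and> (cmod z)\<^sup>2 + p w < 1"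
proof
  assume "case_nat z w \<in> E"
  then obtain z' w' where *: "case_nat z w = case_nat z' w'" "w' \<in> Cn n" "(cmod z')\<^sup>2 + p w' < 1"
    by (auto simp: ellipsoid_p_def)
  have "z = z'" using fun_cong[OF *(1), of 0] by simp
  moreover have "w = w'" using fun_cong[OF *(1), of "Suc i" for i] by (intro ext) simp
  ultimately show "w \<in> Cn n \<and> (cmod z)\<^sup>2 + p w < 1" using * by simp
qed (auto simp: ellipsoid_p_def)

lemma in_B_if_in_E:
  assumes "case_nat z w \<in> E"
  shows "w \<in> B"
proof -
  have "p w \<le> (cmod z)\<^sup>2 + p w" by simp
  also have "\<dots> < 1" using assms by (simp add: case_nat_in_E)
  finally show ?thesis using assms by (simp add: case_nat_in_E ball_p_def)
qed

lemma E_subset: "E \<subseteq> Cn (Suc n)"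
  by (auto simp: ellipsoid_p_def)

lemma in_E_iff: "v \<in> E \<longleftrightarrow> v \<circ> Suc \<in> Cn n \<and> (cmod (v 0))\<^sup>2 + p (v \<circ> Suc) < 1"
proof -
  have "v = case_nat (v 0) (v \<circ> Suc)" by (auto split: nat.split)
  then show ?thesis using case_nat_in_E by metis
qed

lemma open_E: "open_Cn (Suc n) E"
proof -
  have shift: "v \<circ> Suc \<in> Cn n" if v: "v \<in> Cn (Suc n)" for v
  proof -
    obtain z w where "v = case_nat z w" "w \<in> Cn n" using Cn_SucE[OF v] .
    moreover have "case_nat z w \<circ> Suc = w" by auto
    ultimately show ?thesis by simp
  qed
  have "continuous_on (Cn (Suc n)) (\<lambda>v. v \<circ> Suc)"
    by (rule continuous_on_coordinatewise_then_product) (simp add: continuous_on_component)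
  then have "continuous_on (Cn (Suc n)) (\<lambda>v. p (v \<circ> Suc))"
    by (rule continuous_on_compose2[OF continuous_p]) (use shift in blast)
  then have "continuous_on (Cn (Suc n)) (\<lambda>v. (cmod (v 0))\<^sup>2 + p (v \<circ> Suc))"
    by (intro continuous_on_add continuous_on_power continuous_on_norm continuous_on_component)
  from continuous_openin_preimage_gen[OF this open_lessThan]
  have "open_Cn (Suc n) (Cn (Suc n) \<inter> (\<lambda>v. (cmod (v 0))\<^sup>2 + p (v \<circ> Suc)) -` {..<1})" .
  also have "Cn (Suc n) \<inter> (\<lambda>v. (cmod (v 0))\<^sup>2 + p (v \<circ> Suc)) -` {..<1} = E"
    using shift E_subset by (auto simp: in_E_iff)
  finally show ?thesis .
qed

text \<open>
  Keeping the weight folded prevents the simplifier from splitting the power.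
\<close>

definition weight :: "nat \<Rightarrow> (nat \<Rightarrow> complex) \<Rightarrow> real" where
  "weight k w = (1 - p w) ^ (k + 1)"

sublocale W: weighted_domain n B "weight k" for k
  unfolding weight_def[abs_def]
proof
  show "open_Cn n B" by (rule open_B)
  show "continuous_on B (\<lambda>w. (1 - p w) ^ (k + 1))"
    by (intro continuous_on_power continuous_on_diff continuous_on_const
        continuous_on_subset[OF continuous_p]) (auto simp: ball_p_def)
qed (simp add: ball_p_def)

sublocale A: weighted_domain "Suc n" E "\<lambda>_. 1"
  by standard (simp_all add: open_E)

text \<open>
  By continuity, a whole cylinder over a neighbourhood of \<open>w\<^sub>0\<close> lies in the
  Hartogs domain.
\<close>

lemma tube:
  assumes "w\<^sub>0 \<in> Cn n" "p w\<^sub>0 < c"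
  obtains \<delta> where "0 < \<delta>" "\<And>w. w \<in> polydisc n w\<^sub>0 \<delta> \<Longrightarrow> p w < c"
proof -
  obtain \<delta> where "0 < \<delta>" "polydisc n w\<^sub>0 \<delta> \<subseteq> {w \<in> Cn n. p w < c}"
    by (rule open_Cn_contains_polydisc[OF open_sublevel]) (use assms in blast)
  then show thesis by (intro that) auto
qed

text \<open>
  Integrate over the fibre first: Parseval's identity with \<open>R = sqrt (1 - p w)\<close>
  gives the sum of \<open>pi / (k + 1) * (cmod (a k w))\<^sup>2 * (1 - p w) ^ (k + 1)\<close>.
  Then sum and integral over \<open>w\<close> may be exchanged, since everything is nonnegative.
\<close>

lemma energy_power_series:
  assumes a: "\<And>k. holomorphic_Cn n B (a k)" and f: "holomorphic_Cn (Suc n) E f"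
    and sums: "\<And>z w. case_nat z w \<in> E \<Longrightarrow> (\<lambda>k. a k w * z ^ k) sums f (case_nat z w)"
  shows "A.energy f = (\<Sum>k. ennreal (pi / real (k + 1)) * W.energy k (a k))"
proof -
  let ?F = "\<lambda>v. ennreal ((cmod (f v))\<^sup>2 * 1) * indicator E v"
  let ?G = "\<lambda>k w. ennreal ((cmod (a k w))\<^sup>2 * weight k w) * indicator B w"
  have G: "?G k \<in> borel_measurable (Cvol n)" for k
    by (rule W.energy_integrand_measurable) (use a in \<open>simp add: holomorphic_Cn_def\<close>)
  have "A.energy f = (\<integral>\<^sup>+w. \<integral>\<^sup>+z. ?F (case_nat z w) \<partial>lborel \<partial>Cvol n)"
    unfolding A.energy_def
    by (intro nn_integral_Cvol_Suc(2) A.energy_integrand_measurable)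
       (use f in \<open>simp add: holomorphic_Cn_def\<close>)
  also have "\<dots> = (\<integral>\<^sup>+w. (\<Sum>k. ennreal (pi / real (k + 1)) * ?G k w) \<partial>Cvol n)"
  proof (rule nn_integral_cong)
    fix w assume "w \<in> space (Cvol n)"
    then have w: "w \<in> Cn n" by simp
    show "(\<integral>\<^sup>+z. ?F (case_nat z w) \<partial>lborel) = (\<Sum>k. ennreal (pi / real (k + 1)) * ?G k w)"
    proof (cases "w \<in> B")
      case True
      define R where "R = sqrt (1 - p w)"
      have p: "p w < 1" using True by (simp add: ball_p_def)
      then have R: "0 < R" "R\<^sup>2 = 1 - p w" by (simp_all add: R_def)
      have iff: "case_nat z w \<in> E \<longleftrightarrow> cmod z < R" for z
      proof -
        have "case_nat z w \<in> E \<longleftrightarrow> (cmod z)\<^sup>2 < R\<^sup>2"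
          using w R(2) by (simp add: case_nat_in_E) linarith
        also have "\<dots> \<longleftrightarrow> cmod z < R"
          using R(1) by (intro iffI power_strict_mono) (auto intro: power2_less_imp_less)
        finally show ?thesis .
      qed
      have "(\<integral>\<^sup>+z. ?F (case_nat z w) \<partial>lborel) = (\<integral>\<^sup>+z\<in>ball 0 R. ennreal ((cmod (f (case_nat z w)))\<^sup>2) \<partial>lborel)"
        by (intro nn_integral_cong) (simp add: indicator_def iff)
      also have "\<dots> = (\<Sum>k. ennreal (pi * (cmod (a k w))\<^sup>2 * R ^ (2 * k + 2) / (k + 1)))"
        using sums iff by (intro Parseval_ball R(1)) blast
      also have "\<dots> = (\<Sum>k. ennreal (pi / real (k + 1)) * ?G k w)"
      proof (rule suminf_cong)
        fix k
        have "R ^ (2 * k + 2) = (R\<^sup>2) ^ (k + 1)" by (simp add: power_mult power2_eq_square)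
        then have R_eq: "pi * (cmod (a k w))\<^sup>2 * R ^ (2 * k + 2) / (k + 1) =
            pi / real (k + 1) * ((cmod (a k w))\<^sup>2 * weight k w)"
          by (simp add: R(2) weight_def)
        have "ennreal (pi / real (k + 1) * ((cmod (a k w))\<^sup>2 * weight k w)) =
            ennreal (pi / real (k + 1)) * ennreal ((cmod (a k w))\<^sup>2 * weight k w)"
          using W.weight_nonneg[OF True] by (intro ennreal_mult) auto
        then show "ennreal (pi * (cmod (a k w))\<^sup>2 * R ^ (2 * k + 2) / (k + 1)) =
            ennreal (pi / real (k + 1)) * ?G k w"
          by (simp only: R_eq indicator_simps(1)[OF True] mult_1_right)
      qed
      finally show ?thesis .
    next
      case False
      then have "case_nat z w \<notin> E" for z
        using in_B_if_in_E by blast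
      then show ?thesis using False by simp
    qed
  qed
  also have "\<dots> = (\<Sum>k. \<integral>\<^sup>+w. ennreal (pi / real (k + 1)) * ?G k w \<partial>Cvol n)"
    by (rule nn_integral_suminf) (intro borel_measurable_times_ennreal borel_measurable_const G)
  also have "\<dots> = (\<Sum>k. ennreal (pi / real (k + 1)) * W.energy k (a k))"
    unfolding W.energy_def by (intro suminf_cong nn_integral_cmult G)
  finally show ?thesis .
qed

lemma radial_factor_neq_0: "ennreal (pi / real (k + 1)) \<noteq> 0"
proof -
  have "0 < pi / real (k + 1)" by (intro divide_pos_pos pi_gt_zero) simp
  then show ?thesis by (simp only: ennreal_eq_0_iff not_le)
qed

text \<open>
  The factor \<open>pi / real (k + 1)\<close> is what integrating \<open>(cmod z) ^ (2 *
  k)\<close> over a fibre contributes.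
\<close>

definition Y_energy :: "(nat \<Rightarrow> (nat \<Rightarrow> complex) \<Rightarrow> complex) \<Rightarrow> ennreal" where
  "Y_energy a = (\<Sum>k. ennreal (pi / real (k + 1)) * W.energy k (a k))"

abbreviation "W_int k f \<equiv> (LINT w:B|Cvol n. (cmod (f w))\<^sup>2 * weight k w)"

abbreviation "W_inner k \<equiv> A2_inner n B (weight k)"

lemma Y_space_weight:
  "a \<in> Y_space n p \<longleftrightarrow>
    (\<forall>k. a k \<in> A2 n B (weight k)) \<and> summable (\<lambda>k. 1 / real (k + 1) * W_int k (a k))"
  by (simp only: Y_space_def W_space_def weight_def[abs_def] mem_Collect_eq)

lemma Y_inner_weight:
  "Y_inner n p a b = of_real pi * (\<Sum>k. of_real (1 / real (k + 1)) * W_inner k (a k) (b k))"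
  by (simp only: Y_inner_def weight_def[abs_def])

lemma W_int_nonneg: "0 \<le> W_int k f"
  using W.A2_inner_nonneg[where k=k and f=f] by (simp add: A2_inner_self)

lemma Y_energy_terms:
  assumes "\<And>k. a k \<in> A2 n B (weight k)"
  shows "Y_energy a = (\<Sum>k. ennreal (pi * (1 / real (k + 1) * W_int k (a k))))"
proof -
  have "ennreal (pi / real (k + 1)) * W.energy k (a k) = ennreal (pi * (1 / real (k + 1) * W_int k (a k)))" for k
  proof -
    have "W.energy k (a k) = ennreal (W_int k (a k))"
      using assms[of k] by (rule W.energy_eq_LINT)
    then show ?thesis
      using ennreal_mult[of "pi / real (k + 1)" "W_int k (a k)"] W_int_nonneg[of "a k" k]
      by simp
  qed
  then show ?thesis by (simp only: Y_energy_def)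
qed

lemma Y_space_iff: "a \<in> Y_space n p \<longleftrightarrow> (\<forall>k. a k \<in> A2 n B (weight k)) \<and> Y_energy a < \<infinity>"
proof -
  let ?t = "\<lambda>k. 1 / real (k + 1) * W_int k (a k)"
  have nonneg: "0 \<le> pi * ?t k" for k
    by (intro mult_nonneg_nonneg W_int_nonneg) auto
  have "summable ?t \<longleftrightarrow> Y_energy a < \<infinity>" if "\<And>k. a k \<in> A2 n B (weight k)"
  proof
    assume "summable ?t"
    then have "summable (\<lambda>k. pi * ?t k)" by (rule summable_mult)
    then show "Y_energy a < \<infinity>"
      unfolding Y_energy_terms[OF that] by (subst suminf_ennreal2[OF nonneg]) simp_all
  next
    assume "Y_energy a < \<infinity>"
    then have "summable (\<lambda>k. pi * ?t k)"
      unfolding Y_energy_terms[OF that] by (intro summable_suminf_not_top nonneg) simp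
    from summable_mult[OF this, of "1 / pi"] show "summable ?t" by simp
  qed
  then show ?thesis unfolding Y_space_weight by blast
qed

lemma Y_energy_eq_hnorm:
  assumes "a \<in> Y_space n p"
  shows "Y_energy a = ennreal ((hnorm (Y_inner n p) a)\<^sup>2)"
proof -
  let ?t = "\<lambda>k. 1 / real (k + 1) * W_int k (a k)"
  have nonneg: "0 \<le> pi * ?t k" for k
    by (intro mult_nonneg_nonneg W_int_nonneg) auto
  have sm: "summable ?t" and W: "\<And>k. a k \<in> A2 n B (weight k)"
    using assms by (simp_all add: Y_space_weight)
  have "Y_energy a = ennreal (\<Sum>k. pi * ?t k)"
    unfolding Y_energy_terms[OF W] by (rule suminf_ennreal2[OF nonneg summable_mult[OF sm]])
  also have "(\<Sum>k. pi * ?t k) = pi * (\<Sum>k. ?t k)"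
    by (rule suminf_mult[OF sm])
  also have "\<dots> = (hnorm (Y_inner n p) a)\<^sup>2"
    by (simp only: hnorm_Y[OF assms] weight_def)
  finally show ?thesis .
qed

lemma Y_D:
  assumes "a \<in> Y_space n p"
  shows "a k \<in> A2 n B (weight k)" "Y_energy a < \<infinity>"
  using assms unfolding Y_space_iff by auto

lemma Y_add:
  assumes "a \<in> Y_space n p" "b \<in> Y_space n p"
  shows "a + b \<in> Y_space n p"
  unfolding Y_space_iff
proof (intro conjI allI)
  show "(a + b) k \<in> A2 n B (weight k)" for k
    using W.A2_add[OF Y_D(1)[OF assms(1)] Y_D(1)[OF assms(2)]] by simp
  have "Y_energy (a + b) \<le> (\<Sum>k. 2 * (ennreal (pi / real (k + 1)) * W.energy k (a k)) +
      2 * (ennreal (pi / real (k + 1)) * W.energy k (b k)))"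
    unfolding Y_energy_def
  proof (intro suminf_le summableI)
    fix k
    have "W.energy k (a k + b k) \<le> 2 * W.energy k (a k) + 2 * W.energy k (b k)"
      by (intro W.energy_add_le W.A2_D(4)[OF Y_D(1)] assms)
    then have "ennreal (pi / real (k + 1)) * W.energy k (a k + b k) \<le>
        ennreal (pi / real (k + 1)) * (2 * W.energy k (a k) + 2 * W.energy k (b k))"
      by (rule mult_left_mono) simp
    then show "ennreal (pi / real (k + 1)) * W.energy k ((a + b) k) \<le>
        2 * (ennreal (pi / real (k + 1)) * W.energy k (a k)) + 2 * (ennreal (pi / real (k + 1)) * W.energy k (b k))"
      by (simp add: distrib_left mult_ac)
  qed
  also have "\<dots> = 2 * Y_energy a + 2 * Y_energy b"
    unfolding Y_energy_def by (simp add: suminf_add[symmetric] ennreal_suminf_cmult)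
  also have "\<dots> < \<infinity>"
    using Y_D(2)[OF assms(1)] Y_D(2)[OF assms(2)] by (simp add: ennreal_mult_less_top)
  finally show "Y_energy (a + b) < \<infinity>" .
qed

lemma Y_scale_eq: "Y_scale c a = (\<lambda>k. A2_scale c (a k))"
  by (simp add: Y_scale_def A2_scale_def)

lemma Y_scale_closed:
  assumes "a \<in> Y_space n p"
  shows "Y_scale c a \<in> Y_space n p"
  unfolding Y_space_iff Y_scale_eq
proof (intro conjI allI)
  show "A2_scale c (a k) \<in> A2 n B (weight k)" for k
    by (rule W.A2_scale_closed[OF Y_D(1)[OF assms]])
  have "Y_energy (\<lambda>k. A2_scale c (a k)) = ennreal ((cmod c)\<^sup>2) * Y_energy a"
    unfolding Y_energy_def ennreal_suminf_cmult[symmetric]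
    by (intro suminf_cong)
       (simp only: W.energy_scale[OF W.A2_D(4)[OF Y_D(1)[OF assms]]] mult.left_commute)
  then show "Y_energy (\<lambda>k. A2_scale c (a k)) < \<infinity>"
    using Y_D(2)[OF assms] by (simp add: ennreal_mult_less_top)
qed

lemma Y_zero: "0 \<in> Y_space n p"
  unfolding Y_space_iff
  using W.A2_zero by (auto simp: Y_energy_def W.energy_def)

text \<open>
  Membership in \<open>Y_space n p\<close> controls the diagonal terms; the mixed ones are
  dominated by their sum.
\<close>

lemma Y_inner_summable:
  assumes "a \<in> Y_space n p" "b \<in> Y_space n p"
  shows "summable (\<lambda>k. of_real (1 / real (k + 1)) * W_inner k (a k) (b k))"
proof (rule summable_comparison_test')
  show "summable (\<lambda>k. 1 / real (k + 1) * W_int k (a k) + 1 / real (k + 1) * W_int k (b k))"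
    using assms by (intro summable_add) (simp_all add: Y_space_weight)
  fix k :: nat
  have "cmod (W_inner k (a k) (b k)) \<le> W_int k (a k) + W_int k (b k)"
    by (rule W.A2_inner_integrable(2)[OF Y_D(1)[OF assms(1)] Y_D(1)[OF assms(2)]])
  then have "1 / real (k + 1) * cmod (W_inner k (a k) (b k)) \<le> 1 / real (k + 1) * (W_int k (a k) + W_int k (b k))"
    by (rule mult_left_mono) simp
  moreover have "cmod (of_real (1 / real (k + 1))) = 1 / real (k + 1)"
    unfolding norm_of_real by simp
  ultimately show "norm (of_real (1 / real (k + 1)) * W_inner k (a k) (b k)) \<le>
      1 / real (k + 1) * W_int k (a k) + 1 / real (k + 1) * W_int k (b k)"
    by (simp only: norm_mult distrib_left)
qed

lemma Y_inner_cnj: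
  assumes "a \<in> Y_space n p" "b \<in> Y_space n p"
  shows "Y_inner n p b a = cnj (Y_inner n p a b)"
proof -
  have "(\<lambda>k. cnj (of_real (1 / real (k + 1)) * W_inner k (a k) (b k))) sums
      cnj (\<Sum>k. of_real (1 / real (k + 1)) * W_inner k (a k) (b k))"
    using Y_inner_summable[OF assms] by (simp only: sums_cnj summable_sums)
  also have "(\<lambda>k. cnj (of_real (1 / real (k + 1)) * W_inner k (a k) (b k))) =
      (\<lambda>k. of_real (1 / real (k + 1)) * W_inner k (b k) (a k))"
    by (rule ext) (simp only: complex_cnj_mult complex_cnj_complex_of_real W.A2_inner_cnj[symmetric])
  finally show ?thesis by (simp add: Y_inner_weight sums_iff)
qed

lemma Y_inner_uminus: "Y_inner n p (- a) (- a) = Y_inner n p a a"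
  by (simp add: Y_inner_weight W.A2_inner_uminus)

text \<open>
  All axioms are inherited termwise from the spaces \<open>A2 n B (weight k)\<close>.
\<close>

lemma pre_hilbert_Y: "pre_hilbert_space Y_scale (Y_space n p) (Y_inner n p)"
proof -
  interpret V: vector_space Y_scale
    by standard (auto simp: Y_scale_def fun_eq_iff algebra_simps)
  have "V.subspace (Y_space n p)"
    using Y_zero Y_add Y_scale_closed by (intro V.subspaceI) auto
  moreover have "Y_inner n p (a + b) c = Y_inner n p a c + Y_inner n p b c"
    if "a \<in> Y_space n p" "b \<in> Y_space n p" "c \<in> Y_space n p" for a b c
  proof -
    have "(\<lambda>k. of_real (1 / real (k + 1)) * W_inner k ((a + b) k) (c k)) =
        (\<lambda>k. of_real (1 / real (k + 1)) * W_inner k (a k) (c k) + of_real (1 / real (k + 1)) * W_inner k (b k) (c k))"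
      by (rule ext) (simp only: plus_fun_apply distrib_left W.A2_inner_add[OF that[THEN Y_D(1)]])
    then show ?thesis
      unfolding Y_inner_weight
      using suminf_add[OF Y_inner_summable[OF that(1,3)] Y_inner_summable[OF that(2,3)]]
      by (simp only: distrib_left[symmetric])
  qed
  moreover have "Y_inner n p (Y_scale c a) b = c * Y_inner n p a b"
    if "a \<in> Y_space n p" "b \<in> Y_space n p" for a b c
  proof -
    have "(\<lambda>k. of_real (1 / real (k + 1)) * W_inner k (Y_scale c a k) (b k)) =
        (\<lambda>k. c * (of_real (1 / real (k + 1)) * W_inner k (a k) (b k)))"
      by (rule ext) (simp only: Y_scale_eq W.A2_inner_scale mult.left_commute)
    then show ?thesis
      unfolding Y_inner_weight
      using suminf_mult[OF Y_inner_summable[OF that], of c]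
      by (simp only: mult.left_commute)
  qed
  moreover have self: "Y_inner n p a a = of_real (pi * (\<Sum>k. 1 / real (k + 1) * W_int k (a k)))"
    if "a \<in> Y_space n p" for a
  proof -
    have "(\<Sum>k. complex_of_real (1 / real (k + 1) * W_int k (a k))) =
        of_real (\<Sum>k. 1 / real (k + 1) * W_int k (a k))"
      using that by (intro suminf_of_real[symmetric]) (simp add: Y_space_weight)
    then show ?thesis
      by (simp only: Y_inner_weight A2_inner_self of_real_mult)
  qed
  moreover have "0 \<le> Re (Y_inner n p a a)" if "a \<in> Y_space n p" for a
    unfolding self[OF that] Re_complex_of_real using that
    by (intro mult_nonneg_nonneg suminf_nonneg W_int_nonneg) (auto simp: Y_space_weight)
  moreover have "a = 0" if a: "a \<in> Y_space n p" "Y_inner n p a a = 0" for a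
  proof
    fix k
    have "Y_energy a = 0"
      using Y_energy_eq_hnorm[OF a(1)] a(2) by (simp add: hnorm_def)
    then have "(\<Sum>k. ennreal (pi / real (k + 1)) * W.energy k (a k)) = 0"
      by (simp only: Y_energy_def)
    then have "ennreal (pi / real (k + 1)) * W.energy k (a k) = 0"
      by (subst (asm) suminf_eq_zero_iff[OF summableI]) auto
    then have "W.energy k (a k) = 0"
      using radial_factor_neq_0[of k] by (auto simp only: mult_eq_0_iff)
    then show "a k = 0 k"
      using W.energy_zero_imp_zero[OF Y_D(1)[OF a(1)]] by simp
  qed
  ultimately show ?thesis
    unfolding pre_hilbert_space_def
    by (intro conjI ballI allI impI V.vector_space_axioms Y_inner_cnj) simp_all
qed

end

section \<open>Power series in the first coordinate\<close>

text \<open>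
  The quotient is \<open>c k\<close> plus the tail \<open>\<Sum>i. c (k + 1 + i) * s ^ (i +
  1)\<close>, which is dominated by a geometric series of ratio \<open>s / \<rho> \<le> 1 /
  2\<close>. The bound is uniform in any parameter on which \<open>c\<close> and
  \<open>F\<close> may depend.
\<close>

lemma power_series_remainder_bound:
  fixes c :: "nat \<Rightarrow> complex"
  assumes sums: "(\<lambda>l. c l * complex_of_real s ^ l) sums F"
    and c: "\<And>l. cmod (c l) \<le> M / \<rho> ^ l" and s: "0 < s" "2 * s \<le> \<rho>"
  shows "cmod ((F - (\<Sum>j<k. c j * complex_of_real s ^ j)) / complex_of_real s ^ k - c k) \<le> 2 * M / \<rho> ^ k * (s / \<rho>)"
proof -
  let ?t = "s / \<rho>"
  let ?z = "complex_of_real s"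
  have \<rho>: "0 < \<rho>" and t: "0 < ?t" "?t \<le> 1 / 2" using s by (simp_all add: field_simps)
  have M: "0 \<le> M" using c[of 0] norm_ge_zero[of "c 0"] by (simp del: norm_ge_zero)
  have "(\<lambda>i. c (i + (k + 1)) * ?z ^ (i + (k + 1))) sums (F - (\<Sum>j<k + 1. c j * ?z ^ j))"
    by (rule sums_split_initial_segment[OF sums])
  moreover have "(\<lambda>i. M * ?t ^ (k + 1) * ?t ^ i) sums (M * ?t ^ (k + 1) * (1 / (1 - ?t)))"
    using t s(1) \<rho> by (intro sums_mult geometric_sums) (simp add: field_simps)
  moreover have "cmod (c (i + (k + 1)) * ?z ^ (i + (k + 1))) \<le> M * ?t ^ (k + 1) * ?t ^ i" for i
  proof -
    have "cmod (c (i + (k + 1)) * ?z ^ (i + (k + 1))) \<le> M / \<rho> ^ (i + (k + 1)) * s ^ (i + (k + 1))"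
      using s(1) unfolding norm_mult norm_power norm_of_real by (intro mult_mono c) (use M \<rho> s(1) in auto)
    also have "\<dots> = M * ?t ^ (i + (k + 1))" by (simp add: power_divide)
    also have "\<dots> = M * ?t ^ (k + 1) * ?t ^ i" by (simp add: power_add)
    finally show ?thesis .
  qed
  ultimately have "cmod (F - (\<Sum>j<k + 1. c j * ?z ^ j)) \<le> M * ?t ^ (k + 1) * (1 / (1 - ?t))"
    by (metis (no_types, lifting) norm_suminf_le sums_iff)
  also have "\<dots> \<le> M * ?t ^ (k + 1) * 2"
  proof (rule mult_left_mono)
    have "1 / (1 - ?t) \<le> 1 / (1 / 2)" using t(2) by (intro divide_left_mono mult_pos_pos) linarith+
    then show "1 / (1 - ?t) \<le> 2" by simp
    show "0 \<le> M * ?t ^ (k + 1)" by (intro mult_nonneg_nonneg zero_le_power M less_imp_le[OF t(1)])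
  qed
  finally have le: "cmod (F - (\<Sum>j<k + 1. c j * ?z ^ j)) \<le> M * ?t ^ (k + 1) * 2" .
  have "(F - (\<Sum>j<k. c j * ?z ^ j)) / ?z ^ k - c k = (F - (\<Sum>j<k + 1. c j * ?z ^ j)) / ?z ^ k"
    using s(1) by (simp add: field_simps)
  then have "cmod ((F - (\<Sum>j<k. c j * ?z ^ j)) / ?z ^ k - c k) = cmod (F - (\<Sum>j<k + 1. c j * ?z ^ j)) / s ^ k"
    using s(1) by (simp add: norm_divide norm_power)
  also have "\<dots> \<le> M * ?t ^ (k + 1) * 2 / s ^ k"
    by (intro divide_right_mono le) (use s in simp)
  also have "\<dots> = 2 * M / \<rho> ^ k * ?t"
    using s(1) by (simp add: power_divide ac_simps)
  finally show ?thesis .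
qed

context hartogs_domain
begin

definition taylor_coeff :: "((nat \<Rightarrow> complex) \<Rightarrow> complex) \<Rightarrow> nat \<Rightarrow> (nat \<Rightarrow> complex) \<Rightarrow> complex" where
  "taylor_coeff f k w = (if w \<in> B then (deriv ^^ k) (\<lambda>z. f (case_nat z w)) 0 / fact k else 0)"

lemma taylor_coeff_sums:
  assumes f: "holomorphic_Cn (Suc n) E f" and z: "case_nat z w \<in> E"
  shows "(\<lambda>k. taylor_coeff f k w * z ^ k) sums f (case_nat z w)"
proof -
  have w: "w \<in> B" "w \<in> Cn n" "(cmod z)\<^sup>2 < 1 - p w"
    using in_B_if_in_E[OF z] z by (auto simp: case_nat_in_E)
  define R where "R = sqrt (1 - p w)"
  have "\<zeta> \<in> {\<zeta>. case_nat \<zeta> w \<in> E}" if "cmod \<zeta> < R" for \<zeta>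
  proof -
    have "(cmod \<zeta>)\<^sup>2 < R\<^sup>2" using that by (intro power_strict_mono) auto
    then show ?thesis using w zero_le_power2[of "cmod z"] by (simp add: case_nat_in_E R_def del: zero_le_power2)
  qed
  then have "(\<lambda>\<zeta>. f (case_nat \<zeta> w)) holomorphic_on ball 0 R"
    by (intro holomorphic_on_subset[OF holomorphic_Cn_first_coordinate[OF f]]) auto
  moreover have "z \<in> ball 0 R" using w(3) by (simp add: R_def real_less_rsqrt)
  ultimately show ?thesis
    using holomorphic_power_series[of "\<lambda>\<zeta>. f (case_nat \<zeta> w)" 0 R z] w(1) by (simp add: taylor_coeff_def)
qed

text \<open>
  Cauchy's inequality on the circles \<open>cmod z = \<rho>\<close>, uniformly in
  \<open>w\<close>. The bound on \<open>f\<close> over these circles comes from the square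
  integral of \<open>f\<close>, so no compactness argument is involved.
\<close>

lemma taylor_coeff_local_bound:
  assumes f: "f \<in> A2 (Suc n) E (\<lambda>_. 1)" and w\<^sub>0: "w\<^sub>0 \<in> B"
  obtains \<delta> \<rho> M where "0 < \<delta>" "0 < \<rho>"
    "\<And>w z. w \<in> polydisc n w\<^sub>0 \<delta> \<Longrightarrow> cmod z \<le> \<rho> \<Longrightarrow> case_nat z w \<in> E"
    "\<And>w k. w \<in> polydisc n w\<^sub>0 \<delta> \<Longrightarrow> cmod (taylor_coeff f k w) \<le> M / \<rho> ^ k"
proof -
  have w0: "w\<^sub>0 \<in> Cn n" "p w\<^sub>0 < 1" using w\<^sub>0 by (simp_all add: ball_p_def)
  (* The fibres over points near w0 contain the disc of radius \<sigma>. Circles of half that radius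
     keep polydiscs of radius r inside the domain. *)
  define \<sigma> where "\<sigma> = sqrt ((1 - p w\<^sub>0) / 2)"
  have \<sigma>: "0 < \<sigma>" "\<sigma>\<^sup>2 = (1 - p w\<^sub>0) / 2" using w0 by (simp_all add: \<sigma>_def)
  then have "p w\<^sub>0 < 1 - \<sigma>\<^sup>2" using w0(2) by (simp add: field_simps)
  then obtain \<delta> where \<delta>: "0 < \<delta>" "\<And>w. w \<in> polydisc n w\<^sub>0 \<delta> \<Longrightarrow> p w < 1 - \<sigma>\<^sup>2"
    using tube[OF w0(1)] by blast
  have inE: "case_nat z w \<in> E" if "w \<in> polydisc n w\<^sub>0 \<delta>" "cmod z \<le> \<sigma>" for w z
  proof -
    have "(cmod z)\<^sup>2 \<le> \<sigma>\<^sup>2" using that(2) by (intro power_mono) auto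
    then show ?thesis using \<delta>(2)[OF that(1)] that(1) by (simp add: case_nat_in_E polydisc_def)
  qed
  define \<rho> where "\<rho> = \<sigma> / 2"
  define r where "r = min (\<delta> / 2) \<rho>"
  have \<rho>: "0 < \<rho>" and r: "0 < r" "\<delta> / 2 + r \<le> \<delta>" "\<rho> + r \<le> \<sigma>"
    using \<sigma>(1) \<delta>(1) by (auto simp: \<rho>_def r_def)
  define K where "K = (pi * r\<^sup>2) ^ Suc n"
  have K: "0 < K" using r(1) by (simp add: K_def)
  define M where "M = sqrt (enn2real (A.energy f) / K)"
  have bound: "cmod (f (case_nat z w)) \<le> M" if w: "w \<in> polydisc n w\<^sub>0 (\<delta> / 2)" and z: "cmod z \<le> \<rho>" for w z
  proof -
    have sub: "polydisc (Suc n) (case_nat z w) r \<subseteq> E"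
    proof
      fix v assume v: "v \<in> polydisc (Suc n) (case_nat z w) r"
      then have "v \<in> Cn (Suc n)" by (simp add: polydisc_def)
      then obtain z' w' where v': "v = case_nat z' w'" "w' \<in> Cn n" by (rule Cn_SucE)
      with v have "dist z z' < r" "w' \<in> polydisc n w r" by (simp_all add: polydisc_Suc)
      moreover have "cmod z' \<le> cmod z + dist z z'"
        using norm_triangle_ineq2[of z' z] by (simp add: dist_norm norm_minus_commute)
      ultimately show "v \<in> E"
        unfolding v'(1) using polydisc_subset_polydisc[OF w r(2)] z r(3) by (intro inE) auto
    qed
    have "ennreal ((cmod (f (case_nat z w)))\<^sup>2 * ((pi * r\<^sup>2) ^ Suc n * 1)) \<le> A.energy f"
      using w by (intro A.polydisc_energy_bound[OF A.A2_D(1)[OF f] _ r(1) sub]) (simp_all add: polydisc_def)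
    then have "ennreal ((cmod (f (case_nat z w)))\<^sup>2 * K) \<le> ennreal (enn2real (A.energy f))"
      using A.A2_D(3)[OF f] by (simp add: K_def less_top)
    then have "(cmod (f (case_nat z w)))\<^sup>2 * K \<le> enn2real (A.energy f)"
      by (subst (asm) ennreal_le_iff) simp_all
    then have "(cmod (f (case_nat z w)))\<^sup>2 \<le> enn2real (A.energy f) / K"
      using K by (simp add: field_simps)
    then show ?thesis unfolding M_def by (rule real_le_rsqrt)
  qed
  have sub: "polydisc n w\<^sub>0 (\<delta> / 2) \<subseteq> polydisc n w\<^sub>0 \<delta>"
    by (rule polydisc_mono) (use \<delta>(1) in simp)
  have E\<rho>: "case_nat z w \<in> E" if "w \<in> polydisc n w\<^sub>0 (\<delta> / 2)" "cmod z \<le> \<rho>" for w z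
    using that sub \<sigma>(1) by (intro inE) (auto simp: \<rho>_def)
  show thesis
  proof (rule that[of "\<delta> / 2" \<rho> M])
    show "0 < \<delta> / 2" "0 < \<rho>" using \<delta>(1) \<rho> by simp_all
    show "case_nat z w \<in> E" if "w \<in> polydisc n w\<^sub>0 (\<delta> / 2)" "cmod z \<le> \<rho>" for w z
      using that by (rule E\<rho>)
    fix w k assume w: "w \<in> polydisc n w\<^sub>0 (\<delta> / 2)"
    have wB: "w \<in> B" by (rule in_B_if_in_E[OF E\<rho>[OF w, of 0]]) (use \<rho> in simp)
    have hol: "(\<lambda>\<zeta>. f (case_nat \<zeta> w)) holomorphic_on cball 0 \<rho>"
      by (rule holomorphic_on_subset[OF holomorphic_Cn_first_coordinate[OF A.A2_D(1)[OF f]]])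
         (use E\<rho>[OF w] in auto)
    have "cmod ((deriv ^^ k) (\<lambda>\<zeta>. f (case_nat \<zeta> w)) 0) \<le> fact k * M / \<rho> ^ k"
    proof (rule Cauchy_inequality[OF _ _ \<rho>])
      show "(\<lambda>\<zeta>. f (case_nat \<zeta> w)) holomorphic_on ball 0 \<rho>"
        by (rule holomorphic_on_subset[OF hol ball_subset_cball])
      show "continuous_on (cball 0 \<rho>) (\<lambda>\<zeta>. f (case_nat \<zeta> w))"
        by (rule holomorphic_on_imp_continuous_on[OF hol])
      show "cmod (f (case_nat x w)) \<le> M" if "cmod (0 - x) = \<rho>" for x
        using that by (intro bound[OF w]) simp
    qed
    then show "cmod (taylor_coeff f k w) \<le> M / \<rho> ^ k"
      using wB by (simp add: taylor_coeff_def norm_divide field_simps)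
  qed
qed

text \<open>
  Induction on \<open>k\<close>: for fixed small \<open>s\<close>, subtracting the earlier terms
  from \<open>f (s, w)\<close> and dividing by \<open>s ^ k\<close> gives a holomorphic function
  of \<open>w\<close>, and these converge to the coefficient locally uniformly as \<open>s
  \<longrightarrow> 0\<close>. This avoids differentiating under an integral sign.
\<close>

lemma taylor_coeff_holomorphic:
  assumes f: "f \<in> A2 (Suc n) E (\<lambda>_. 1)"
  shows "holomorphic_Cn n B (taylor_coeff f k)"
proof (induction k rule: less_induct)
  case (less k)
  show ?case
  proof (rule holomorphic_Cn_local[OF open_B])
    fix w\<^sub>0 assume "w\<^sub>0 \<in> B"
    from taylor_coeff_local_bound[OF f this]
    obtain \<delta> \<rho> M where \<delta>: "0 < \<delta>" and \<rho>: "0 < \<rho>"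
      and inE: "\<And>w z. w \<in> polydisc n w\<^sub>0 \<delta> \<Longrightarrow> cmod z \<le> \<rho> \<Longrightarrow> case_nat z w \<in> E"
      and bound: "\<And>w k. w \<in> polydisc n w\<^sub>0 \<delta> \<Longrightarrow> cmod (taylor_coeff f k w) \<le> M / \<rho> ^ k"
      by blast
    let ?P = "polydisc n w\<^sub>0 \<delta>"
    have PB: "?P \<subseteq> B"
      using inE[of _ 0] \<rho> by (auto intro: in_B_if_in_E)
    (* The sequence tends to 0 and satisfies 2 * s N \<le> \<rho>, as the remainder bound requires. *)
    define s where "s N = \<rho> / 2 * inverse (real (Suc N))" for N
    define F where "F N w = (f (case_nat (complex_of_real (s N)) w) -
        (\<Sum>j<k. taylor_coeff f j w * complex_of_real (s N) ^ j)) * inverse (complex_of_real (s N) ^ k)" for N w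
    have s: "0 < s N" "2 * s N \<le> \<rho>" for N
      using \<rho> by (simp_all add: s_def field_simps)
    have s\<rho>: "cmod (complex_of_real (s N)) \<le> \<rho>" for N
      using s[of N] by simp
    have F_hol: "holomorphic_Cn n ?P (F N)" for N
      unfolding F_def
    proof (intro holomorphic_Cn_mult holomorphic_Cn_diff holomorphic_Cn_sum holomorphic_Cn_const)
      show "holomorphic_Cn n ?P (\<lambda>w. f (case_nat (complex_of_real (s N)) w))"
        by (rule holomorphic_Cn_subset[OF holomorphic_Cn_fix_first[OF A.A2_D(1)[OF f]]])
           (use inE s\<rho> in blast)
      show "holomorphic_Cn n ?P (taylor_coeff f j)" if "j \<in> {..<k}" for j
        using that by (intro holomorphic_Cn_subset[OF less.IH PB]) simp
    qed
    have "uniform_limit ?P F (taylor_coeff f k) sequentially"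
    proof (rule uniform_limitI)
      fix e :: real assume e: "0 < e"
      have "(\<lambda>N. 2 * M / \<rho> ^ k * (s N / \<rho>)) \<longlonglongrightarrow> 2 * M / \<rho> ^ k * ((\<rho> / 2 * 0) / \<rho>)"
        unfolding s_def by (intro tendsto_intros LIMSEQ_inverse_real_of_nat) (use \<rho> in simp)
      then have "\<forall>\<^sub>F N in sequentially. 2 * M / \<rho> ^ k * (s N / \<rho>) < e"
        using e by (intro order_tendstoD(2)) simp_all
      then show "\<forall>\<^sub>F N in sequentially. \<forall>w\<in>?P. dist (F N w) (taylor_coeff f k w) < e"
      proof eventually_elim
        case (elim N)
        show ?case
        proof
          fix w assume w: "w \<in> ?P"
          have "dist (F N w) (taylor_coeff f k w) \<le> 2 * M / \<rho> ^ k * (s N / \<rho>)"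
            unfolding dist_norm F_def divide_inverse[symmetric]
            using taylor_coeff_sums[OF A.A2_D(1)[OF f] inE[OF w s\<rho>]] bound[OF w] s
            by (rule power_series_remainder_bound)
          with elim show "dist (F N w) (taylor_coeff f k w) < e" by simp
        qed
      qed
    qed
    then have "holomorphic_Cn n ?P (taylor_coeff f k)"
      by (rule holomorphic_Cn_uniform_limit[OF open_Cn_polydisc F_hol])
    with \<delta> show "\<exists>r>0. holomorphic_Cn n (polydisc n w\<^sub>0 r) (taylor_coeff f k)" by blast
  qed
qed

lemma taylor_coeff_in_Y:
  assumes f: "f \<in> A2 (Suc n) E (\<lambda>_. 1)"
  shows "taylor_coeff f \<in> Y_space n p"
proof -
  have "A.energy f = Y_energy (taylor_coeff f)"
    unfolding Y_energy_def
    by (rule energy_power_series[OF taylor_coeff_holomorphic[OF f] A.A2_D(1)[OF f] taylor_coeff_sums[OF A.A2_D(1)[OF f]]])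
  then have Y: "Y_energy (taylor_coeff f) < \<infinity>" using A.A2_D(3)[OF f] by simp
  have "taylor_coeff f k \<in> A2 n B (weight k)" for k
  proof (rule W.A2_I[OF taylor_coeff_holomorphic[OF f]])
    have "ennreal (pi / real (k + 1)) * W.energy k (taylor_coeff f k) \<le> Y_energy (taylor_coeff f)"
      unfolding Y_energy_def
      using sum_le_suminf[OF summableI, of "{k}" "\<lambda>k. ennreal (pi / real (k + 1)) * W.energy k (taylor_coeff f k)"] by simp
    also note Y
    finally show "W.energy k (taylor_coeff f k) < \<infinity>"
      using radial_factor_neq_0[of k] by (auto simp: ennreal_mult_less_top)
  qed (simp add: taylor_coeff_def)
  then show ?thesis using Y by (simp add: Y_space_iff)
qed

text \<open>
  Where \<open>1 - p w > \<rho>\<^sub>2\<^sup>2\<close>, the weight of \<open>a k\<close> is at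
  least \<open>\<rho>\<^sub>2 ^ (2 * (k + 1))\<close>. Hence the mean value inequality bounds
  \<open>(cmod (a k w))\<^sup>2\<close> by a constant times \<open>(k + 1) / \<rho>\<^sub>2 ^ (2
  * (k + 1))\<close>. For \<open>cmod z \<le> \<rho>\<^sub>1 < \<rho>\<^sub>2\<close> the terms
  \<open>a k w * z ^ k\<close> then decay geometrically, up to a factor that is polynomial in
  \<open>k\<close>.
\<close>

lemma Y_terms_locally_dominated:
  assumes a: "a \<in> Y_space n p" and E: "case_nat z\<^sub>0 w\<^sub>0 \<in> E"
  obtains r M where "0 < r" "summable M" "polydisc (Suc n) (case_nat z\<^sub>0 w\<^sub>0) r \<subseteq> E"
    "\<And>k v. v \<in> polydisc (Suc n) (case_nat z\<^sub>0 w\<^sub>0) r \<Longrightarrow> cmod (a k (v \<circ> Suc) * v 0 ^ k) \<le> M k"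
proof -
  have w0: "w\<^sub>0 \<in> Cn n" "(cmod z\<^sub>0)\<^sup>2 < 1 - p w\<^sub>0" using E by (simp_all add: case_nat_in_E)
  (* Two radii between cmod z0 and the radius of the fibre over w0: the outer one bounds the
     coefficients, the inner one bounds z. *)
  then have "cmod z\<^sub>0 < sqrt (1 - p w\<^sub>0)" by (simp add: real_less_rsqrt)
  then obtain \<rho>\<^sub>1 where \<rho>\<^sub>1: "cmod z\<^sub>0 < \<rho>\<^sub>1" "\<rho>\<^sub>1 < sqrt (1 - p w\<^sub>0)" using dense by blast
  then obtain \<rho>\<^sub>2 where \<rho>\<^sub>2: "\<rho>\<^sub>1 < \<rho>\<^sub>2" "\<rho>\<^sub>2 < sqrt (1 - p w\<^sub>0)" using dense by blast
  have pos: "0 < \<rho>\<^sub>1" "0 < \<rho>\<^sub>2" using \<rho>\<^sub>1(1) \<rho>\<^sub>2(1) norm_ge_zero[of z\<^sub>0] by linarith+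
  have "\<rho>\<^sub>2\<^sup>2 < (sqrt (1 - p w\<^sub>0))\<^sup>2" using \<rho>\<^sub>2(2) pos by (intro power_strict_mono) auto
  also have "\<dots> = 1 - p w\<^sub>0" using w0(2) zero_le_power2[of "cmod z\<^sub>0"] by (intro real_sqrt_pow2) linarith
  finally obtain \<delta> where \<delta>: "0 < \<delta>" "\<And>w. w \<in> polydisc n w\<^sub>0 \<delta> \<Longrightarrow> p w < 1 - \<rho>\<^sub>2\<^sup>2"
    using tube[OF w0(1), of "1 - \<rho>\<^sub>2\<^sup>2"] by auto
  have PB: "polydisc n w\<^sub>0 \<delta> \<subseteq> B"
  proof
    fix w assume "w \<in> polydisc n w\<^sub>0 \<delta>"
    moreover from this have "p w < 1" using \<delta>(2)[of w] zero_le_power2[of \<rho>\<^sub>2] by linarith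
    ultimately show "w \<in> B" by (simp add: ball_p_def polydisc_def)
  qed
  define K where "K = (pi * (\<delta> / 2)\<^sup>2) ^ n"
  have K: "0 < K" using \<delta>(1) by (simp add: K_def)
  define S where "S = enn2real (Y_energy a)"
  have S: "Y_energy a = ennreal S" "0 \<le> S" using Y_D(2)[OF a] by (simp_all add: S_def less_top)
  have coeff: "(cmod (a k w))\<^sup>2 * (K * \<rho>\<^sub>2 ^ (2 * (k + 1))) \<le> S * (real (k + 1) / pi)"
    if w: "w \<in> polydisc n w\<^sub>0 (\<delta> / 2)" for k w
  proof -
    have sub: "polydisc n w (\<delta> / 2) \<subseteq> polydisc n w\<^sub>0 \<delta>"
      by (rule polydisc_subset_polydisc[OF w]) simp
    have "ennreal ((cmod (a k w))\<^sup>2 * ((pi * (\<delta> / 2)\<^sup>2) ^ n * (\<rho>\<^sub>2\<^sup>2) ^ (k + 1))) \<le> W.energy k (a k)"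
    proof (rule W.polydisc_energy_bound[OF W.A2_D(1)[OF Y_D(1)[OF a]]])
      show "w \<in> Cn n" using w by (simp add: polydisc_def)
      show "polydisc n w (\<delta> / 2) \<subseteq> B" using sub PB by blast
      fix v assume "v \<in> polydisc n w (\<delta> / 2)"
      then have "p v < 1 - \<rho>\<^sub>2\<^sup>2" using sub \<delta>(2) by blast
      then show "(\<rho>\<^sub>2\<^sup>2) ^ (k + 1) \<le> weight k v"
        unfolding weight_def by (intro power_mono) auto
    qed (use \<delta>(1) in simp_all)
    then have "ennreal (pi / real (k + 1)) * ennreal ((cmod (a k w))\<^sup>2 * (K * (\<rho>\<^sub>2\<^sup>2) ^ (k + 1))) \<le>
        ennreal (pi / real (k + 1)) * W.energy k (a k)"
      unfolding K_def by (rule mult_left_mono) simp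
    also have "\<dots> \<le> Y_energy a"
      unfolding Y_energy_def
      using sum_le_suminf[OF summableI, of "{k}" "\<lambda>k. ennreal (pi / real (k + 1)) * W.energy k (a k)"] by simp
    finally have "ennreal (pi / real (k + 1) * ((cmod (a k w))\<^sup>2 * (K * (\<rho>\<^sub>2\<^sup>2) ^ (k + 1)))) \<le> ennreal S"
      using K S(1) by (subst ennreal_mult) auto
    then have "pi / real (k + 1) * ((cmod (a k w))\<^sup>2 * (K * (\<rho>\<^sub>2\<^sup>2) ^ (k + 1))) \<le> S"
      by (rule iffD1[OF ennreal_le_iff[OF S(2)]])
    then have "(cmod (a k w))\<^sup>2 * (K * (\<rho>\<^sub>2\<^sup>2) ^ (k + 1)) \<le> S * (real (k + 1) / pi)"
      by (simp add: field_simps)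
    then show ?thesis by (simp only: power_mult)
  qed
  define q where "q = \<rho>\<^sub>1 / \<rho>\<^sub>2"
  define C where "C = sqrt (S / (pi * K * \<rho>\<^sub>2\<^sup>2))"
  define M where "M k = C * (real (k + 1) * q ^ k)" for k
  define r where "r = min (\<delta> / 2) (\<rho>\<^sub>1 - cmod z\<^sub>0)"
  have q: "0 < q" "q < 1" using pos \<rho>\<^sub>2(1) by (simp_all add: q_def)
  have r: "0 < r" using \<delta>(1) \<rho>\<^sub>1(1) by (simp add: r_def)
  have split: "\<exists>z w. v = case_nat z w \<and> w \<in> polydisc n w\<^sub>0 (\<delta> / 2) \<and> cmod z \<le> \<rho>\<^sub>1"
    if v: "v \<in> polydisc (Suc n) (case_nat z\<^sub>0 w\<^sub>0) r" for v
  proof -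
    have "v \<in> Cn (Suc n)" using v by (simp add: polydisc_def)
    then obtain z w where zw: "v = case_nat z w" "w \<in> Cn n" by (rule Cn_SucE)
    with v have "dist z\<^sub>0 z < r" "w \<in> polydisc n w\<^sub>0 r" by (simp_all add: polydisc_Suc)
    moreover have "cmod z \<le> cmod z\<^sub>0 + dist z\<^sub>0 z"
      using norm_triangle_ineq2[of z z\<^sub>0] by (simp add: dist_norm norm_minus_commute)
    moreover have "r \<le> \<delta> / 2" "r \<le> \<rho>\<^sub>1 - cmod z\<^sub>0"
      unfolding r_def by (rule min.cobounded1 min.cobounded2)+
    moreover have "polydisc n w\<^sub>0 r \<subseteq> polydisc n w\<^sub>0 (\<delta> / 2)"
      unfolding r_def by (rule polydisc_mono[OF min.cobounded1])
    ultimately have "w \<in> polydisc n w\<^sub>0 (\<delta> / 2)" "cmod z \<le> \<rho>\<^sub>1" by auto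
    with zw(1) show ?thesis by blast
  qed
  show thesis
  proof (rule that[OF r, of M])
    have "(\<lambda>k. of_nat (Suc k) * q ^ k) sums (1 / (1 - q)\<^sup>2)"
      using q by (intro geometric_deriv_sums) simp
    then show "summable M"
      unfolding M_def by (intro summable_mult) (simp add: sums_iff)
    show "polydisc (Suc n) (case_nat z\<^sub>0 w\<^sub>0) r \<subseteq> E"
    proof
      fix v assume "v \<in> polydisc (Suc n) (case_nat z\<^sub>0 w\<^sub>0) r"
      then obtain z w where v: "v = case_nat z w" "w \<in> polydisc n w\<^sub>0 (\<delta> / 2)" "cmod z \<le> \<rho>\<^sub>1"
        using split by blast
      have "polydisc n w\<^sub>0 (\<delta> / 2) \<subseteq> polydisc n w\<^sub>0 \<delta>"
        by (rule polydisc_mono) (use \<delta>(1) in simp)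
      then have "p w < 1 - \<rho>\<^sub>2\<^sup>2" using v(2) \<delta>(2) by blast
      moreover have "(cmod z)\<^sup>2 \<le> \<rho>\<^sub>2\<^sup>2" using v(3) \<rho>\<^sub>2(1) by (intro power_mono) auto
      ultimately show "v \<in> E" using v(2) by (simp add: v(1) case_nat_in_E polydisc_def)
    qed
    fix k v assume "v \<in> polydisc (Suc n) (case_nat z\<^sub>0 w\<^sub>0) r"
    then obtain z w where v: "v = case_nat z w" "w \<in> polydisc n w\<^sub>0 (\<delta> / 2)" "cmod z \<le> \<rho>\<^sub>1"
      using split by blast
    have "v \<circ> Suc = w" "v 0 = z" by (auto simp: v(1))
    then have "(cmod (a k (v \<circ> Suc) * v 0 ^ k))\<^sup>2 = (cmod (a k w))\<^sup>2 * (cmod z) ^ (2 * k)"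
      by (simp add: norm_mult norm_power power_mult_distrib power_mult[symmetric] mult.commute)
    also have "\<dots> \<le> (cmod (a k w))\<^sup>2 * \<rho>\<^sub>1 ^ (2 * k)"
      using v(3) by (intro mult_left_mono power_mono) auto
    also have "\<dots> \<le> (S * (real (k + 1) / pi)) / (K * \<rho>\<^sub>2 ^ (2 * (k + 1))) * \<rho>\<^sub>1 ^ (2 * k)"
    proof (rule mult_right_mono)
      have "0 < K * \<rho>\<^sub>2 ^ (2 * (k + 1))" using K pos by simp
      then show "(cmod (a k w))\<^sup>2 \<le> (S * (real (k + 1) / pi)) / (K * \<rho>\<^sub>2 ^ (2 * (k + 1)))"
        using coeff[OF v(2), of k] by (simp only: pos_le_divide_eq)
    qed (use pos in simp)
    also have "\<dots> = S / (pi * K * \<rho>\<^sub>2\<^sup>2) * (real (k + 1) * (q ^ k)\<^sup>2)"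
    proof -
      have "\<rho>\<^sub>1 ^ (2 * k) = (\<rho>\<^sub>1 ^ k)\<^sup>2" "\<rho>\<^sub>2 ^ (2 * (k + 1)) = (\<rho>\<^sub>2 ^ k)\<^sup>2 * \<rho>\<^sub>2\<^sup>2"
        by (simp_all add: power_even_eq power_mult_distrib power2_eq_square)
      then show ?thesis using pos K by (simp only: q_def power_divide) (simp add: field_simps)
    qed
    (* Squaring k + 1 makes the bound a perfect square, so that no square root of k + 1 occurs. *)
    also have "\<dots> \<le> S / (pi * K * \<rho>\<^sub>2\<^sup>2) * ((real (k + 1))\<^sup>2 * (q ^ k)\<^sup>2)"
      using S(2) K by (intro mult_left_mono mult_right_mono) (auto simp: power2_eq_square)
    also have "\<dots> = (M k)\<^sup>2"
      using S(2) K by (simp add: M_def C_def power_mult_distrib)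
    finally have sq: "(cmod (a k (v \<circ> Suc) * v 0 ^ k))\<^sup>2 \<le> (M k)\<^sup>2" .
    have "0 \<le> M k" using q S(2) K by (simp add: M_def C_def)
    with sq show "cmod (a k (v \<circ> Suc) * v 0 ^ k) \<le> M k" by (rule power2_le_imp_le)
  qed
qed

end

section \<open>The isometry\<close>

context hartogs_domain
begin

lemma Y_power_series_sums:
  assumes a: "a \<in> Y_space n p" and E: "case_nat z w \<in> E"
  shows "(\<lambda>k. a k w * z ^ k) sums T_map n p a (case_nat z w)"
proof -
  obtain r M where r: "0 < r" and M: "summable M"
    and le: "\<And>k v. v \<in> polydisc (Suc n) (case_nat z w) r \<Longrightarrow> cmod (a k (v \<circ> Suc) * v 0 ^ k) \<le> M k"
    by (rule Y_terms_locally_dominated[OF a E]) blast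
  have shift: "case_nat z w \<circ> Suc = w" by auto
  have "case_nat z w \<in> polydisc (Suc n) (case_nat z w) r"
    by (rule centre_in_polydisc[OF subsetD[OF E_subset E] r])
  from le[OF this] have "cmod (a k w * z ^ k) \<le> M k" for k
    by (simp only: shift nat.case(1))
  then have "summable (\<lambda>k. a k w * z ^ k)"
    by (rule summable_comparison_test'[OF M])
  then show ?thesis
    unfolding T_map_def if_P[OF E] shift nat.case(1) by (rule summable_sums)
qed

text \<open>
  The partial sums are holomorphic, and by the Weierstrass M-test they converge locally
  uniformly.
\<close>

lemma T_map_holomorphic:
  assumes a: "a \<in> Y_space n p"
  shows "holomorphic_Cn (Suc n) E (T_map n p a)"
proof (rule holomorphic_Cn_local[OF open_E])
  fix v\<^sub>0 assume v0: "v\<^sub>0 \<in> E"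
  obtain z w where zw: "v\<^sub>0 = case_nat z w"
    by (rule Cn_SucE[OF subsetD[OF E_subset v0]])
  obtain r M where r: "0 < r" and M: "summable M" and PE: "polydisc (Suc n) v\<^sub>0 r \<subseteq> E"
    and le: "\<And>k v. v \<in> polydisc (Suc n) v\<^sub>0 r \<Longrightarrow> cmod (a k (v \<circ> Suc) * v 0 ^ k) \<le> M k"
    unfolding zw by (rule Y_terms_locally_dominated[OF a v0[unfolded zw]]) blast
  let ?P = "polydisc (Suc n) v\<^sub>0 r"
  have PB: "v \<circ> Suc \<in> B" if "v \<in> ?P" for v
  proof (rule in_B_if_in_E)
    have "case_nat (v 0) (v \<circ> Suc) = v" by (auto split: nat.split)
    then show "case_nat (v 0) (v \<circ> Suc) \<in> E" using that PE by auto
  qed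
  have sum_eq: "(\<Sum>k. a k (v \<circ> Suc) * v 0 ^ k) = T_map n p a v" if "v \<in> ?P" for v
    using that PE by (auto simp: T_map_def)
  have "uniform_limit ?P (\<lambda>N v. \<Sum>k<N. a k (v \<circ> Suc) * v 0 ^ k) (\<lambda>v. \<Sum>k. a k (v \<circ> Suc) * v 0 ^ k) sequentially"
    by (rule Weierstrass_m_test[OF le M])
  then have lim: "uniform_limit ?P (\<lambda>N v. \<Sum>k<N. a k (v \<circ> Suc) * v 0 ^ k) (T_map n p a) sequentially"
    by (rule uniform_limit_cong'[THEN iffD1, rotated 2]) (simp_all only: sum_eq)
  have "holomorphic_Cn (Suc n) ?P (T_map n p a)"
  proof (rule holomorphic_Cn_uniform_limit[OF open_Cn_polydisc _ lim])
    show "holomorphic_Cn (Suc n) ?P (\<lambda>v. \<Sum>k<N. a k (v \<circ> Suc) * v 0 ^ k)" for N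
      by (intro holomorphic_Cn_sum holomorphic_Cn_mult holomorphic_Cn_first_power
          holomorphic_Cn_shift[OF W.A2_D(1)[OF Y_D(1)[OF a]]] PB)
  qed
  with r show "\<exists>r>0. holomorphic_Cn (Suc n) (polydisc (Suc n) v\<^sub>0 r) (T_map n p a)" by blast
qed

lemma T_map_energy:
  assumes a: "a \<in> Y_space n p"
  shows "A.energy (T_map n p a) = Y_energy a"
  unfolding Y_energy_def
  by (rule energy_power_series[OF W.A2_D(1)[OF Y_D(1)[OF a]] T_map_holomorphic[OF a] Y_power_series_sums[OF a]])

lemma T_map_in_A2:
  assumes a: "a \<in> Y_space n p"
  shows "T_map n p a \<in> A2 (Suc n) E (\<lambda>_. 1)"
  using T_map_holomorphic[OF a] Y_D(2)[OF a] T_map_energy[OF a]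
  by (intro A.A2_I) (simp_all add: T_map_def)

lemma T_map_isometric:
  assumes a: "a \<in> Y_space n p"
  shows "hnorm (A2_inner (Suc n) E (\<lambda>_. 1)) (T_map n p a) = hnorm (Y_inner n p) a"
proof -
  have "ennreal ((hnorm (A2_inner (Suc n) E (\<lambda>_. 1)) (T_map n p a))\<^sup>2) = ennreal ((hnorm (Y_inner n p) a)\<^sup>2)"
    using T_map_energy[OF a] A.energy_eq_hnorm[OF T_map_in_A2[OF a]] Y_energy_eq_hnorm[OF a] by simp
  then have "(hnorm (A2_inner (Suc n) E (\<lambda>_. 1)) (T_map n p a))\<^sup>2 = (hnorm (Y_inner n p) a)\<^sup>2"
    by (subst (asm) ennreal_inj) simp_all
  then show ?thesis
    by (rule power2_eq_imp_eq) (simp_all add: hnorm_def)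
qed

text \<open>
  Sums of convergent series are unique, so a function with the right expansion is the image of
  its coefficients; linearity and surjectivity are both instances.
\<close>

lemma T_map_eqI:
  assumes a: "a \<in> Y_space n p" and f: "\<And>v. v \<notin> E \<Longrightarrow> f v = 0"
    and sums: "\<And>z w. case_nat z w \<in> E \<Longrightarrow> (\<lambda>k. a k w * z ^ k) sums f (case_nat z w)"
  shows "T_map n p a = f"
proof
  fix v show "T_map n p a v = f v"
  proof (cases "v \<in> E")
    case True
    obtain z w where v: "v = case_nat z w"
      by (rule Cn_SucE[OF subsetD[OF E_subset True]])
    show ?thesis
      unfolding v by (rule sums_unique2[OF Y_power_series_sums[OF a] sums]) (use True v in simp_all)
  qed (simp add: T_map_def f)
qed

lemma T_map_add:
  assumes "a \<in> Y_space n p" "b \<in> Y_space n p"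
  shows "T_map n p (a + b) = T_map n p a + T_map n p b"
proof (rule T_map_eqI[OF Y_add[OF assms]])
  fix z w assume "case_nat z w \<in> E"
  then show "(\<lambda>k. (a + b) k w * z ^ k) sums (T_map n p a + T_map n p b) (case_nat z w)"
    using sums_add[OF Y_power_series_sums[OF assms(1)] Y_power_series_sums[OF assms(2)]]
    by (simp add: distrib_right)
qed (simp add: T_map_def)

lemma T_map_scale:
  assumes "a \<in> Y_space n p"
  shows "T_map n p (Y_scale c a) = A2_scale c (T_map n p a)"
proof (rule T_map_eqI[OF Y_scale_closed[OF assms]])
  fix z w assume "case_nat z w \<in> E"
  then show "(\<lambda>k. Y_scale c a k w * z ^ k) sums A2_scale c (T_map n p a) (case_nat z w)"
    using sums_mult[OF Y_power_series_sums[OF assms], of z w c]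
    by (simp add: Y_scale_def A2_scale_def mult.assoc)
qed (simp add: T_map_def A2_scale_def)

lemma T_map_surj: "T_map n p ` Y_space n p = A2 (Suc n) E (\<lambda>_. 1)"
proof (intro equalityI subsetI)
  fix f assume f: "f \<in> A2 (Suc n) E (\<lambda>_. 1)"
  have "T_map n p (taylor_coeff f) = f"
    using A.A2_D(2)[OF f] taylor_coeff_sums[OF A.A2_D(1)[OF f]]
    by (intro T_map_eqI taylor_coeff_in_Y[OF f])
  then show "f \<in> T_map n p ` Y_space n p"
    by (rule image_eqI[OF sym taylor_coeff_in_Y[OF f]])
next
  fix f assume "f \<in> T_map n p ` Y_space n p"
  then show "f \<in> A2 (Suc n) E (\<lambda>_. 1)" using T_map_in_A2 by blast
qed

lemma isometric_isomorphism_T_map: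
  "isometric_isomorphism Y_scale (Y_space n p) (Y_inner n p)
     A2_scale (A2 (Suc n) E (\<lambda>_. 1)) (A2_inner (Suc n) E (\<lambda>_. 1)) (T_map n p)"
  by (rule isometric_isomorphismI[OF pre_hilbert_Y Y_inner_uminus A.hilbert_space_A2 A.A2_inner_uminus
        T_map_surj T_map_add T_map_scale T_map_isometric])

end

text \<open>
  On \<open>Cn n\<close> the function is the real part of a polynomial in the coordinates and
  their conjugates.
\<close>

lemma weighted_homogeneous_balanced_continuous:
  assumes "weighted_homogeneous_balanced n m p"
  shows "continuous_on (Cn n) p"
proof -
  obtain C where C: "\<And>w. w \<in> Cn n \<Longrightarrow> complex_of_real (p w) =
      (\<Sum>\<alpha>\<in>half_weight_indices n m. \<Sum>\<beta>\<in>half_weight_indices n m.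
         C \<alpha> \<beta> * (\<Prod>i<n. w i ^ \<alpha> i) * (\<Prod>i<n. cnj (w i) ^ \<beta> i))"
    using assms unfolding weighted_homogeneous_balanced_def by blast
  let ?q = "\<lambda>w. \<Sum>\<alpha>\<in>half_weight_indices n m. \<Sum>\<beta>\<in>half_weight_indices n m.
         C \<alpha> \<beta> * (\<Prod>i<n. w i ^ \<alpha> i) * (\<Prod>i<n. cnj (w i) ^ \<beta> i)"
  have "continuous_on (Cn n) ?q"
    by (intro continuous_on_sum continuous_on_mult continuous_on_prod continuous_on_power
        continuous_on_cnj continuous_on_const continuous_on_component)
  then have "continuous_on (Cn n) (\<lambda>w. Re (?q w))"
    by (rule continuous_on_Re)
  also have "continuous_on (Cn n) (\<lambda>w. Re (?q w)) \<longleftrightarrow> continuous_on (Cn n) p"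
    by (intro continuous_on_cong refl) (simp only: C[symmetric] Re_complex_of_real)
  finally show ?thesis .
qed

theorem theorem1:
  fixes n :: nat and m :: "nat \<Rightarrow> nat" and p :: "(nat \<Rightarrow> complex) \<Rightarrow> real"
  assumes "\<forall>i<n. 0 < m i"
    and "weighted_homogeneous_balanced n m p"
    and "\<forall>w\<in>Cn n. 0 \<le> p w"
  shows "(\<forall>a\<in>Y_space n p. \<forall>z. \<forall>w\<in>Cn n. (cmod z)\<^sup>2 + p w < 1 \<longrightarrow> summable (\<lambda>k. a k w * z ^ k)) \<and>
    isometric_isomorphism
      Y_scale (Y_space n p) (Y_inner n p)
      A2_scale (A2 (Suc n) (ellipsoid_p n p) (\<lambda>_. 1))
        (A2_inner (Suc n) (ellipsoid_p n p) (\<lambda>_. 1))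
      (T_map n p)"
proof -
  interpret hartogs_domain n p
    by standard (rule weighted_homogeneous_balanced_continuous[OF assms(2)])
  show ?thesis
  proof (intro conjI ballI allI impI isometric_isomorphism_T_map)
    fix a z w assume "a \<in> Y_space n p" "w \<in> Cn n" "(cmod z)\<^sup>2 + p w < 1"
    then show "summable (\<lambda>k. a k w * z ^ k)"
      by (intro sums_summable[OF Y_power_series_sums]) (simp_all add: case_nat_in_E)
  qed
qed

end
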